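(* Let $N\ge1$ and let $X=X_1\times\cdots\times X_N$ be a product of based spaces such that, for each $i=1,\dots,N$, $$\Sigma X_i\simeq S^{d_{i,1}+1}\vee\cdots\vee S^{d_{i,n_i}+1}$$ for some integers $d_{i,1},\dots,d_{i,n_i}\ge1$. Let $Y$ be a based space, with $X_1,\dots,X_N$ and $Y$ satisfying the standing assumptions in the context. Then for $n\ge1$ there is an isomorphism $$G_n\big(\mathrm{map}(X,Y;0)\big)\cong G_n(Y)\oplus\bigoplus_{r=1}^{N}\ \bigoplus_{\substack{1\le i_1<i_2<\cdots<i_r\le N\\ 1\le m_j\le n_{i_j}\ (j=1,\dots,r)}}G_{\,n+d_{i_1,m_1}+\cdots+d_{i_r,m_r}}(Y),$$ where, for each $r$, the inner sum runs over all $r$-tuples $1\le i_1<\cdots<i_r\le N$ and all $m_j$ with $1\le m_j\le n_{i_j}$.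
   Context: Standing assumptions: $X_1,\dots,X_N$ and $Y$ are based spaces that are connected, locally compact, Hausdorff and well-pointed (no finiteness or simple connectivity is assumed). $\Sigma$ is reduced suspension and $\simeq$ is based homotopy equivalence. Mapping spaces consist of unbased maps and carry the compact-open topology. $\mathrm{map}(X,Y;0)$ denotes the path component of the null (constant) map in the space of unbased maps $X\to Y$, based at the constant map at the basepoint of $Y$. For a based space $Z$, $\mathrm{aut}_1 Z$ denotes the path component of the identity map $1_Z$ in the space of unbased self-maps of $Z$, based at $1_Z$, and $\omega\colon \mathrm{aut}_1 Z\to Z$ is evaluation at the basepoint of $Z$. The $n$th Gottlieb group $G_n(Z)$ ($n\ge1$) is the image of $\omega_\#\colon\pi_n(\mathrm{aut}_1 Z)\to\pi_n(Z)$; it is abelian.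
   Formalization: "Connected" is taken to mean path connected; for the X_i this follows from the other hypotheses, but for Y merely connected in the point-set sense the claim fails (a circle with a sine-type ray accumulating on an arc of it, X=S^1, n=1). *)

theory Defs
  imports "HOL-Analysis.Analysis" "HOL-Algebra.Product_Groups"
begin

section \<open>Based spaces\<close>

text \<open>A based space is a pair of a topology and a point of it; membership of the point in
  the space is stated where it is needed.\<close>

type_synonym 'a based_space = "'a topology \<times> 'a"

abbreviation unit_interval :: "real topology" where
  "unit_interval \<equiv> top_of_set {0..1}"

definition homotopy_extension_property ::
    "'a topology \<Rightarrow> 'a set \<Rightarrow> 'z topology \<Rightarrow> bool" where
  "homotopy_extension_property X A Z \<longleftrightarrow>
    (\<forall>f h. continuous_map X Z f \<and>
           continuous_map (prod_topology unit_interval (subtopology X A)) Z h \<and>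
           (\<forall>a\<in>A. h (0, a) = f a) \<longrightarrow>
      (\<exists>F. continuous_map (prod_topology unit_interval X) Z F \<and>
           (\<forall>x\<in>topspace X. F (0, x) = f x) \<and>
           (\<forall>t\<in>{0..1}. \<forall>a\<in>A. F (t, a) = h (t, a))))"

text \<open>Well-pointed means that the inclusion of the base point is a cofibration. A definition
  cannot quantify over the type of the test space, so the test spaces range over all topologies
  on \<open>real \<times> 'a\<close>. This type carries the mapping cylinder of the inclusion, and hence the
  condition implies the homotopy extension property for test spaces of every type when the base
  point is closed; this is lemma \<open>well_pointed_imp_hep\<close> below.\<close>

definition well_pointed :: "'a based_space \<Rightarrow> bool" where
  "well_pointed P \<longleftrightarrow>
    (\<forall>Z :: (real \<times> 'a) topology. homotopy_extension_property (fst P) {snd P} Z)"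

lemma well_pointed_imp_hep:
  fixes P :: "'a based_space" and W :: "'w topology"
  assumes wp: "well_pointed P" and base: "snd P \<in> topspace (fst P)"
    and cl: "closedin (fst P) {snd P}"
  shows "homotopy_extension_property (fst P) {snd P} W"
proof -
  obtain X p where P: "P = (X, p)" by (cases P)
  define XI where "XI = prod_topology unit_interval X"
  define A where "A = {0::real} \<times> topspace X"
  define B where "B = {0..1::real} \<times> {p}"
  define Z where "Z = subtopology XI (A \<union> B)"
  have p: "p \<in> topspace X" and clp: "closedin X {p}" using base cl P by auto
  have hep: "homotopy_extension_property X {p} Z"
    using wp P by (simp add: well_pointed_def)
  have f0: "continuous_map X Z (\<lambda>x. (0, x))"
    unfolding Z_def XI_def A_def
    by (auto simp: continuous_map_in_subtopology continuous_map_pairwise o_def)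
  have subB: "subtopology Z B = prod_topology unit_interval (subtopology X {p})"
  proof -
    have "subtopology Z B = subtopology (prod_topology unit_interval X) ({0..1} \<times> {p})"
      by (simp add: Z_def subtopology_subtopology XI_def B_def inf_absorb2)
    also have "\<dots> = prod_topology unit_interval (subtopology X {p})"
      by (simp add: subtopology_Times subtopology_subtopology)
    finally show ?thesis .
  qed
  have h0: "continuous_map (prod_topology unit_interval (subtopology X {p})) Z (\<lambda>u. u)"
    unfolding subB[symmetric] by (simp add: continuous_map_from_subtopology)
  obtain r where r: "continuous_map XI Z r"
    and r0: "\<forall>x\<in>topspace X. r (0, x) = (0, x)"
    and r1: "\<forall>t\<in>{0..1}. r (t, p) = (t, p)"
  proof -
    have "\<exists>F. continuous_map XI Z F \<and> (\<forall>x\<in>topspace X. F (0, x) = (0, x)) \<and>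
        (\<forall>t\<in>{0..1}. \<forall>a\<in>{p}. F (t, a) = (t, a))"
      using hep[unfolded homotopy_extension_property_def, rule_format, OF conjI, OF f0 conjI, OF h0]
      by (simp add: XI_def)
    then show ?thesis using that by blast
  qed
  have clA: "closedin XI A"
    unfolding XI_def A_def
    by (auto simp: closedin_prod_Times_iff intro: closedin_subset_topspace)
  have clB: "closedin XI B"
    unfolding XI_def B_def using clp by (auto simp: closedin_prod_Times_iff)
  show ?thesis
    unfolding P homotopy_extension_property_def fst_conv snd_conv
  proof (intro allI impI, elim conjE)
    fix f h
    assume f: "continuous_map X W f"
      and h: "continuous_map (prod_topology unit_interval (subtopology X {p})) W h"
      and eq: "\<forall>a\<in>{p}. h (0, a) = f a"
    define g where "g = (\<lambda>u. if u \<in> A then f (snd u) else h u)"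
    have gZ: "continuous_map Z W g"
    proof (rule pasting_lemma_closed[where I = "UNIV :: bool set"
          and T = "\<lambda>b. if b then A else B" and f = "\<lambda>b. if b then f \<circ> snd else h"])
      show "closedin Z (if i then A else B)" for i
        using clA clB by (auto simp: Z_def closedin_closed_subtopology closedin_subset_topspace)
      show "continuous_map (subtopology Z (if i then A else B)) W (if i then f \<circ> snd else h)" for i
      proof (cases i)
        case True
        have "continuous_map XI X snd" unfolding XI_def by (rule continuous_map_snd)
        then show ?thesis
          using True f by (auto simp: Z_def subtopology_subtopology
              intro!: continuous_map_compose continuous_map_from_subtopology)
      next
        case False
        then show ?thesis using h subB by simp
      qed
      show "(if i then f \<circ> snd else h) x = (if j then f \<circ> snd else h) x"
        if "x \<in> topspace Z \<inter> (if i then A else B) \<inter> (if j then A else B)" for i j x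
        using that eq by (auto simp: A_def B_def)
      show "\<exists>j. j \<in> UNIV \<and> x \<in> (if j then A else B) \<and> g x = (if j then f \<circ> snd else h) x"
        if "x \<in> topspace Z" for x
        using that by (auto simp: Z_def g_def split: if_splits intro: exI[of _ True] exI[of _ False])
    qed simp
    show "\<exists>F. continuous_map (prod_topology unit_interval X) W F \<and>
        (\<forall>x\<in>topspace X. F (0, x) = f x) \<and> (\<forall>t\<in>{0..1}. \<forall>a\<in>{p}. F (t, a) = h (t, a))"
    proof (intro exI conjI ballI)
      show "continuous_map (prod_topology unit_interval X) W (g \<circ> r)"
        using continuous_map_compose[OF r gZ] by (simp add: XI_def)
      show "(g \<circ> r) (0, x) = f x" if "x \<in> topspace X" for x
        using that r0 by (simp add: g_def A_def)
      show "(g \<circ> r) (t, a) = h (t, a)" if "t \<in> {0..1}" "a \<in> {p}" for t a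
        using that r1 eq by (auto simp: g_def A_def)
    qed
  qed
qed

text \<open>The standing assumptions on the spaces. As usual in homotopy theory, connected means
  path connected.\<close>

definition admissible_space :: "'a based_space \<Rightarrow> bool" where
  "admissible_space P \<longleftrightarrow>
    snd P \<in> topspace (fst P) \<and>
    path_connected_space (fst P) \<and>
    locally_compact_space (fst P) \<and>
    Hausdorff_space (fst P) \<and>
    well_pointed P"

definition based_homotopy_equivalent ::
    "'a based_space \<Rightarrow> 'b based_space \<Rightarrow> bool" (infix \<open>\<simeq>\<^sub>*\<close> 50) where
  "P \<simeq>\<^sub>* Q \<longleftrightarrow>
    (\<exists>f g. continuous_map (fst P) (fst Q) f \<and> f (snd P) = snd Q \<and>
           continuous_map (fst Q) (fst P) g \<and> g (snd Q) = snd P \<and>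
           homotopic_with (\<lambda>h. h (snd P) = snd P) (fst P) (fst P) (g \<circ> f) id \<and>
           homotopic_with (\<lambda>h. h (snd Q) = snd Q) (fst Q) (fst Q) (f \<circ> g) id)"


section \<open>Suspensions, wedges and spheres\<close>

text \<open>The quotient \<open>X/A\<close>: its points are \<open>A\<close>, which is the base point, and the singletons of
  points outside \<open>A\<close>. With the usual convention, \<open>X/\<emptyset>\<close> is \<open>X\<close> with a disjoint base point.\<close>

definition collapse_map :: "'a set \<Rightarrow> 'a \<Rightarrow> 'a set" where
  "collapse_map A x = (if x \<in> A then A else {x})"

definition collapse :: "'a topology \<Rightarrow> 'a set \<Rightarrow> 'a set based_space" where
  "collapse X A =
    (topology (\<lambda>U. U \<subseteq> insert A (collapse_map A ` topspace X) \<and>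
                   openin X {x \<in> topspace X. collapse_map A x \<in> U}), A)"

lemma openin_collapse:
  "openin (fst (collapse X A)) U \<longleftrightarrow>
    U \<subseteq> insert A (collapse_map A ` topspace X) \<and>
    openin X {x \<in> topspace X. collapse_map A x \<in> U}"
proof -
  have 1: "{x \<in> topspace X. collapse_map A x \<in> S \<inter> T} =
      {x \<in> topspace X. collapse_map A x \<in> S} \<inter> {x \<in> topspace X. collapse_map A x \<in> T}" for S T
    by auto
  have 2: "{x \<in> topspace X. collapse_map A x \<in> \<Union>\<K>} =
      (\<Union>K\<in>\<K>. {x \<in> topspace X. collapse_map A x \<in> K})" for \<K>
    by auto
  have "istopology (\<lambda>U. U \<subseteq> insert A (collapse_map A ` topspace X) \<and>
      openin X {x \<in> topspace X. collapse_map A x \<in> U})"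
    unfolding istopology_def 1 2 by (blast intro: openin_Int openin_clauses(3))
  then show ?thesis by (simp add: collapse_def)
qed

lemma topspace_collapse:
  "topspace (fst (collapse X A)) = insert A (collapse_map A ` topspace X)"
proof -
  have "{x \<in> topspace X. collapse_map A x \<in> insert A (collapse_map A ` topspace X)} = topspace X"
    by auto
  then have "openin (fst (collapse X A)) (insert A (collapse_map A ` topspace X))"
    by (simp add: openin_collapse)
  then show ?thesis
    by (meson openin_collapse openin_subset openin_topspace subset_antisym)
qed

lemma quotient_map_collapse:
  assumes "A \<subseteq> topspace X" "A \<noteq> {}"
  shows "quotient_map X (fst (collapse X A)) (collapse_map A)"
proof -
  have "A \<in> collapse_map A ` topspace X"
    using assms by (force simp: collapse_map_def)
  then show ?thesis
    by (auto simp: quotient_map_def topspace_collapse openin_collapse insert_absorb)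
qed

definition reduced_suspension :: "'a based_space \<Rightarrow> (real \<times> 'a) set based_space" where
  "reduced_suspension P =
    collapse (prod_topology unit_interval (fst P))
      ({0, 1} \<times> topspace (fst P) \<union> {0..1} \<times> {snd P})"

text \<open>The wedge over an empty index set is a one-point space.\<close>

definition wedge :: "'i set \<Rightarrow> ('i \<Rightarrow> 'a based_space) \<Rightarrow> ('i \<times> 'a) set based_space" where
  "wedge I P = collapse (sum_topology (\<lambda>i. fst (P i)) I) ((\<lambda>i. (i, snd (P i))) ` I)"

definition based_sphere :: "nat \<Rightarrow> (nat \<Rightarrow> real) based_space" where
  "based_sphere k = (nsphere k, (\<lambda>i. if i = 0 then 1 else 0))"


section \<open>Homotopy groups\<close>

definition cube :: "nat \<Rightarrow> (nat \<Rightarrow> real) topology" where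
  "cube n = product_topology (\<lambda>_. unit_interval) {..<n}"

definition cube_boundary :: "nat \<Rightarrow> (nat \<Rightarrow> real) set" where
  "cube_boundary n = {t \<in> topspace (cube n). \<exists>i<n. t i = 0 \<or> t i = 1}"

definition cube_loops :: "nat \<Rightarrow> 'a based_space \<Rightarrow> ((nat \<Rightarrow> real) \<Rightarrow> 'a) set" where
  "cube_loops n P =
    {f. continuous_map (cube n) (fst P) f \<and> (\<forall>t\<in>cube_boundary n. f t = snd P)}"

definition loop_homotopic ::
    "nat \<Rightarrow> 'a based_space \<Rightarrow> ((nat \<Rightarrow> real) \<Rightarrow> 'a) \<Rightarrow> ((nat \<Rightarrow> real) \<Rightarrow> 'a) \<Rightarrow> bool" where
  "loop_homotopic n P =
    homotopic_with (\<lambda>h. \<forall>t\<in>cube_boundary n. h t = snd P) (cube n) (fst P)"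

definition loop_class ::
    "nat \<Rightarrow> 'a based_space \<Rightarrow> ((nat \<Rightarrow> real) \<Rightarrow> 'a) \<Rightarrow> ((nat \<Rightarrow> real) \<Rightarrow> 'a) set" where
  "loop_class n P f = {g. loop_homotopic n P f g}"

text \<open>Concatenation in the first coordinate of the cube.\<close>

definition loop_concat ::
    "((nat \<Rightarrow> real) \<Rightarrow> 'a) \<Rightarrow> ((nat \<Rightarrow> real) \<Rightarrow> 'a) \<Rightarrow> (nat \<Rightarrow> real) \<Rightarrow> 'a" where
  "loop_concat f g t =
    (if t 0 \<le> 1/2 then f (t(0 := 2 * t 0)) else g (t(0 := 2 * t 0 - 1)))"

text \<open>For \<open>n \<ge> 1\<close>.\<close>

definition homotopy_group ::
    "nat \<Rightarrow> 'a based_space \<Rightarrow> ((nat \<Rightarrow> real) \<Rightarrow> 'a) set monoid" where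
  "homotopy_group n P =
    \<lparr>carrier = loop_class n P ` cube_loops n P,
     monoid.mult = (\<lambda>A B. \<Union>f\<in>A. \<Union>g\<in>B. loop_class n P (loop_concat f g)),
     one = loop_class n P (\<lambda>_. snd P)\<rparr>"

definition homotopy_group_map ::
    "nat \<Rightarrow> 'b based_space \<Rightarrow> ('a \<Rightarrow> 'b) \<Rightarrow>
      ((nat \<Rightarrow> real) \<Rightarrow> 'a) set \<Rightarrow> ((nat \<Rightarrow> real) \<Rightarrow> 'b) set" where
  "homotopy_group_map n Q \<phi> A = (\<Union>f\<in>A. loop_class n Q (\<phi> \<circ> f))"


section \<open>Mapping spaces and Gottlieb groups\<close>

text \<open>Unbased maps with the compact-open topology. A map is represented by the function that is
  \<open>undefined\<close> outside the domain, so that equal maps are equal points.\<close>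

definition maps :: "'a topology \<Rightarrow> 'b topology \<Rightarrow> ('a \<Rightarrow> 'b) set" where
  "maps X Y = {f \<in> extensional (topspace X). continuous_map X Y f}"

definition mapping_space :: "'a topology \<Rightarrow> 'b topology \<Rightarrow> ('a \<Rightarrow> 'b) topology" where
  "mapping_space X Y =
    topology_generated_by {{f \<in> maps X Y. f ` K \<subseteq> U} | K U. compactin X K \<and> openin Y U}"

lemma topspace_mapping_space: "topspace (mapping_space X Y) = maps X Y"
proof -
  have "maps X Y = {f \<in> maps X Y. f ` {} \<subseteq> topspace Y}" by simp
  then have "maps X Y \<in> {{f \<in> maps X Y. f ` K \<subseteq> U} | K U. compactin X K \<and> openin Y U}"
    using compactin_empty openin_topspace by blast
  then show ?thesis
    unfolding mapping_space_def topology_generated_by_topspace by blast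
qed

definition map_component :: "'a topology \<Rightarrow> 'b topology \<Rightarrow> ('a \<Rightarrow> 'b) \<Rightarrow> ('a \<Rightarrow> 'b) based_space" where
  "map_component X Y f =
    (subtopology (mapping_space X Y) (path_component_of_set (mapping_space X Y) f), f)"

definition null_map_component :: "'a topology \<Rightarrow> 'b based_space \<Rightarrow> ('a \<Rightarrow> 'b) based_space" where
  "null_map_component X P = map_component X (fst P) (\<lambda>x\<in>topspace X. snd P)"

definition aut1 :: "'a based_space \<Rightarrow> ('a \<Rightarrow> 'a) based_space" where
  "aut1 P = map_component (fst P) (fst P) (\<lambda>x\<in>topspace (fst P). x)"

text \<open>The image of \<open>\<pi>\<^sub>n (aut1 P) \<rightarrow> \<pi>\<^sub>n P\<close> induced by evaluation at the base point, with the group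
  structure of \<open>\<pi>\<^sub>n P\<close>.\<close>

definition gottlieb_group ::
    "nat \<Rightarrow> 'a based_space \<Rightarrow> ((nat \<Rightarrow> real) \<Rightarrow> 'a) set monoid" where
  "gottlieb_group n P =
    (homotopy_group n P)
      \<lparr>carrier := homotopy_group_map n P (\<lambda>\<alpha>. \<alpha> (snd P)) ` carrier (homotopy_group n (aut1 P))\<rparr>"


section \<open>The index set of the decomposition\<close>

text \<open>The tuple \<open>[(i\<^sub>1, m\<^sub>1), \<dots>, (i\<^sub>r, m\<^sub>r)]\<close> with \<open>1 \<le> i\<^sub>1 < \<dots> < i\<^sub>r \<le> N\<close> and
  \<open>1 \<le> m\<^sub>j \<le> k i\<^sub>j\<close>.\<close>

definition index_tuples :: "nat \<Rightarrow> (nat \<Rightarrow> nat) \<Rightarrow> nat \<Rightarrow> (nat \<times> nat) list set" where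
  "index_tuples N k r =
    {ts. length ts = r \<and> sorted_wrt (<) (map fst ts) \<and>
         (\<forall>(i, m)\<in>set ts. i \<in> {1..N} \<and> m \<in> {1..k i})}"

end

theory Submission
  imports Defs
begin

text \<open>
  A class in \<open>\<pi>\<^sub>n (map(X, Y; 0))\<close> is represented by a map \<open>S\<^sup>n \<and> X\<^sub>+ \<rightarrow> Y\<close>. It is a Gottlieb class if and
  only if some representative has the form \<open>F (y\<^sub>0, -)\<close> for a map \<open>F : Y \<times> (I\<^sup>n \<times> X) \<rightarrow> Y\<close> with
  \<open>F (y, k) = y\<close> on \<open>\<partial>I\<^sup>n \<times> X\<close>: a cyclic homotopy of the mapping space restricts to the constant maps,
  and conversely \<open>F\<close> acts on the mapping space pointwise. In this description the product of two
  classes is the pointwise composition \<open>(y, k) \<mapsto> F (F' (y, k), k)\<close>, which does not refer to the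
  suspension coordinate. Hence restriction along every based map \<open>S\<^sup>m \<rightarrow> S\<^sup>n \<and> X\<^sub>+\<close> is a homomorphism of
  Gottlieb groups, even if the map is not a co-H-map. It therefore suffices to find a based homotopy
  equivalence between \<open>S\<^sup>n \<and> X\<^sub>+\<close> and a wedge of spheres. Since \<open>S\<^sup>1 \<and> X\<^sub>+ \<simeq> S\<^sup>1 \<or> \<Sigma>X\<close> for a well-pointed
  space \<open>X\<close>, this follows by induction on the number of factors.

  A quotient \<open>K/L\<close> is represented by the pair \<open>(K, L)\<close>.
\<close>

text \<open>Two obstacles shape the formalisation. An affiliated map satisfies
  \<open>F (y, l) = y\<close> on the collapsed set, so it is constant there for each fixed
  \<open>y\<close> only, and the pair has to be kept instead of its quotient. The hypothesis,
  however, supplies equivalences of quotients, and lifting them to the underlying spaces requires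
  arbitrary choices of preimages. Therefore a map of pairs is a function that is continuous after
  collapsing, and the continuity of \<open>(y, k) \<mapsto> F (y, \<theta> k)\<close> rests on the
  local compactness of \<open>Y\<close>. The null component is not known to be locally compact, so a
  loop of its self-maps need not have a jointly continuous adjoint. Such a loop is evaluated only
  along maps from locally compact spaces: the family of constant maps, parametrised by
  \<open>Y\<close>, and a loop with which it is multiplied. In the induction one cube coordinate
  goes with the last factor, \<open>S^n \<and> (V \<times> W)_+ = (S^(n-1) \<and> V_+) \<and> (S^1
  \<and> W_+)\<close>. The spheres found for \<open>W\<close> then raise the dimension of the cube
  that is left for \<open>V\<close>.\<close>

lemma continuous_map_fst_comp:
  "continuous_map Z (prod_topology X Y) f \<Longrightarrow> continuous_map Z X (\<lambda>x. fst (f x))"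
  and continuous_map_snd_comp:
  "continuous_map Z (prod_topology X Y) f \<Longrightarrow> continuous_map Z Y (\<lambda>x. snd (f x))"
  by (simp_all add: continuous_map_pairwise o_def)

lemma continuous_map_Pair:
  "\<lbrakk>continuous_map Z X f; continuous_map Z Y g\<rbrakk> \<Longrightarrow> continuous_map Z (prod_topology X Y) (\<lambda>x. (f x, g x))"
  by (simp add: continuous_map_pairwise o_def)

lemma unit_interval_lc [simp]: "locally_compact_space unit_interval" "Hausdorff_space unit_interval"
  by (simp_all add: compact_imp_locally_compact_space compact_space_subtopology Hausdorff_space_subtopology)

lemma continuous_map_unit_interval:
  "continuous_map X unit_interval f \<longleftrightarrow> continuous_map X euclideanreal f \<and> (\<forall>x\<in>topspace X. 0 \<le> f x \<and> f x \<le> 1)"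
  by (auto simp: continuous_map_in_subtopology)

lemma continuous_map_unit_intervalI:
  "\<lbrakk>continuous_map X euclideanreal f; \<And>x. x \<in> topspace X \<Longrightarrow> 0 \<le> f x \<and> f x \<le> 1\<rbrakk> \<Longrightarrow> continuous_map X unit_interval f"
  by (simp add: continuous_map_unit_interval)

lemma continuous_map_unit_intervalD:
  "continuous_map X unit_interval f \<Longrightarrow> continuous_map X euclideanreal f"
  by (simp add: continuous_map_unit_interval)

lemma continuous_map_ident: "continuous_map X X (\<lambda>x. x)"
  by (rule continuous_map_id[unfolded id_def])

lemma continuous_map_constI: "c \<in> topspace Y \<Longrightarrow> continuous_map X Y (\<lambda>x. c)"
  by simp

lemma continuous_map_projections:
  "continuous_map (prod_topology A (prod_topology B C)) B (\<lambda>w. fst (snd w))"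
  "continuous_map (prod_topology A (prod_topology B C)) C (\<lambda>w. snd (snd w))"
  "continuous_map (prod_topology (prod_topology A B) C) A (\<lambda>w. fst (fst w))"
  "continuous_map (prod_topology (prod_topology A B) C) B (\<lambda>w. snd (fst w))"
  "continuous_map (prod_topology A (prod_topology B (prod_topology C D))) C (\<lambda>w. fst (snd (snd w)))"
  "continuous_map (prod_topology A (prod_topology B (prod_topology C D))) D (\<lambda>w. snd (snd (snd w)))"
  by (rule continuous_map_fst_comp continuous_map_snd_comp continuous_map_ident)+

lemmas cmap_real = continuous_map_unit_intervalD[OF continuous_map_fst]
  continuous_map_unit_intervalD[OF continuous_map_snd]
  continuous_map_projections[THEN continuous_map_unit_intervalD]
  continuous_map_real_mult continuous_map_add continuous_map_diff continuous_map_minus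
  continuous_map_real_min continuous_map_real_max continuous_map_canonical_const

lemmas cmap = continuous_map_ident continuous_map_fst continuous_map_snd continuous_map_Pair
  continuous_map_projections

section \<open>Pairs of spaces and their quotients\<close>

type_synonym 'a pair = "'a topology \<times> 'a set"

abbreviation pt_set :: "'a pair \<Rightarrow> 'a set" where
  "pt_set P \<equiv> topspace (fst P)"

definition proper_pair :: "'a pair \<Rightarrow> bool" where
  "proper_pair P \<longleftrightarrow> snd P \<subseteq> pt_set P \<and> snd P \<noteq> {}"

abbreviation pair_quot :: "'a pair \<Rightarrow> 'a set topology" where
  "pair_quot P \<equiv> fst (collapse (fst P) (snd P))"

text \<open>Only the map that is induced on the quotients has to be continuous.\<close>

definition pair_map :: "'a pair \<Rightarrow> 'b pair \<Rightarrow> ('a \<Rightarrow> 'b) \<Rightarrow> bool" where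
  "pair_map P Q \<theta> \<longleftrightarrow> \<theta> ` pt_set P \<subseteq> pt_set Q \<and> \<theta> ` snd P \<subseteq> snd Q \<and>
     continuous_map (fst P) (pair_quot Q) (collapse_map (snd Q) \<circ> \<theta>)"

lemma collapse_map_eq_iff:
  "collapse_map A x = collapse_map A y \<longleftrightarrow> x = y \<or> (x \<in> A \<and> y \<in> A)"
  by (auto simp: collapse_map_def)

lemma collapse_map_eq_base [simp]: "collapse_map A x = A \<longleftrightarrow> x \<in> A"
  by (auto simp: collapse_map_def)

lemma continuous_collapse_map: "continuous_map X (fst (collapse X A)) (collapse_map A)"
  by (auto simp: continuous_map_def openin_collapse topspace_collapse)

lemma quotient_map_pair:
  "proper_pair P \<Longrightarrow> quotient_map (fst P) (pair_quot P) (collapse_map (snd P))"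
  unfolding proper_pair_def by (rule quotient_map_collapse) auto

lemma pair_map_continuous:
  assumes "continuous_map (fst P) (fst Q) \<theta>" "\<theta> ` snd P \<subseteq> snd Q"
  shows "pair_map P Q \<theta>"
  using assms continuous_map_compose[OF assms(1) continuous_collapse_map]
  unfolding pair_map_def by (auto simp: continuous_map_def)

lemma pair_map_in: "pair_map P Q \<theta> \<Longrightarrow> x \<in> pt_set P \<Longrightarrow> \<theta> x \<in> pt_set Q"
  by (auto simp: pair_map_def)

lemma pair_map_base: "pair_map P Q \<theta> \<Longrightarrow> x \<in> snd P \<Longrightarrow> \<theta> x \<in> snd Q"
  by (auto simp: pair_map_def)

text \<open>The parameter is admissible because the product of a quotient map with a locally compact
  Hausdorff space is a quotient map.\<close>

lemma pair_map_lift: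
  assumes \<theta>: "pair_map P Q \<theta>" and Q: "proper_pair Q"
    and V: "locally_compact_space V" "Hausdorff_space V"
    and F: "continuous_map (prod_topology V (fst Q)) Z F"
    and const: "\<And>v l l'. \<lbrakk>v \<in> topspace V; l \<in> snd Q; l' \<in> snd Q\<rbrakk> \<Longrightarrow> F (v, l) = F (v, l')"
  shows "continuous_map (prod_topology V (fst P)) Z (\<lambda>(v, k). F (v, \<theta> k))"
proof -
  let ?q = "collapse_map (snd Q)"
  have q: "quotient_map (prod_topology V (fst Q)) (prod_topology V (pair_quot Q)) (\<lambda>(v, k). (v, ?q k))"
    using quotient_map_prod_right quotient_map_pair[OF Q] V by blast
  have resp: "F x = F y" if "x \<in> topspace (prod_topology V (fst Q))"
      "y \<in> topspace (prod_topology V (fst Q))"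
      "(\<lambda>(v, k). (v, ?q k)) x = (\<lambda>(v, k). (v, ?q k)) y" for x y
    using that by (auto simp: collapse_map_eq_iff intro: const)
  obtain G where G: "continuous_map (prod_topology V (pair_quot Q)) Z G"
    and GF: "\<And>x. x \<in> topspace (prod_topology V (fst Q)) \<Longrightarrow> G ((\<lambda>(v, k). (v, ?q k)) x) = F x"
    by (rule quotient_map_lift_exists[OF q F]) (use resp in blast)+
  have "continuous_map (prod_topology V (fst P)) (prod_topology V (pair_quot Q)) (\<lambda>(v, k). (v, ?q (\<theta> k)))"
    using \<theta> unfolding pair_map_def
    by (auto simp: o_def case_prod_unfold
        intro!: continuous_map_Pair continuous_map_fst continuous_map_compose[OF continuous_map_snd, unfolded o_def])
  from continuous_map_compose[OF this G] show ?thesis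
    by (rule continuous_map_eq) (use GF pair_map_in[OF \<theta>] in auto)
qed

lemma pair_map_lift0:
  assumes \<theta>: "pair_map P Q \<theta>" and Q: "proper_pair Q"
    and F: "continuous_map (fst Q) Z F"
    and const: "\<And>l l'. \<lbrakk>l \<in> snd Q; l' \<in> snd Q\<rbrakk> \<Longrightarrow> F l = F l'"
  shows "continuous_map (fst P) Z (F \<circ> \<theta>)"
proof -
  obtain G where G: "continuous_map (pair_quot Q) Z G"
    and GF: "\<And>x. x \<in> pt_set Q \<Longrightarrow> G (collapse_map (snd Q) x) = F x"
    by (rule quotient_map_lift_exists[OF quotient_map_pair[OF Q] F])
      (auto simp: collapse_map_eq_iff intro: const)
  have "continuous_map (fst P) Z (G \<circ> (collapse_map (snd Q) \<circ> \<theta>))"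
    using \<theta> G unfolding pair_map_def by (blast intro: continuous_map_compose)
  then show ?thesis
    by (rule continuous_map_eq) (use GF pair_map_in[OF \<theta>] in auto)
qed

text \<open>\<open>\<theta>\<close> itself need not be continuous, so the composite is formed
  through the quotient: the map induced by \<open>\<sigma>\<close> is constant on
  \<open>snd Q\<close> and can therefore be precomposed with \<open>\<theta>\<close>.\<close>

lemma pair_map_compose:
  assumes \<theta>: "pair_map P Q \<theta>" and \<sigma>: "pair_map Q R \<sigma>" and Q: "proper_pair Q"
  shows "pair_map P R (\<sigma> \<circ> \<theta>)"
proof -
  have "continuous_map (fst P) (pair_quot R) ((collapse_map (snd R) \<circ> \<sigma>) \<circ> \<theta>)"
    by (rule pair_map_lift0[OF \<theta> Q])
      (use \<sigma> in \<open>auto simp: pair_map_def collapse_map_eq_iff\<close>)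
  then show ?thesis
    using \<theta> \<sigma> unfolding pair_map_def image_comp[symmetric] by (auto simp: o_assoc image_subset_iff)
qed

lemma pair_map_id: "pair_map P P id"
  by (rule pair_map_continuous) auto

text \<open>The pasting lemma is applied to the induced maps into the quotient, so on the overlap
  the branches have to agree only up to the collapse.\<close>

lemma pair_map_cases_le:
  assumes P: "snd P \<subseteq> pt_set P"
    and p: "continuous_map (fst P) euclideanreal p" and q: "continuous_map (fst P) euclideanreal q"
    and f: "continuous_map (subtopology (fst P) {x \<in> pt_set P. p x \<le> q x}) (pair_quot Q) (collapse_map (snd Q) \<circ> f)"
    and g: "continuous_map (subtopology (fst P) {x \<in> pt_set P. q x \<le> p x}) (pair_quot Q) (collapse_map (snd Q) \<circ> g)"
    and eq: "\<And>x. \<lbrakk>x \<in> pt_set P; p x = q x\<rbrakk> \<Longrightarrow> collapse_map (snd Q) (f x) = collapse_map (snd Q) (g x)"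
    and fin: "\<And>x. \<lbrakk>x \<in> pt_set P; p x \<le> q x\<rbrakk> \<Longrightarrow> f x \<in> pt_set Q"
    and gin: "\<And>x. \<lbrakk>x \<in> pt_set P; q x < p x\<rbrakk> \<Longrightarrow> g x \<in> pt_set Q"
    and fL: "\<And>x. \<lbrakk>x \<in> snd P; p x \<le> q x\<rbrakk> \<Longrightarrow> f x \<in> snd Q"
    and gL: "\<And>x. \<lbrakk>x \<in> snd P; q x < p x\<rbrakk> \<Longrightarrow> g x \<in> snd Q"
  shows "pair_map P Q (\<lambda>x. if p x \<le> q x then f x else g x)"
proof -
  have "continuous_map (fst P) (pair_quot Q)
      (\<lambda>x. if p x \<le> q x then (collapse_map (snd Q) \<circ> f) x else (collapse_map (snd Q) \<circ> g) x)"
    by (rule continuous_map_cases_le[OF p q f g]) (use eq in auto)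
  then have "continuous_map (fst P) (pair_quot Q)
      (collapse_map (snd Q) \<circ> (\<lambda>x. if p x \<le> q x then f x else g x))"
    by (rule continuous_map_eq) auto
  then show ?thesis
    unfolding pair_map_def using P fin gin fL gL by auto
qed

section \<open>Smash products and cylinders of pairs\<close>

definition pair_smash :: "'a pair \<Rightarrow> 'b pair \<Rightarrow> ('a \<times> 'b) pair" where
  "pair_smash R P =
    (prod_topology (fst R) (fst P), pt_set R \<times> snd P \<union> snd R \<times> pt_set P)"

text \<open>A pair with empty second component stands for a space with a disjoint base point. Hence
  this represents the reduced cylinder \<open>I_+ \<and> P\<close>.\<close>

abbreviation pair_cyl :: "'a pair \<Rightarrow> (real \<times> 'a) pair" where
  "pair_cyl \<equiv> pair_smash (unit_interval, {})"

lemma fst_pair_smash [simp]: "fst (pair_smash R P) = prod_topology (fst R) (fst P)"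
  and snd_pair_smash [simp]: "snd (pair_smash R P) = pt_set R \<times> snd P \<union> snd R \<times> pt_set P"
  by (auto simp: pair_smash_def)

lemma proper_pair_smash:
  "proper_pair P \<Longrightarrow> snd R \<subseteq> pt_set R \<Longrightarrow> pt_set R \<noteq> {} \<Longrightarrow> proper_pair (pair_smash R P)"
  by (auto simp: proper_pair_def)

lemma proper_pair_cyl: "proper_pair P \<Longrightarrow> proper_pair (pair_cyl P)"
  by (rule proper_pair_smash) auto

text \<open>Continuity comes from the parametrised lifting with \<open>fst R\<close> as the locally
  compact parameter.\<close>

lemma pair_map_smash:
  assumes \<theta>: "pair_map P Q \<theta>" and Q: "proper_pair Q"
    and R: "locally_compact_space (fst R)" "Hausdorff_space (fst R)" "snd R \<subseteq> pt_set R"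
  shows "pair_map (pair_smash R P) (pair_smash R Q) (\<lambda>(r, k). (r, \<theta> k))"
  unfolding pair_map_def
proof (intro conjI)
  let ?q = "collapse_map (snd (pair_smash R Q))"
  have "continuous_map (prod_topology (fst R) (fst P)) (pair_quot (pair_smash R Q)) (\<lambda>(r, k). ?q (r, \<theta> k))"
    by (rule pair_map_lift[OF \<theta> Q R(1,2), of _ ?q])
      (use continuous_collapse_map[of "prod_topology (fst R) (fst Q)"] in \<open>auto simp: collapse_map_eq_iff\<close>)
  then show "continuous_map (fst (pair_smash R P)) (pair_quot (pair_smash R Q)) (?q \<circ> (\<lambda>(r, k). (r, \<theta> k)))"
    by (simp add: o_def case_prod_unfold)
qed (use \<theta> in \<open>auto simp: pair_map_def\<close>)

text \<open>The ends are compared after collapsing because two functions that induce the same map of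
  quotients may differ inside the collapsed set.\<close>

definition pair_homotopic :: "'a pair \<Rightarrow> 'b pair \<Rightarrow> ('a \<Rightarrow> 'b) \<Rightarrow> ('a \<Rightarrow> 'b) \<Rightarrow> bool" where
  "pair_homotopic P Q \<theta> \<theta>' \<longleftrightarrow>
    (\<exists>h. pair_map (pair_cyl P) Q h \<and>
      (\<forall>x\<in>pt_set P. collapse_map (snd Q) (h (0, x)) = collapse_map (snd Q) (\<theta> x) \<and>
         collapse_map (snd Q) (h (1, x)) = collapse_map (snd Q) (\<theta>' x)))"

lemma pair_homotopicI:
  assumes "pair_map (pair_cyl P) Q h"
    "\<And>x. x \<in> pt_set P \<Longrightarrow> collapse_map (snd Q) (h (0, x)) = collapse_map (snd Q) (\<theta> x)"
    "\<And>x. x \<in> pt_set P \<Longrightarrow> collapse_map (snd Q) (h (1, x)) = collapse_map (snd Q) (\<theta>' x)"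
  shows "pair_homotopic P Q \<theta> \<theta>'"
  using assms unfolding pair_homotopic_def by blast

lemma pair_map_cyl_reparam:
  assumes u: "continuous_map (prod_topology unit_interval (fst P)) unit_interval u"
    and P: "proper_pair P" and h: "pair_map (pair_cyl P) Q h"
  shows "pair_map (pair_cyl P) Q (\<lambda>x. h (u x, snd x))"
proof -
  have "u x \<in> {0..1}" if "x \<in> {0..1} \<times> pt_set P" for x
    using u that by (auto simp: continuous_map_unit_interval)
  then have "pair_map (pair_cyl P) (pair_cyl P) (\<lambda>x. (u x, snd x))"
    using u P by (intro pair_map_continuous) (auto simp: proper_pair_def intro!: cmap)
  from pair_map_compose[OF this h] show ?thesis
    using proper_pair_smash[OF P, of "(unit_interval, {})"] by (auto simp: o_def)
qed

lemma pair_homotopic_refl: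
  assumes "pair_map P Q \<theta>" "proper_pair P" shows "pair_homotopic P Q \<theta> \<theta>"
proof -
  have "pair_map (pair_cyl P) P snd"
    by (rule pair_map_continuous) (auto simp: continuous_map_snd)
  from pair_map_compose[OF this assms] show ?thesis
    unfolding pair_homotopic_def by (intro exI[of _ "\<theta> \<circ> snd"]) auto
qed

lemma pair_homotopic_cong:
  assumes h: "pair_homotopic P Q \<theta> \<theta>'"
    and "\<And>x. x \<in> pt_set P \<Longrightarrow> collapse_map (snd Q) (\<theta> x) = collapse_map (snd Q) (\<sigma> x)"
    and "\<And>x. x \<in> pt_set P \<Longrightarrow> collapse_map (snd Q) (\<theta>' x) = collapse_map (snd Q) (\<sigma>' x)"
  shows "pair_homotopic P Q \<sigma> \<sigma>'"
  using assms unfolding pair_homotopic_def by auto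

lemma pair_homotopic_trans:
  assumes "pair_homotopic P Q \<theta> \<theta>'" "pair_homotopic P Q \<theta>' \<theta>''" and P: "proper_pair P"
  shows "pair_homotopic P Q \<theta> \<theta>''"
proof -
  obtain h where h: "pair_map (pair_cyl P) Q h"
    "\<forall>x\<in>pt_set P. collapse_map (snd Q) (h (0, x)) = collapse_map (snd Q) (\<theta> x) \<and>
         collapse_map (snd Q) (h (1, x)) = collapse_map (snd Q) (\<theta>' x)"
    using assms unfolding pair_homotopic_def by auto
  obtain h' where h': "pair_map (pair_cyl P) Q h'"
    "\<forall>x\<in>pt_set P. collapse_map (snd Q) (h' (0, x)) = collapse_map (snd Q) (\<theta>' x) \<and>
         collapse_map (snd Q) (h' (1, x)) = collapse_map (snd Q) (\<theta>'' x)"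
    using assms unfolding pair_homotopic_def by auto
  \<comment> \<open>Clamping the times makes each half a pair map on the whole cylinder; its
    restriction then has the continuity that pasting asks for.\<close>
  define u where "u x = min 1 (2 * fst x)" for x :: "real \<times> 'a"
  define v where "v x = max 0 (2 * fst x - 1)" for x :: "real \<times> 'a"
  have u: "pair_map (pair_cyl P) Q (\<lambda>x. h (u x, snd x))"
    by (rule pair_map_cyl_reparam[OF _ P h(1)])
      (auto simp: u_def continuous_map_unit_interval intro!: cmap_real)
  have v: "pair_map (pair_cyl P) Q (\<lambda>x. h' (v x, snd x))"
    by (rule pair_map_cyl_reparam[OF _ P h'(1)])
      (auto simp: v_def continuous_map_unit_interval intro!: cmap_real)
  have "pair_map (pair_cyl P) Q (\<lambda>x. if fst x \<le> 1/2 then h (u x, snd x) else h' (v x, snd x))"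
  proof (rule pair_map_cases_le)
    show "continuous_map (fst (pair_cyl P)) euclideanreal fst"
      by (simp, intro cmap_real)
    show "continuous_map (subtopology (fst (pair_cyl P)) {x \<in> pt_set (pair_cyl P). fst x \<le> 1/2}) (pair_quot Q)
        (collapse_map (snd Q) \<circ> (\<lambda>x. h (u x, snd x)))"
      using u unfolding pair_map_def by (blast intro: continuous_map_from_subtopology)
    show "continuous_map (subtopology (fst (pair_cyl P)) {x \<in> pt_set (pair_cyl P). 1/2 \<le> fst x}) (pair_quot Q)
        (collapse_map (snd Q) \<circ> (\<lambda>x. h' (v x, snd x)))"
      using v unfolding pair_map_def by (blast intro: continuous_map_from_subtopology)
    show "collapse_map (snd Q) (h (u x, snd x)) = collapse_map (snd Q) (h' (v x, snd x))"
      if "x \<in> pt_set (pair_cyl P)" "fst x = 1/2" for x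
      using that h h' by (auto simp: u_def v_def)
  qed (use pair_map_in[OF u] pair_map_in[OF v] pair_map_base[OF u] pair_map_base[OF v] P
       in \<open>auto simp: proper_pair_def\<close>)
  then show ?thesis
    by (rule pair_homotopicI) (use h(2) h'(2) in \<open>auto simp: u_def v_def\<close>)
qed

lemma pair_homotopic_compose_left:
  assumes h: "pair_homotopic P Q \<theta> \<theta>'" and Q: "proper_pair Q" and \<sigma>: "pair_map Q R \<sigma>"
  shows "pair_homotopic P R (\<sigma> \<circ> \<theta>) (\<sigma> \<circ> \<theta>')"
proof -
  have *: "collapse_map (snd R) (\<sigma> x) = collapse_map (snd R) (\<sigma> y)"
    if "collapse_map (snd Q) x = collapse_map (snd Q) y" for x y
    using that pair_map_base[OF \<sigma>] by (auto simp: collapse_map_eq_iff)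
  obtain h where h: "pair_map (pair_cyl P) Q h"
    "\<forall>x\<in>pt_set P. collapse_map (snd Q) (h (0, x)) = collapse_map (snd Q) (\<theta> x) \<and>
         collapse_map (snd Q) (h (1, x)) = collapse_map (snd Q) (\<theta>' x)"
    using h unfolding pair_homotopic_def by auto
  show ?thesis
    by (rule pair_homotopicI[OF pair_map_compose[OF h(1) \<sigma> Q]])
      (unfold o_apply, (rule *, use h(2) in blast)+)
qed

lemma pair_homotopic_compose_right:
  assumes h: "pair_homotopic Q R \<sigma> \<sigma>'" and Q: "proper_pair Q" and \<theta>: "pair_map P Q \<theta>"
  shows "pair_homotopic P R (\<sigma> \<circ> \<theta>) (\<sigma>' \<circ> \<theta>)"
proof -
  obtain h where h: "pair_map (pair_cyl Q) R h"
    "\<forall>x\<in>pt_set Q. collapse_map (snd R) (h (0, x)) = collapse_map (snd R) (\<sigma> x) \<and>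
         collapse_map (snd R) (h (1, x)) = collapse_map (snd R) (\<sigma>' x)"
    using h unfolding pair_homotopic_def by auto
  have "pair_map (pair_cyl P) R (h \<circ> (\<lambda>(t, x). (t, \<theta> x)))"
    by (intro pair_map_compose[OF _ h(1)] pair_map_smash \<theta> Q proper_pair_smash) auto
  then show ?thesis
    by (rule pair_homotopicI) (use h(2) pair_map_in[OF \<theta>] in auto)
qed

section \<open>Homotopy equivalences of pairs\<close>

definition pair_equiv :: "'a pair \<Rightarrow> 'b pair \<Rightarrow> bool" where
  "pair_equiv P Q \<longleftrightarrow> (\<exists>\<theta> \<psi>. pair_map P Q \<theta> \<and> pair_map Q P \<psi> \<and>
     pair_homotopic P P (\<psi> \<circ> \<theta>) id \<and> pair_homotopic Q Q (\<theta> \<circ> \<psi>) id)"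

lemma pair_equiv_trans_aux:
  assumes P: "proper_pair P" and Q: "proper_pair Q"
    and \<theta>: "pair_map P Q \<theta>" and \<psi>: "pair_map Q P \<psi>" and h: "pair_homotopic P P (\<psi> \<circ> \<theta>) id"
    and \<theta>': "pair_map Q R \<theta>'" and \<psi>': "pair_map R Q \<psi>'" and h': "pair_homotopic Q Q (\<psi>' \<circ> \<theta>') id"
  shows "pair_homotopic P P ((\<psi> \<circ> \<psi>') \<circ> (\<theta>' \<circ> \<theta>)) id"
proof -
  have "pair_homotopic P Q (\<psi>' \<circ> \<theta>' \<circ> \<theta>) (id \<circ> \<theta>)"
    by (rule pair_homotopic_compose_right[OF h' Q \<theta>])
  then have "pair_homotopic P P (\<psi> \<circ> (\<psi>' \<circ> \<theta>' \<circ> \<theta>)) (\<psi> \<circ> (id \<circ> \<theta>))"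
    by (rule pair_homotopic_compose_left[OF _ Q \<psi>])
  with h have "pair_homotopic P P (\<psi> \<circ> (\<psi>' \<circ> \<theta>' \<circ> \<theta>)) id"
    by (auto intro: pair_homotopic_trans[OF _ _ P])
  then show ?thesis by (simp add: o_assoc)
qed

lemma pair_equiv_trans:
  assumes "pair_equiv P Q" "pair_equiv Q R" "proper_pair P" "proper_pair Q" "proper_pair R"
  shows "pair_equiv P R"
proof -
  obtain \<theta> \<psi> where 1: "pair_map P Q \<theta>" "pair_map Q P \<psi>"
     "pair_homotopic P P (\<psi> \<circ> \<theta>) id" "pair_homotopic Q Q (\<theta> \<circ> \<psi>) id"
    using assms unfolding pair_equiv_def by auto
  obtain \<theta>' \<psi>' where 2: "pair_map Q R \<theta>'" "pair_map R Q \<psi>'"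
     "pair_homotopic Q Q (\<psi>' \<circ> \<theta>') id" "pair_homotopic R R (\<theta>' \<circ> \<psi>') id"
    using assms unfolding pair_equiv_def by auto
  show ?thesis unfolding pair_equiv_def
    using pair_map_compose[OF 1(1) 2(1) assms(4)] pair_map_compose[OF 2(2) 1(2) assms(4)]
      pair_equiv_trans_aux[OF assms(3,4) 1(1-3) 2(1-3)]
      pair_equiv_trans_aux[OF assms(5,4) 2(2,1,4) 1(2,1,4)] by blast
qed

lemma pair_equiv_iso:
  assumes "pair_map P Q \<theta>" "pair_map Q P \<psi>" and P: "proper_pair P" and Q: "proper_pair Q"
    and 1: "\<And>x. x \<in> pt_set P \<Longrightarrow> collapse_map (snd P) (\<psi> (\<theta> x)) = collapse_map (snd P) x"
    and 2: "\<And>x. x \<in> pt_set Q \<Longrightarrow> collapse_map (snd Q) (\<theta> (\<psi> x)) = collapse_map (snd Q) x"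
  shows "pair_equiv P Q"
  unfolding pair_equiv_def
proof (intro exI conjI)
  show "pair_homotopic P P (\<psi> \<circ> \<theta>) id"
    by (rule pair_homotopic_cong[OF pair_homotopic_refl[OF pair_map_id P]]) (use 1 in auto)
  show "pair_homotopic Q Q (\<theta> \<circ> \<psi>) id"
    by (rule pair_homotopic_cong[OF pair_homotopic_refl[OF pair_map_id Q]]) (use 2 in auto)
qed fact+

lemma collapse_map_smash_cong:
  assumes "collapse_map (snd Q) x = collapse_map (snd Q) y" "r \<in> pt_set R"
  shows "collapse_map (snd (pair_smash R Q)) (r, x) = collapse_map (snd (pair_smash R Q)) (r, y)"
  using assms unfolding collapse_map_eq_iff by auto

lemma pair_homotopic_smash:
  assumes h: "pair_homotopic P Q \<theta> \<theta>'" and Q: "proper_pair Q" and P: "proper_pair P"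
    and R: "locally_compact_space (fst R)" "Hausdorff_space (fst R)" "snd R \<subseteq> pt_set R" "pt_set R \<noteq> {}"
  shows "pair_homotopic (pair_smash R P) (pair_smash R Q) (\<lambda>(r, k). (r, \<theta> k)) (\<lambda>(r, k). (r, \<theta>' k))"
proof -
  obtain h where h: "pair_map (pair_cyl P) Q h"
    "\<forall>x\<in>pt_set P. collapse_map (snd Q) (h (0, x)) = collapse_map (snd Q) (\<theta> x) \<and>
         collapse_map (snd Q) (h (1, x)) = collapse_map (snd Q) (\<theta>' x)"
    using h unfolding pair_homotopic_def by auto
  have 1: "pair_map (pair_smash R (pair_cyl P)) (pair_smash R Q) (\<lambda>(r, k). (r, h k))"
    by (rule pair_map_smash[OF h(1) Q R(1-3)])
  \<comment> \<open>The homotopy is smashed with \<open>R\<close>, and the time coordinate is moved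
    past \<open>R\<close> to recover a cylinder.\<close>
  have "pair_map (pair_cyl (pair_smash R P)) (pair_smash R (pair_cyl P)) (\<lambda>(t, r, k). (r, t, k))"
    by (rule pair_map_continuous)
      (auto simp: case_prod_unfold intro!: cmap)
  from pair_map_compose[OF this 1 proper_pair_smash[OF proper_pair_cyl[OF P] R(3,4)]]
  have "pair_map (pair_cyl (pair_smash R P)) (pair_smash R Q) ((\<lambda>(r, k). (r, h k)) \<circ> (\<lambda>(t, r, k). (r, t, k)))" .
  then show ?thesis
  proof (rule pair_homotopicI)
    fix z assume "z \<in> pt_set (pair_smash R P)"
    then obtain r x where z: "z = (r, x)" "r \<in> pt_set R" "x \<in> pt_set P" by auto
    show "collapse_map (snd (pair_smash R Q)) (((\<lambda>(r, k). (r, h k)) \<circ> (\<lambda>(t, r, k). (r, t, k))) (0, z)) =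
      collapse_map (snd (pair_smash R Q)) ((\<lambda>(r, k). (r, \<theta> k)) z)"
      using collapse_map_smash_cong[of Q "h (0, x)" "\<theta> x" r R] h(2) z by (simp del: snd_pair_smash)
    show "collapse_map (snd (pair_smash R Q)) (((\<lambda>(r, k). (r, h k)) \<circ> (\<lambda>(t, r, k). (r, t, k))) (1, z)) =
      collapse_map (snd (pair_smash R Q)) ((\<lambda>(r, k). (r, \<theta>' k)) z)"
      using collapse_map_smash_cong[of Q "h (1, x)" "\<theta>' x" r R] h(2) z by (simp del: snd_pair_smash)
  qed
qed

lemma pair_equiv_smash:
  assumes "pair_equiv P Q" and Q: "proper_pair Q" and P: "proper_pair P"
    and R: "locally_compact_space (fst R)" "Hausdorff_space (fst R)" "snd R \<subseteq> pt_set R" "pt_set R \<noteq> {}"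
  shows "pair_equiv (pair_smash R P) (pair_smash R Q)"
proof -
  obtain \<theta> \<psi> where 1: "pair_map P Q \<theta>" "pair_map Q P \<psi>"
     "pair_homotopic P P (\<psi> \<circ> \<theta>) id" "pair_homotopic Q Q (\<theta> \<circ> \<psi>) id"
    using assms unfolding pair_equiv_def by auto
  show ?thesis
    unfolding pair_equiv_def
  proof (intro exI conjI)
    show "pair_map (pair_smash R P) (pair_smash R Q) (\<lambda>(r, k). (r, \<theta> k))"
      "pair_map (pair_smash R Q) (pair_smash R P) (\<lambda>(r, k). (r, \<psi> k))"
      using 1 P Q R by (auto intro!: pair_map_smash)
    show "pair_homotopic (pair_smash R P) (pair_smash R P) ((\<lambda>(r, k). (r, \<psi> k)) \<circ> (\<lambda>(r, k). (r, \<theta> k))) id"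
      using pair_homotopic_smash[OF 1(3) P P R] by (simp add: o_def case_prod_unfold id_def)
    show "pair_homotopic (pair_smash R Q) (pair_smash R Q) ((\<lambda>(r, k). (r, \<theta> k)) \<circ> (\<lambda>(r, k). (r, \<psi> k))) id"
      using pair_homotopic_smash[OF 1(4) Q Q R] by (simp add: o_def case_prod_unfold id_def)
  qed
qed

section \<open>Wedges of pairs\<close>

definition pair_wedge :: "'i set \<Rightarrow> ('i \<Rightarrow> 'a pair) \<Rightarrow> ('i \<times> 'a) pair" where
  "pair_wedge I P = (sum_topology (\<lambda>i. fst (P i)) I, Sigma I (\<lambda>i. snd (P i)))"

lemma fst_pair_wedge [simp]: "fst (pair_wedge I P) = sum_topology (\<lambda>i. fst (P i)) I"
  and snd_pair_wedge [simp]: "snd (pair_wedge I P) = Sigma I (\<lambda>i. snd (P i))"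
  by (auto simp: pair_wedge_def)

lemma proper_pair_wedge:
  "(\<And>i. i \<in> I \<Longrightarrow> proper_pair (P i)) \<Longrightarrow> I \<noteq> {} \<Longrightarrow> proper_pair (pair_wedge I P)"
  unfolding proper_pair_def by (simp add: Sigma_mono) (metis Sigma_empty_iff ex_in_conv)

lemma continuous_map_from_sum_topology:
  "continuous_map (sum_topology X I) Z f \<longleftrightarrow> (\<forall>i\<in>I. continuous_map (X i) Z (\<lambda>x. f (i, x)))"
proof
  assume f: "continuous_map (sum_topology X I) Z f"
  show "\<forall>i\<in>I. continuous_map (X i) Z (\<lambda>x. f (i, x))"
    using continuous_map_compose[OF continuous_map_component_injection f] by (auto simp: o_def)
next
  assume f: "\<forall>i\<in>I. continuous_map (X i) Z (\<lambda>x. f (i, x))"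
  have "{x. (i, x) \<in> {x \<in> Sigma I (topspace \<circ> X). f x \<in> U}} = {x \<in> topspace (X i). f (i, x) \<in> U}"
    if "i \<in> I" for i U using that by auto
  then show "continuous_map (sum_topology X I) Z f"
    using f unfolding continuous_map_def by (auto simp: openin_sum_topology Pi_iff)
qed

text \<open>Products distribute over topological sums because the component injections are open.
  This serves homotopies on wedges, with \<open>T\<close> the interval, and affiliated maps on
  wedges, with \<open>T = Y\<close>.\<close>

lemma continuous_map_from_prod_sum_topology:
  assumes f: "\<And>i. i \<in> I \<Longrightarrow> continuous_map (prod_topology T (X i)) Z (\<lambda>(t, x). f (t, i, x))"
  shows "continuous_map (prod_topology T (sum_topology X I)) Z f"
proof -
  let ?D = "\<lambda>(t, i, x). (i, t, x)"
  have g: "continuous_map (sum_topology (\<lambda>i. prod_topology T (X i)) I) Z (\<lambda>(i, t, x). f (t, i, x))"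
    using f by (simp add: continuous_map_from_sum_topology case_prod_unfold)
  have "continuous_map (prod_topology T (sum_topology X I)) (sum_topology (\<lambda>i. prod_topology T (X i)) I) (\<lambda>(t, i, x). (i, t, x))"
    unfolding continuous_map_def
  proof (intro conjI allI impI)
    fix U assume U: "openin (sum_topology (\<lambda>i. prod_topology T (X i)) I) U"
    have eq: "{x \<in> topspace (prod_topology T (sum_topology X I)). ?D x \<in> U} =
      (\<Union>i\<in>I. (\<lambda>(t, x). (t, i, x)) ` {x. (i, x) \<in> U})"
      using openin_subset[OF U] by (force simp: image_iff)
    have "openin (prod_topology T (sum_topology X I)) ((\<lambda>(t, x). (t, i, x)) ` {x. (i, x) \<in> U})" if i: "i \<in> I" for i
    proof (subst openin_prod_topology_alt, intro allI impI)
      fix t z assume tz: "(t, z) \<in> (\<lambda>(t, x). (t, i, x)) ` {x. (i, x) \<in> U}"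
      then obtain x where z: "z = (i, x)" and x: "(i, t, x) \<in> U" by auto
      have "openin (prod_topology T (X i)) {x. (i, x) \<in> U}" using U i by (simp add: openin_sum_topology)
      with x obtain A B where AB: "openin T A" "openin (X i) B" "t \<in> A" "x \<in> B" "A \<times> B \<subseteq> {x. (i, x) \<in> U}"
        unfolding openin_prod_topology_alt by (metis mem_Collect_eq)
      have "openin (sum_topology X I) (Pair i ` B)"
        using open_map_component_injection[OF i, of X] AB by (auto simp: open_map_def)
      then show "\<exists>Ua V. openin T Ua \<and> openin (sum_topology X I) V \<and> t \<in> Ua \<and> z \<in> V \<and>
         Ua \<times> V \<subseteq> (\<lambda>(t, x). (t, i, x)) ` {x. (i, x) \<in> U}"
        using AB z by (intro exI[of _ A] exI[of _ "Pair i ` B"]) (auto simp: image_iff)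
    qed
    then show "openin (prod_topology T (sum_topology X I)) {x \<in> topspace (prod_topology T (sum_topology X I)). ?D x \<in> U}"
      unfolding eq by auto
  qed auto
  from continuous_map_compose[OF this g] show ?thesis
    by (simp add: o_def case_prod_unfold)
qed

lemma pair_map_into_wedge: "i \<in> I \<Longrightarrow> pair_map (P i) (pair_wedge I P) (\<lambda>x. (i, x))"
  using continuous_map_component_injection[of i I "\<lambda>i. fst (P i)"]
  by (intro pair_map_continuous) auto

lemma pair_map_from_wedge:
  assumes "\<And>i. i \<in> I \<Longrightarrow> pair_map (P i) Q (\<lambda>x. \<theta> (i, x))"
  shows "pair_map (pair_wedge I P) Q \<theta>"
  using assms unfolding pair_map_def
  by (auto simp: continuous_map_from_sum_topology o_def image_subset_iff)

lemma pair_homotopic_from_wedge: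
  assumes "\<And>i. i \<in> I \<Longrightarrow> pair_homotopic (P i) Q (\<lambda>x. \<theta> (i, x)) (\<lambda>x. \<theta>' (i, x))"
  shows "pair_homotopic (pair_wedge I P) Q \<theta> \<theta>'"
proof -
  have "\<forall>i\<in>I. \<exists>h. pair_map (pair_cyl (P i)) Q h \<and>
      (\<forall>x\<in>pt_set (P i). collapse_map (snd Q) (h (0, x)) = collapse_map (snd Q) (\<theta> (i, x)) \<and>
         collapse_map (snd Q) (h (1, x)) = collapse_map (snd Q) (\<theta>' (i, x)))"
    using assms unfolding pair_homotopic_def by auto
  then obtain h where h: "\<And>i. i \<in> I \<Longrightarrow> pair_map (pair_cyl (P i)) Q (h i)"
     and h01: "\<And>i x. i \<in> I \<Longrightarrow> x\<in>pt_set (P i) \<Longrightarrow> collapse_map (snd Q) (h i (0, x)) = collapse_map (snd Q) (\<theta> (i, x)) \<and>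
         collapse_map (snd Q) (h i (1, x)) = collapse_map (snd Q) (\<theta>' (i, x))"
    by metis
  have "continuous_map (prod_topology unit_interval (sum_topology (\<lambda>i. fst (P i)) I)) (pair_quot Q)
      (collapse_map (snd Q) \<circ> (\<lambda>(t, i, x). h i (t, x)))"
    by (rule continuous_map_from_prod_sum_topology)
      (use h in \<open>auto simp: pair_map_def o_def case_prod_unfold\<close>)
  then have "pair_map (pair_cyl (pair_wedge I P)) Q (\<lambda>(t, i, x). h i (t, x))"
    using h unfolding pair_map_def by (fastforce simp: image_subset_iff)
  then show ?thesis
    by (rule pair_homotopicI) (use h01 in auto)
qed

lemma pair_equiv_wedge:
  assumes "\<And>i. i \<in> I \<Longrightarrow> pair_equiv (P i) (Q i)"
    and P: "\<And>i. i \<in> I \<Longrightarrow> proper_pair (P i)" and Q: "\<And>i. i \<in> I \<Longrightarrow> proper_pair (Q i)"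
  shows "pair_equiv (pair_wedge I P) (pair_wedge I Q)"
proof -
  have "\<forall>i\<in>I. \<exists>\<theta> \<psi>. pair_map (P i) (Q i) \<theta> \<and> pair_map (Q i) (P i) \<psi> \<and>
     pair_homotopic (P i) (P i) (\<psi> \<circ> \<theta>) id \<and> pair_homotopic (Q i) (Q i) (\<theta> \<circ> \<psi>) id"
    using assms unfolding pair_equiv_def by blast
  then obtain \<theta> \<psi> where 1: "\<And>i. i \<in> I \<Longrightarrow> pair_map (P i) (Q i) (\<theta> i)" "\<And>i. i \<in> I \<Longrightarrow> pair_map (Q i) (P i) (\<psi> i)"
    "\<And>i. i \<in> I \<Longrightarrow> pair_homotopic (P i) (P i) (\<psi> i \<circ> \<theta> i) id" "\<And>i. i \<in> I \<Longrightarrow> pair_homotopic (Q i) (Q i) (\<theta> i \<circ> \<psi> i) id"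
    by metis
  have m: "pair_map (pair_wedge I A) (pair_wedge I B) (\<lambda>(i, x). (i, f i x))"
    if "\<And>i. i \<in> I \<Longrightarrow> pair_map (A i) (B i) (f i)" "\<And>i. i \<in> I \<Longrightarrow> proper_pair (B i)"
    for A :: "'a \<Rightarrow> 'd pair" and B :: "'a \<Rightarrow> 'e pair" and f
    by (rule pair_map_from_wedge)
      (use pair_map_compose[OF that(1) pair_map_into_wedge[where P = B] that(2)] in \<open>auto simp: o_def\<close>)
  have h: "pair_homotopic (pair_wedge I A) (pair_wedge I A) (\<lambda>(i, x). (i, f i x)) id"
    if h: "\<And>i. i \<in> I \<Longrightarrow> pair_homotopic (A i) (A i) (f i) id" and A: "\<And>i. i \<in> I \<Longrightarrow> proper_pair (A i)"
    for A :: "'a \<Rightarrow> 'd pair" and f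
  proof (rule pair_homotopic_from_wedge)
    fix i assume i: "i \<in> I"
    show "pair_homotopic (A i) (pair_wedge I A) (\<lambda>x. case (i, x) of (i, x) \<Rightarrow> (i, f i x)) (\<lambda>x. id (i, x))"
      using pair_homotopic_compose_left[OF h[OF i] A[OF i] pair_map_into_wedge[where P = A, OF i]]
      by (simp add: o_def)
  qed
  show ?thesis
    unfolding pair_equiv_def
  proof (intro exI conjI)
    show "pair_map (pair_wedge I P) (pair_wedge I Q) (\<lambda>(i, x). (i, \<theta> i x))"
      "pair_map (pair_wedge I Q) (pair_wedge I P) (\<lambda>(i, x). (i, \<psi> i x))"
      using 1 P Q by (auto intro!: m)
    show "pair_homotopic (pair_wedge I P) (pair_wedge I P) ((\<lambda>(i, x). (i, \<psi> i x)) \<circ> (\<lambda>(i, x). (i, \<theta> i x))) id"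
      using h[of P "\<lambda>i. \<psi> i \<circ> \<theta> i"] 1 P Q by (auto simp: o_def case_prod_unfold intro: pair_map_compose[unfolded o_def])
    show "pair_homotopic (pair_wedge I Q) (pair_wedge I Q) ((\<lambda>(i, x). (i, \<theta> i x)) \<circ> (\<lambda>(i, x). (i, \<psi> i x))) id"
      using h[of Q "\<lambda>i. \<theta> i \<circ> \<psi> i"] 1 P Q by (auto simp: o_def case_prod_unfold intro: pair_map_compose[unfolded o_def])
  qed
qed

section \<open>Presentations of based spaces by pairs\<close>

text \<open>\<open>\<kappa>\<close> exhibits \<open>Q\<close> as the quotient that is represented by \<open>P\<close>.\<close>

definition pair_presents :: "'a pair \<Rightarrow> 'b based_space \<Rightarrow> ('a \<Rightarrow> 'b) \<Rightarrow> bool" where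
  "pair_presents P Q \<kappa> \<longleftrightarrow> proper_pair P \<and> quotient_map (fst P) (fst Q) \<kappa> \<and>
     (\<forall>x\<in>pt_set P. \<kappa> x = snd Q \<longleftrightarrow> x \<in> snd P) \<and>
     (\<forall>x\<in>pt_set P. \<forall>y\<in>pt_set P. \<kappa> x = \<kappa> y \<longrightarrow> x = y \<or> x \<in> snd P)"

lemma pair_presents_eq_iff:
  assumes "pair_presents P Q \<kappa>" "x \<in> pt_set P" "y \<in> pt_set P"
  shows "\<kappa> x = \<kappa> y \<longleftrightarrow> collapse_map (snd P) x = collapse_map (snd P) y"
  using assms unfolding pair_presents_def collapse_map_eq_iff by metis

text \<open>On \<open>pt_set Q\<close> the maps \<open>\<kappa>\<close> and
  \<open>collapse_map (snd Q)\<close> have the same fibres, so the quotient map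
  \<open>\<kappa>\<close> induces a continuous map from \<open>q\<close> to the quotient of
  \<open>Q\<close>. Continuity can thus be tested in the presented space.\<close>

lemma pair_map_into_presented:
  assumes Q: "pair_presents Q q \<kappa>"
    and im: "\<theta> ` pt_set P \<subseteq> pt_set Q" "\<theta> ` snd P \<subseteq> snd Q"
    and c: "continuous_map (fst P) (fst q) (\<kappa> \<circ> \<theta>)"
  shows "pair_map P Q \<theta>"
proof -
  obtain G where G: "continuous_map (fst q) (pair_quot Q) G"
    and GF: "\<And>x. x \<in> pt_set Q \<Longrightarrow> G (\<kappa> x) = collapse_map (snd Q) x"
    by (rule quotient_map_lift_exists[of "fst Q" "fst q" \<kappa> "pair_quot Q" "collapse_map (snd Q)"])
      (use Q pair_presents_eq_iff[OF Q] continuous_collapse_map in \<open>auto simp: pair_presents_def\<close>)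
  have "continuous_map (fst P) (pair_quot Q) (G \<circ> (\<kappa> \<circ> \<theta>))"
    by (rule continuous_map_compose[OF c G])
  then have "continuous_map (fst P) (pair_quot Q) (collapse_map (snd Q) \<circ> \<theta>)"
    by (rule continuous_map_eq) (use GF im in auto)
  with im show ?thesis by (simp add: pair_map_def)
qed

lemma snd_collapse [simp]: "snd (collapse X A) = A"
  by (simp add: collapse_def)

lemma pair_presents_collapse:
  "proper_pair P \<Longrightarrow> pair_presents P (collapse (fst P) (snd P)) (collapse_map (snd P))"
  using quotient_map_pair[of P]
  by (auto simp only: pair_presents_def collapse_map_eq_iff collapse_map_eq_base snd_collapse)

lemma pair_presents_self: "snd Q \<in> topspace (fst Q) \<Longrightarrow> pair_presents (fst Q, {snd Q}) Q id"
  by (auto simp: pair_presents_def proper_pair_def quotient_map_def openin_subset Collect_conj_eq Int_absorb1)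

lemma based_homotopy_equivalent_refl: "snd Q \<in> topspace (fst Q) \<Longrightarrow> Q \<simeq>\<^sub>* Q"
  unfolding based_homotopy_equivalent_def
  by (intro exI[of _ id]) (auto simp: homotopic_with_refl)

text \<open>The maps between the presented spaces are lifted through arbitrary preimages. Such lifts
  are usually discontinuous, but composed with \<open>\<kappa>\<close> or \<open>\<mu>\<close> they
  give back continuous maps, and pair maps ask for no more.\<close>

lemma pair_equiv_of_based_homotopy_equivalent:
  assumes P: "pair_presents P p \<kappa>" and Q: "pair_presents Q q \<mu>" and eq: "p \<simeq>\<^sub>* q"
  shows "pair_equiv P Q"
proof -
  obtain f g where f: "continuous_map (fst p) (fst q) f" "f (snd p) = snd q"
    and g: "continuous_map (fst q) (fst p) g" "g (snd q) = snd p"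
    and gf: "homotopic_with (\<lambda>h. h (snd p) = snd p) (fst p) (fst p) (g \<circ> f) id"
    and fg: "homotopic_with (\<lambda>h. h (snd q) = snd q) (fst q) (fst q) (f \<circ> g) id"
    using eq unfolding based_homotopy_equivalent_def by blast
  \<comment> \<open>A set-theoretic section of a surjection; nothing is claimed about its
    continuity.\<close>
  have rep: "\<exists>\<rho>. \<forall>z\<in>topspace (fst b). \<rho> z \<in> pt_set B \<and> \<beta> (\<rho> z) = z" if "pair_presents B b \<beta>"
    for B :: "'e pair" and b :: "'f based_space" and \<beta>
  proof -
    have "\<beta> ` pt_set B = topspace (fst b)"
      using that by (auto simp: pair_presents_def intro!: quotient_imp_surjective_map)
    then show ?thesis
      by (intro exI[of _ "inv_into (pt_set B) \<beta>"]) (auto intro: inv_into_into f_inv_into_f)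
  qed
  obtain \<rho> where \<rho>: "\<And>z. z \<in> topspace (fst p) \<Longrightarrow> \<rho> z \<in> pt_set P \<and> \<kappa> (\<rho> z) = z"
    using rep[OF P] by blast
  obtain \<sigma> where \<sigma>: "\<And>z. z \<in> topspace (fst q) \<Longrightarrow> \<sigma> z \<in> pt_set Q \<and> \<mu> (\<sigma> z) = z"
    using rep[OF Q] by blast
  have lift: "pair_map A B (\<rho> \<circ> F)" if B: "pair_presents B b \<beta>"
    and r: "\<And>z. z \<in> topspace (fst b) \<Longrightarrow> \<rho> z \<in> pt_set B \<and> \<beta> (\<rho> z) = z"
    and F: "continuous_map (fst A) (fst b) F" "\<And>x. x \<in> snd A \<Longrightarrow> F x = snd b" and A: "snd A \<subseteq> pt_set A"
    for A :: "'g pair" and B :: "'e pair" and b :: "'f based_space" and \<beta> F \<rho>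
  proof (rule pair_map_into_presented[OF B])
    have Fin: "F x \<in> topspace (fst b)" if "x \<in> pt_set A" for x
      using F(1) that by (auto simp: continuous_map_def)
    show "continuous_map (fst A) (fst b) (\<beta> \<circ> (\<rho> \<circ> F))"
      by (rule continuous_map_eq[OF F(1)]) (use r Fin in auto)
    show "(\<rho> \<circ> F) ` pt_set A \<subseteq> pt_set B" using r Fin by auto
    show "(\<rho> \<circ> F) ` snd A \<subseteq> snd B"
    proof clarsimp
      fix x assume x: "x \<in> snd A"
      then have "F x = snd b" "x \<in> pt_set A" using F A by auto
      then show "\<rho> (F x) \<in> snd B" using r[OF Fin, of x] B unfolding pair_presents_def by auto
    qed
  qed
  have \<kappa>c: "continuous_map (fst P) (fst p) \<kappa>" and \<mu>c: "continuous_map (fst Q) (fst q) \<mu>"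
    using P Q by (auto simp: pair_presents_def quotient_imp_continuous_map)
  have \<kappa>b: "\<kappa> x = snd p" if "x \<in> snd P" for x
    using that P by (auto simp: pair_presents_def proper_pair_def)
  have \<mu>b: "\<mu> x = snd q" if "x \<in> snd Q" for x
    using that Q by (auto simp: pair_presents_def proper_pair_def)
  have PL: "snd P \<subseteq> pt_set P" "snd Q \<subseteq> pt_set Q"
    using P Q by (auto simp: pair_presents_def proper_pair_def)
  have \<theta>: "pair_map P Q (\<sigma> \<circ> (f \<circ> \<kappa>))"
    by (rule lift[OF Q \<sigma>]) (use f \<kappa>c \<kappa>b PL in \<open>auto intro: continuous_map_compose\<close>)
  have \<psi>: "pair_map Q P (\<rho> \<circ> (g \<circ> \<mu>))"
    by (rule lift[OF P \<rho>]) (use g \<mu>c \<mu>b PL in \<open>auto intro: continuous_map_compose\<close>)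
  \<comment> \<open>Stated for generic data so that it yields both composites, with the roles of
    \<open>P\<close> and \<open>Q\<close> exchanged.\<close>
  have hom: "pair_homotopic B B ((\<rho> \<circ> (g \<circ> \<mu>)) \<circ> (\<sigma> \<circ> (f \<circ> \<beta>))) id"
    if B: "pair_presents B b \<beta>"
      and r: "\<And>z. z \<in> topspace (fst b) \<Longrightarrow> \<rho> z \<in> pt_set B \<and> \<beta> (\<rho> z) = z"
      and s: "\<And>z. z \<in> topspace (fst a) \<Longrightarrow> \<mu> (\<sigma> z) = z"
      and f: "continuous_map (fst b) (fst a) f" and g: "continuous_map (fst a) (fst b) g"
      and gf: "homotopic_with (\<lambda>h. h (snd b) = snd b) (fst b) (fst b) (g \<circ> f) id"
    for B :: "'e pair" and b :: "'f based_space" and a :: "'g based_space" and \<beta> f g \<rho> \<sigma> and \<mu> :: "'h \<Rightarrow> 'g"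
  proof -
    obtain H where H: "continuous_map (prod_topology unit_interval (fst b)) (fst b) H"
      "\<And>x. H (0, x) = g (f x)" "\<And>x. H (1, x) = x" "\<And>t. t \<in> {0..1} \<Longrightarrow> H (t, snd b) = snd b"
      using gf unfolding homotopic_with_def by auto
    have \<beta>c: "continuous_map (fst B) (fst b) \<beta>"
      using B by (auto simp: pair_presents_def quotient_imp_continuous_map)
    then have \<beta>in: "\<beta> x \<in> topspace (fst b)" if "x \<in> pt_set B" for x
      using that by (auto simp: continuous_map_def)
    have BL: "snd B \<subseteq> pt_set B" using B by (auto simp: pair_presents_def proper_pair_def)
    have "pair_map (pair_cyl B) B (\<rho> \<circ> (H \<circ> (\<lambda>x. (fst x, \<beta> (snd x)))))"
    proof (rule lift[OF B r])
      have "continuous_map (prod_topology unit_interval (fst B)) (prod_topology unit_interval (fst b))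
          (\<lambda>x. (fst x, \<beta> (snd x)))"
        by (intro cmap continuous_map_compose[OF _ \<beta>c, unfolded o_def])
      from continuous_map_compose[OF this H(1)]
      show "continuous_map (fst (pair_cyl B)) (fst b) (H \<circ> (\<lambda>x. (fst x, \<beta> (snd x))))" by simp
      show "(H \<circ> (\<lambda>x. (fst x, \<beta> (snd x)))) x = snd b" if xs: "x \<in> snd (pair_cyl B)" for x
      proof -
        obtain t y where y: "x = (t, y)" "t \<in> {0..1}" "y \<in> snd B" using xs by auto
        then have "\<beta> y = snd b" using B BL unfolding pair_presents_def by blast
        then show ?thesis using y H(4) by simp
      qed
    qed (use BL in auto)
    then show ?thesis
    proof (rule pair_homotopicI)
      fix x assume x: "x \<in> pt_set B"
      have fin: "f (\<beta> x) \<in> topspace (fst a)" using \<beta>in[OF x] f by (auto simp: continuous_map_def)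
      show "collapse_map (snd B) ((\<rho> \<circ> (H \<circ> (\<lambda>x. (fst x, \<beta> (snd x))))) (0, x)) =
         collapse_map (snd B) (((\<rho> \<circ> (g \<circ> \<mu>)) \<circ> (\<sigma> \<circ> (f \<circ> \<beta>))) x)"
        using H(2) s[OF fin] by simp
      have "\<beta> (\<rho> (\<beta> x)) = \<beta> x" using r[OF \<beta>in[OF x]] by simp
      then show "collapse_map (snd B) ((\<rho> \<circ> (H \<circ> (\<lambda>x. (fst x, \<beta> (snd x))))) (1, x)) = collapse_map (snd B) (id x)"
        using H(3) pair_presents_eq_iff[OF B, of "\<rho> (\<beta> x)" x] r[OF \<beta>in[OF x]] x by simp
    qed
  qed
  show ?thesis
    unfolding pair_equiv_def
    by (intro exI conjI, rule \<theta>, rule \<psi>, rule hom[OF P \<rho> _ f(1) g(1) gf])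
       (use \<sigma> hom[OF Q \<sigma> _ g(1) f(1) fg, of \<kappa> \<rho>] \<rho> in auto)
qed

lemma pair_equiv_presented:
  assumes P: "pair_presents P q \<kappa>" and "pair_presents Q q \<mu>"
  shows "pair_equiv P Q"
proof (rule pair_equiv_of_based_homotopy_equivalent[OF assms based_homotopy_equivalent_refl])
  have "\<kappa> ` pt_set P = topspace (fst q)"
    using P by (auto simp: pair_presents_def intro!: quotient_imp_surjective_map)
  then show "snd q \<in> topspace (fst q)"
    using P unfolding pair_presents_def proper_pair_def by (metis ex_in_conv image_eqI subset_iff)
qed

section \<open>The suspension of a space with a disjoint base point\<close>

text \<open>The base set \<open>{}\<close> in the hypotheses asks only for continuity of the
  branches; the collapsed set is treated separately, on the region where each branch is in
  force.\<close>

lemma pair_map_cases: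
  assumes P: "snd P \<subseteq> pt_set P"
    and f: "pair_map (fst P, {}) Q f" and g: "pair_map (fst P, {}) Q g"
    and p: "continuous_map (fst P) euclideanreal p" and q: "continuous_map (fst P) euclideanreal q"
    and eq: "\<And>x. \<lbrakk>x \<in> pt_set P; p x = q x\<rbrakk> \<Longrightarrow> collapse_map (snd Q) (f x) = collapse_map (snd Q) (g x)"
    and fL: "\<And>x. \<lbrakk>x \<in> snd P; p x \<le> q x\<rbrakk> \<Longrightarrow> f x \<in> snd Q"
    and gL: "\<And>x. \<lbrakk>x \<in> snd P; q x < p x\<rbrakk> \<Longrightarrow> g x \<in> snd Q"
  shows "pair_map P Q (\<lambda>x. if p x \<le> q x then f x else g x)"
  by (rule pair_map_cases_le[OF P p q _ _ eq _ _ fL gL])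
    (use f g in \<open>auto simp: pair_map_def intro: continuous_map_from_subtopology\<close>)

lemma pair_map_unbased:
  "continuous_map X (fst Q) f \<Longrightarrow> pair_map (X, {}) Q f"
  by (rule pair_map_continuous) auto

lemma continuous_map_into_sum:
  "i \<in> I \<Longrightarrow> continuous_map Z (X i) f \<Longrightarrow> continuous_map Z (sum_topology X I) (\<lambda>x. (i, f x))"
  using continuous_map_compose[OF _ continuous_map_component_injection, of Z X i f I] by (simp add: o_def)

text \<open>This represents \<open>S^1 \<and> X_+\<close>: both ends of the cylinder go to one base
  point.\<close>

definition plus_pair :: "'a topology \<Rightarrow> (real \<times> 'a) pair" where
  "plus_pair X = (prod_topology unit_interval X, {0, 1} \<times> topspace X)"

definition susp_pair :: "'a topology \<Rightarrow> 'a \<Rightarrow> (real \<times> 'a) pair" where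
  "susp_pair X p = (prod_topology unit_interval X, {0, 1} \<times> topspace X \<union> {0..1} \<times> {p})"

text \<open>The circle is realised as \<open>I \<times> {p}\<close>, so that both summands of \<open>S\<^sup>1 \<or> \<Sigma>X\<close> have the same type.\<close>

abbreviation circle_pair :: "'a topology \<Rightarrow> 'a \<Rightarrow> (real \<times> 'a) pair" where
  "circle_pair X p \<equiv> plus_pair (subtopology X {p})"

abbreviation split_pair :: "'a topology \<Rightarrow> 'a \<Rightarrow> (bool \<times> real \<times> 'a) pair" where
  "split_pair X p \<equiv> pair_wedge UNIV (\<lambda>b. if b then circle_pair X p else susp_pair X p)"

lemma fst_plus_pair [simp]: "fst (plus_pair X) = prod_topology unit_interval X"
  and snd_plus_pair [simp]: "snd (plus_pair X) = {0, 1} \<times> topspace X"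
  and fst_susp_pair [simp]: "fst (susp_pair X p) = prod_topology unit_interval X"
  and snd_susp_pair [simp]: "snd (susp_pair X p) = {0, 1} \<times> topspace X \<union> {0..1} \<times> {p}"
  by (simp_all add: plus_pair_def susp_pair_def)

lemma proper_plus_pair: "topspace X \<noteq> {} \<Longrightarrow> proper_pair (plus_pair X)"
  by (auto simp: proper_pair_def plus_pair_def)

lemma proper_susp_pair: "p \<in> topspace X \<Longrightarrow> proper_pair (susp_pair X p)"
  by (auto simp: proper_pair_def susp_pair_def)

lemma proper_split_pair: "p \<in> topspace X \<Longrightarrow> proper_pair (split_pair X p)"
  by (intro proper_pair_wedge) (auto intro: proper_plus_pair proper_susp_pair)

text \<open>The test space is \<open>{0} \<times> X \<union> I \<times> {p}\<close> itself, with its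
  two inclusions as the data to be extended; the extension is a retraction, recorded by its
  coordinates \<open>s\<close> and \<open>\<xi>\<close>. So \<open>\<xi>\<close> deforms the
  identity of \<open>X\<close>, and wherever \<open>s\<close> is positive \<open>\<xi>\<close> has
  already reached \<open>p\<close>.\<close>

lemma well_pointed_retraction:
  assumes wp: "well_pointed (X, p)" and p: "p \<in> topspace X"
  obtains s :: "real \<times> 'a \<Rightarrow> real" and \<xi> :: "real \<times> 'a \<Rightarrow> 'a"
  where "continuous_map (prod_topology unit_interval X) unit_interval s"
    "continuous_map (prod_topology unit_interval X) X \<xi>"
    "\<And>t x. \<lbrakk>t \<in> {0..1}; x \<in> topspace X\<rbrakk> \<Longrightarrow> s (t, x) = 0 \<or> \<xi> (t, x) = p"
    "\<And>x. x \<in> topspace X \<Longrightarrow> s (0, x) = 0 \<and> \<xi> (0, x) = x"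
    "\<And>t. t \<in> {0..1} \<Longrightarrow> s (t, p) = t \<and> \<xi> (t, p) = p"
proof -
  define A where "A = {0::real} \<times> topspace X \<union> {0..1} \<times> {p}"
  define Z where "Z = subtopology (prod_topology unit_interval X) A"
  have "continuous_map X Z (\<lambda>x. (0, x))"
    unfolding Z_def A_def by (auto simp: continuous_map_in_subtopology intro!: cmap)
  moreover have "continuous_map (prod_topology unit_interval (subtopology X {p})) Z (\<lambda>u. u)"
    unfolding Z_def A_def
    by (auto simp: continuous_map_in_subtopology prod_topology_subtopology intro!: continuous_map_from_subtopology)
  ultimately obtain r where r: "continuous_map (prod_topology unit_interval X) Z r"
    and r0: "\<forall>x\<in>topspace X. r (0, x) = (0, x)" and r1: "\<forall>t\<in>{0..1}. r (t, p) = (t, p)"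
    using wp unfolding well_pointed_def homotopy_extension_property_def by (metis fst_conv snd_conv singletonD singletonI)
  have rc: "continuous_map (prod_topology unit_interval X) (prod_topology unit_interval X) r"
    using r by (simp add: Z_def continuous_map_in_subtopology)
  have rA: "r (t, x) \<in> A" if "t \<in> {0..1}" "x \<in> topspace X" for t x
    using r that by (auto simp: Z_def continuous_map_in_subtopology)
  show ?thesis
  proof
    show "continuous_map (prod_topology unit_interval X) unit_interval (\<lambda>z. fst (r z))"
      "continuous_map (prod_topology unit_interval X) X (\<lambda>z. snd (r z))"
      using rc by (intro continuous_map_fst_comp continuous_map_snd_comp, assumption)+
    show "fst (r (t, x)) = 0 \<or> snd (r (t, x)) = p" if "t \<in> {0..1}" "x \<in> topspace X" for t x
      using rA[OF that] by (auto simp: A_def)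
  qed (use r0 r1 in auto)
qed

lemma unit_convex:
  fixes a b \<sigma> :: real
  assumes "0 \<le> a" "a \<le> 1" "0 \<le> b" "b \<le> 1" "0 \<le> \<sigma>" "\<sigma> \<le> 1"
  shows "0 \<le> (1 - \<sigma>) * a + \<sigma> * b \<and> (1 - \<sigma>) * a + \<sigma> * b \<le> 1"
  using assms convex_bound_le[of a 1 b "1 - \<sigma>" \<sigma>] by simp

lemma unit_mult:
  fixes a b :: real
  assumes "0 \<le> a" "a \<le> 1" "0 \<le> b" "b \<le> 1"
  shows "0 \<le> a * b \<and> a * b \<le> 1"
  using assms by (simp add: mult_le_one)

text \<open>\<open>\<psi>\<close> is the pinch map. On \<open>\<Sigma>X\<close> the map \<open>\<theta>\<close> runs up along \<open>(t, x)\<close> and back along \<open>(t, p)\<close>; the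
  retraction \<open>(s, \<xi>)\<close> of \<open>I \<times> X\<close> onto \<open>{0} \<times> X \<union> I \<times> {p}\<close> is used to contract this loop at \<open>x = p\<close>.\<close>

lemma pair_equiv_plus_split:
  assumes wp: "well_pointed (X, p)" and p: "p \<in> topspace X"
  shows "pair_equiv (plus_pair X) (split_pair X p)"
proof -
  obtain s :: "real \<times> 'a \<Rightarrow> real" and \<xi> :: "real \<times> 'a \<Rightarrow> 'a" where
    sc: "continuous_map (prod_topology unit_interval X) unit_interval s"
    and xc: "continuous_map (prod_topology unit_interval X) X \<xi>"
    and sx: "\<And>t x. \<lbrakk>t \<in> {0..1}; x \<in> topspace X\<rbrakk> \<Longrightarrow> s (t, x) = 0 \<or> \<xi> (t, x) = p"
    and s0: "\<And>x. x \<in> topspace X \<Longrightarrow> s (0, x) = 0 \<and> \<xi> (0, x) = x"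
    and sp: "\<And>t. t \<in> {0..1} \<Longrightarrow> s (t, p) = t \<and> \<xi> (t, p) = p"
    using well_pointed_retraction[OF wp p] by metis
  have s01: "0 \<le> s (t, x) \<and> s (t, x) \<le> 1" if "0 \<le> t" "t \<le> 1" "x \<in> topspace X" for t x
    using sc that by (auto simp: continuous_map_unit_interval)
  have xin: "\<xi> (t, x) \<in> topspace X" if "0 \<le> t" "t \<le> 1" "x \<in> topspace X" for t x
    using xc that by (auto simp: continuous_map_def)
  have sI: "continuous_map Z euclideanreal (\<lambda>z. s (g z, h z))"
    and xI: "continuous_map Z X (\<lambda>z. \<xi> (g z, h z))"
    if "continuous_map Z unit_interval g" "continuous_map Z X h" for Z :: "'z topology" and g h
    using continuous_map_compose[OF continuous_map_Pair[OF that] sc]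
      continuous_map_compose[OF continuous_map_Pair[OF that] xc]
    by (auto simp: o_def continuous_map_unit_interval)
  note cI = cmap_real cmap xI sI continuous_map_unit_intervalI continuous_map_into_sum
  define tent where "tent t = min (2 * t) (2 - 2 * t)" for t :: real
  have tent01: "0 \<le> tent t \<and> tent t \<le> 1" if "0 \<le> t" "t \<le> 1" for t
    using that by (auto simp: tent_def min_def)
  define \<psi> where "\<psi> = (\<lambda>z :: real \<times> 'a. if fst z \<le> 1/2 then (False, (min 1 (2 * fst z), snd z))
      else (True, (max 0 (2 * fst z - 1), p :: 'a)))"
  \<comment> \<open>At \<open>x = p\<close> the factor \<open>1 - s (1, x)\<close> vanishes, so the
    loop shrinks to height 0. At the turning point \<open>t = 1/2\<close> either
    \<open>s (1, x) = 0\<close>, and the height 1 is collapsed, or \<open>\<xi> (1, x) = p\<close>,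
    and the two branches of \<open>\<theta>F\<close> coincide.\<close>
  define c where "c z = (1 - s (1, snd z)) * tent (fst z)" for z :: "real \<times> 'a"
  define \<theta>F where "\<theta>F z = (if fst z \<le> 1/2 then (c z, \<xi> (1, snd z)) else (c z, p))" for z
  define \<theta> where "\<theta> = (\<lambda>(b, z). if b then z else \<theta>F z)"
  let ?P = "plus_pair X" and ?B = "split_pair X p"
  have P: "proper_pair ?P" and B: "proper_pair ?B"
    using p by (auto intro: proper_plus_pair proper_split_pair)
  have c01: "0 \<le> c z \<and> c z \<le> 1" if "z \<in> {0..1} \<times> topspace X" for z
    unfolding c_def using that s01[of 1 "snd z"] tent01[of "fst z"] by (intro unit_mult) auto
  have cc: "continuous_map (prod_topology unit_interval X) unit_interval c"
    by (rule continuous_map_unit_intervalI, unfold c_def tent_def, intro cI)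
      (use c01 in \<open>auto simp: c_def tent_def\<close>)
  have cc': "continuous_map Z unit_interval (\<lambda>z. c (g z))"
    if "continuous_map Z (prod_topology unit_interval X) g" for Z :: "'z topology" and g
    using continuous_map_compose[OF that cc] by (simp add: o_def)
  have intoF: "continuous_map Z (prod_topology unit_interval X) f \<Longrightarrow> continuous_map Z (fst ?B) (\<lambda>z. (False, f z))"
    and intoT: "continuous_map Z (prod_topology unit_interval (subtopology X {p})) f \<Longrightarrow> continuous_map Z (fst ?B) (\<lambda>z. (True, f z))"
    for Z :: "'z topology" and f
    unfolding fst_pair_wedge by (rule continuous_map_into_sum, simp, simp)+
  have pc: "continuous_map Z (subtopology X {p}) (\<lambda>z. p)" for Z :: "'z topology"
    using p by (intro continuous_map_constI) auto
  have pc': "continuous_map Z X (\<lambda>z. p)" for Z :: "'z topology"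
    using p by (intro continuous_map_constI) auto
  have LT: "(True, (t, x)) \<in> snd ?B \<longleftrightarrow> (t = 0 \<or> t = 1) \<and> x = p" for t x
    using p by auto
  have LF: "(False, (t, x)) \<in> snd ?B \<longleftrightarrow> (t = 0 \<or> t = 1) \<and> x \<in> topspace X \<or> 0 \<le> t \<and> t \<le> 1 \<and> x = p" for t x
    by auto
  note LB = LT LF
  note simps = collapse_map_eq_iff LB
  have \<psi>m: "pair_map ?P ?B \<psi>"
    unfolding \<psi>_def
  proof (rule pair_map_cases)
    show "pair_map (fst ?P, {}) ?B (\<lambda>z. (False, (min 1 (2 * fst z), snd z)))"
      by (rule pair_map_unbased, rule intoF, simp, intro cI) auto
    show "pair_map (fst ?P, {}) ?B (\<lambda>z. (True, (max 0 (2 * fst z - 1), p)))"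
      by (rule pair_map_unbased, rule intoT, simp, intro cI pc) auto
  qed (auto simp: simps simp del: snd_pair_wedge intro: cmap_real)
  have \<theta>Fm: "pair_map (susp_pair X p) ?P \<theta>F"
    unfolding \<theta>F_def
  proof (rule pair_map_cases)
    show "pair_map (fst (susp_pair X p), {}) ?P (\<lambda>z. (c z, \<xi> (1, snd z)))"
      by (rule pair_map_unbased, simp, intro cI cc continuous_map_unit_intervalD[OF cc]) (auto simp: c01)
    show "pair_map (fst (susp_pair X p), {}) ?P (\<lambda>z. (c z, p))"
      by (rule pair_map_unbased, simp, intro cI cc pc' continuous_map_unit_intervalD[OF cc]) (auto simp: c01)
    show "collapse_map (snd ?P) (c z, \<xi> (1, snd z)) = collapse_map (snd ?P) (c z, p)"
      if "z \<in> pt_set (susp_pair X p)" "fst z = 1/2" for z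
      using that sx[of 1 "snd z"] p xin[of 1 "snd z"] by (auto simp: collapse_map_eq_iff c_def tent_def)
    show "(c z, \<xi> (1, snd z)) \<in> snd ?P" if "z \<in> snd (susp_pair X p)" "fst z \<le> 1/2" for z
      using that sp[of 1] p xin[of 1 "snd z"] by (auto simp: c_def tent_def)
    show "(c z, p) \<in> snd ?P" if "z \<in> snd (susp_pair X p)" "1/2 < fst z" for z
      using that sp[of 1] p by (auto simp: c_def tent_def)
  qed (use p in \<open>auto intro: cmap_real\<close>)
  have \<theta>Tm: "pair_map (circle_pair X p) ?P (\<lambda>z. z)"
    by (rule pair_map_continuous)
      (auto simp: prod_topology_subtopology intro: continuous_map_from_subtopology)
  have \<theta>m: "pair_map ?B ?P \<theta>"
    unfolding \<theta>_def
  proof (rule pair_map_from_wedge)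
    fix b :: bool assume "b \<in> UNIV"
    show "pair_map (if b then circle_pair X p else susp_pair X p) ?P (\<lambda>z. case (b, z) of (b, z) \<Rightarrow> if b then z else \<theta>F z)"
      using \<theta>Fm \<theta>Tm by (cases b) auto
  qed
  have h1: "pair_homotopic ?P ?P (\<theta> \<circ> \<psi>) (\<lambda>z. (min 1 (4 * fst z), snd z))"
  proof (rule pair_homotopicI)
    \<comment> \<open>For \<open>t\<close> in \<open>[1/4, 1]\<close> the composite stays over
      \<open>p\<close>, and its height goes from \<open>1 - S\<close> down to 0 and then up to 1.
      \<open>v\<close> interpolates linearly to the direct path from \<open>1 - S\<close> to 1,
      where \<open>4/3\<close> rescales an interval of length \<open>3/4\<close>. At
      \<open>t = 1/4\<close> it keeps the value \<open>1 - S\<close>, as the other branch requires.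
      Meanwhile the retraction time \<open>1 - fst w\<close> runs back to 0, so that
      \<open>S\<close> becomes 0 and \<open>\<xi>\<close> becomes the identity.\<close>
    define S where "S w = s (1 - fst w, snd (snd w))" for w :: "real \<times> real \<times> 'a"
    define v where "v w = (1 - fst w) * ((1 - S w) * min 1 (max 0 (2 - 4 * fst (snd w))) + max 0 (2 * fst (snd w) - 1))
       + fst w * (1 - S w * min 1 ((1 - fst (snd w)) * (4/3)))" for w
    let ?I = "prod_topology unit_interval (prod_topology unit_interval X)"
    have S01: "0 \<le> S w \<and> S w \<le> 1" if "w \<in> topspace ?I" for w
      using that s01 by (auto simp: S_def)
    have S: "continuous_map ?I euclideanreal S"
      unfolding S_def by (intro cI) auto
    have v: "continuous_map ?I unit_interval v"
    proof (rule continuous_map_unit_intervalI)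
      show "continuous_map ?I euclideanreal v" unfolding v_def by (intro cI S)
      fix w assume w: "w \<in> topspace ?I"
      obtain \<sigma> t x where wd: "w = (\<sigma>, t, x)" "0 \<le> \<sigma>" "\<sigma> \<le> 1" "0 \<le> t" "t \<le> 1" using w by auto
      have 1: "0 \<le> (1 - S w) * min 1 (max 0 (2 - 4 * t)) \<and> (1 - S w) * min 1 (max 0 (2 - 4 * t)) \<le> 1"
        using S01[OF w] by (intro unit_mult) auto
      have 2: "0 \<le> S w * min 1 ((1 - t) * (4/3)) \<and> S w * min 1 ((1 - t) * (4/3)) \<le> 1"
        using S01[OF w] wd by (intro unit_mult) auto
      have 3: "0 \<le> (1 - S w) * min 1 (max 0 (2 - 4 * t)) + max 0 (2 * t - 1) \<and>
        (1 - S w) * min 1 (max 0 (2 - 4 * t)) + max 0 (2 * t - 1) \<le> 1"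
      proof (cases "t \<le> 1/2")
        case False
        then have "min 1 (max 0 (2 - 4 * t)) = 0" by auto
        then show ?thesis using wd False by auto
      qed (use 1 in auto)
      show "0 \<le> v w \<and> v w \<le> 1"
        unfolding v_def by (intro unit_convex) (use 2 3 wd in auto)
    qed
    show "pair_map (pair_cyl ?P) ?P (\<lambda>w. if fst (snd w) \<le> 1/4
       then ((1 - S w) * min 1 (4 * fst (snd w)), \<xi> (1 - fst w, snd (snd w))) else (v w, p))"
    proof (rule pair_map_cases)
      have u: "continuous_map ?I unit_interval (\<lambda>w. (1 - S w) * min 1 (4 * fst (snd w)))"
        using S01 by (intro continuous_map_unit_intervalI cI S unit_mult) auto
      show "pair_map (fst (pair_cyl ?P), {}) ?P
         (\<lambda>w. ((1 - S w) * min 1 (4 * fst (snd w)), \<xi> (1 - fst w, snd (snd w))))"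
        by (intro pair_map_unbased, simp, intro cmap u xI continuous_map_unit_intervalI cmap_real) auto
      show "pair_map (fst (pair_cyl ?P), {}) ?P (\<lambda>w. (v w, p))"
        by (intro pair_map_unbased, simp, intro cmap v pc')
      show "collapse_map (snd ?P) ((1 - S w) * min 1 (4 * fst (snd w)), \<xi> (1 - fst w, snd (snd w))) =
          collapse_map (snd ?P) (v w, p)"
        if "w \<in> pt_set (pair_cyl ?P)" "fst (snd w) = 1/4" for w
        using that sx[of "1 - fst w" "snd (snd w)"] p xin[of "1 - fst w" "snd (snd w)"]
        by (auto simp: collapse_map_eq_iff S_def v_def algebra_simps)
      show "((1 - S w) * min 1 (4 * fst (snd w)), \<xi> (1 - fst w, snd (snd w))) \<in> snd ?P"
        if "w \<in> snd (pair_cyl ?P)" "fst (snd w) \<le> 1/4" for w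
        using that xin[of "1 - fst w" "snd (snd w)"] by auto
      show "(v w, p) \<in> snd ?P" if "w \<in> snd (pair_cyl ?P)" "1/4 < fst (snd w)" for w
        using that p by (auto simp: v_def)
    qed (auto intro!: cI)
    fix z assume "z \<in> pt_set ?P"
    then obtain t x where z: "z = (t, x)" "0 \<le> t" "t \<le> 1" "x \<in> topspace X" by auto
    consider "t < 1/4" | "t = 1/4" | "1/4 < t" "t < 1/2" | "t = 1/2" | "1/2 < t" by linarith
    then show "collapse_map (snd ?P) (if fst (snd (0, z)) \<le> 1/4
       then ((1 - S (0, z)) * min 1 (4 * fst (snd (0, z))), \<xi> (1 - fst (0::real, z), snd (snd (0::real, z))))
       else (v (0, z), p)) = collapse_map (snd ?P) ((\<theta> \<circ> \<psi>) z)"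
    proof cases
      case 2
      with z have "z = (1/4, x)" by simp
      then show ?thesis by (simp add: \<theta>_def \<psi>_def \<theta>F_def c_def tent_def S_def v_def min_def max_def)
    next
      case 4
      with z have "z = (1/2, x)" by simp
      then show ?thesis by (simp add: \<theta>_def \<psi>_def \<theta>F_def c_def tent_def S_def v_def min_def max_def)
    qed (use z in \<open>simp_all add: \<theta>_def \<psi>_def \<theta>F_def c_def tent_def S_def v_def min_def max_def\<close>)
    show "collapse_map (snd ?P) (if fst (snd (1, z)) \<le> 1/4
       then ((1 - S (1, z)) * min 1 (4 * fst (snd (1, z))), \<xi> (1 - fst (1::real, z), snd (snd (1::real, z))))
       else (v (1, z), p)) = collapse_map (snd ?P) (min 1 (4 * fst z), snd z)"
      using z s0[of x] p by (auto simp: S_def v_def collapse_map_eq_iff)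
  qed
  \<comment> \<open>The slope \<open>4 - 3 * fst w\<close> falls from 4 to 1 and is never below 1,
    so the end \<open>t = 1\<close> stays in the collapsed set throughout.\<close>
  have slide: "continuous_map (prod_topology unit_interval (prod_topology unit_interval Z)) unit_interval
      (\<lambda>w. min 1 ((4 - 3 * fst w) * fst (snd w)))" for Z :: "'z topology"
    by (intro continuous_map_unit_intervalI cI) auto
  have slide1: "min 1 (4 - 3 * \<tau>) = 1" if "0 \<le> \<tau>" "\<tau> \<le> 1" for \<tau> :: real using that by auto
  have h2: "pair_homotopic ?P ?P (\<lambda>z. (min 1 (4 * fst z), snd z)) id"
  proof (rule pair_homotopicI)
    show "pair_map (pair_cyl ?P) ?P (\<lambda>w. (min 1 ((4 - 3 * fst w) * fst (snd w)), snd (snd w)))"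
    proof (rule pair_map_continuous)
      show "continuous_map (fst (pair_cyl ?P)) (fst ?P) (\<lambda>w. (min 1 ((4 - 3 * fst w) * fst (snd w)), snd (snd w)))"
        by (simp, intro cmap slide)
    qed (auto simp: slide1)
  qed auto
  have hP: "pair_homotopic ?P ?P (\<theta> \<circ> \<psi>) id"
    by (rule pair_homotopic_trans[OF h1 h2 P])
  \<comment> \<open>Over \<open>p\<close> the first half of the pinch map lands in
    \<open>I \<times> {p}\<close>, which is collapsed in \<open>susp_pair\<close>. What remains is
    the circle traversed on the second half, and it is straightened linearly.\<close>
  have hT: "pair_homotopic (circle_pair X p) ?B (\<lambda>z. (\<psi> \<circ> \<theta>) (True, z)) (\<lambda>z. id (True, z))"
  proof (rule pair_homotopicI)
    show "pair_map (pair_cyl (circle_pair X p)) ?B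
      (\<lambda>w. (True, ((1 - fst w) * max 0 (2 * fst (snd w) - 1) + fst w * fst (snd w), snd (snd w))))"
    proof (rule pair_map_continuous)
      show "continuous_map (fst (pair_cyl (circle_pair X p))) (fst ?B)
        (\<lambda>w. (True, ((1 - fst w) * max 0 (2 * fst (snd w) - 1) + fst w * fst (snd w), snd (snd w))))"
      proof (rule intoT, simp, intro cI)
        show "0 \<le> (1 - fst w) * max 0 (2 * fst (snd w) - 1) + fst w * fst (snd w) \<and>
           (1 - fst w) * max 0 (2 * fst (snd w) - 1) + fst w * fst (snd w) \<le> 1"
          if "w \<in> topspace (prod_topology unit_interval (prod_topology unit_interval (subtopology X {p})))" for w
          using that by (intro unit_convex) auto
      qed
    qed (auto simp: LB simp del: snd_pair_wedge)
  qed (auto simp: \<theta>_def \<psi>_def simps simp del: snd_pair_wedge)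
  \<comment> \<open>The circle component runs through the heights \<open>max 0 (2 * c - 1)\<close>,
    upwards for \<open>t \<le> 1/2\<close> and back afterwards. The factor \<open>1 - fst w\<close>
    contracts this excursion and leaves the suspension component.\<close>
  let ?H = "\<lambda>w. if fst (snd w) \<le> 1/2 then
       (if c (snd w) \<le> 1/2 then (False, (min 1 (2 * c (snd w)), \<xi> (1, snd (snd w))))
        else (True, ((1 - fst w) * max 0 (2 * c (snd w) - 1), p)))
     else (True, ((1 - fst w) * max 0 (2 * c (snd w) - 1), p))"
  have hF1: "pair_homotopic (susp_pair X p) ?B (\<lambda>z. (\<psi> \<circ> \<theta>) (False, z)) (\<lambda>z. (False, (min 1 (4 * fst z), \<xi> (1, snd z))))"
  proof (rule pair_homotopicI)
    let ?I = "prod_topology unit_interval (prod_topology unit_interval X)"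
    let ?C = "pair_cyl (susp_pair X p)"
    have fC: "fst ?C = ?I" by simp
    have d: "continuous_map ?I unit_interval (\<lambda>w. (1 - fst w) * max 0 (2 * c (snd w) - 1))"
      using c01 by (intro continuous_map_unit_intervalI cI continuous_map_unit_intervalD[OF cc'] unit_mult) auto
    have dm: "pair_map (?I, {}) ?B (\<lambda>w. (True, ((1 - fst w) * max 0 (2 * c (snd w) - 1), p)))"
      by (rule pair_map_unbased, rule intoT, intro cmap d pc)
    have em: "pair_map (?I, {}) ?B (\<lambda>w. (False, (min 1 (2 * c (snd w)), \<xi> (1, snd (snd w)))))"
      using c01 by (intro pair_map_unbased intoF cI continuous_map_unit_intervalD[OF cc']) auto
    show "pair_map ?C ?B ?H"
    proof (rule pair_map_cases)
      show "pair_map (fst ?C, {}) ?B (\<lambda>w. if c (snd w) \<le> 1/2 then (False, (min 1 (2 * c (snd w)), \<xi> (1, snd (snd w))))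
        else (True, ((1 - fst w) * max 0 (2 * c (snd w) - 1), p)))"
        unfolding fC
      proof (rule pair_map_cases)
        show "continuous_map (fst (?I, {})) euclideanreal (\<lambda>w. c (snd w))"
          by (simp, intro cI continuous_map_unit_intervalD[OF cc'])
      qed (use dm em xin in \<open>auto simp: simps simp del: snd_pair_wedge\<close>)
      show "pair_map (fst ?C, {}) ?B (\<lambda>w. (True, ((1 - fst w) * max 0 (2 * c (snd w) - 1), p)))"
        using dm by simp
      show "collapse_map (snd ?B) (if c (snd w) \<le> 1/2 then (False, (min 1 (2 * c (snd w)), \<xi> (1, snd (snd w))))
          else (True, ((1 - fst w) * max 0 (2 * c (snd w) - 1), p))) =
         collapse_map (snd ?B) (True, ((1 - fst w) * max 0 (2 * c (snd w) - 1), p))"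
        if w: "w \<in> pt_set ?C" "fst (snd w) = 1/2" for w
      proof (cases "c (snd w) \<le> 1/2")
        case True
        then have "s (1, snd (snd w)) \<noteq> 0" using w by (auto simp: c_def tent_def)
        then have "\<xi> (1, snd (snd w)) = p" using sx[of 1 "snd (snd w)"] w by auto
        then show ?thesis using True c01[of "snd w"] w by (auto simp: simps simp del: snd_pair_wedge)
      qed auto
      show "(if c (snd w) \<le> 1/2 then (False, (min 1 (2 * c (snd w)), \<xi> (1, snd (snd w))))
          else (True, ((1 - fst w) * max 0 (2 * c (snd w) - 1), p))) \<in> snd ?B"
        if w: "w \<in> snd ?C" "fst (snd w) \<le> 1/2" for w
      proof -
        have "c (snd w) = 0" using w sp[of 1] by (auto simp: c_def tent_def)
        then show ?thesis using w xin[of 1 "snd (snd w)"] p by (auto simp: simps simp del: snd_pair_wedge)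
      qed
      show "(True, ((1 - fst w) * max 0 (2 * c (snd w) - 1), p)) \<in> snd ?B"
        if w: "w \<in> snd ?C" "1/2 < fst (snd w)" for w
      proof -
        have "c (snd w) = 0" using w sp[of 1] by (auto simp: c_def tent_def)
        then show ?thesis by (auto simp: simps simp del: snd_pair_wedge)
      qed
    qed (use p in \<open>auto intro!: cI\<close>)
    fix z assume "z \<in> pt_set (susp_pair X p)"
    then obtain t x where z: "z = (t, x)" "0 \<le> t" "t \<le> 1" "x \<in> topspace X" by auto
    show "collapse_map (snd ?B) (?H (0, z)) = collapse_map (snd ?B) ((\<psi> \<circ> \<theta>) (False, z))"
      using z c01[of z] p xin[of 1 x] by (auto simp: \<theta>_def \<theta>F_def \<psi>_def simps simp del: snd_pair_wedge)
    show "collapse_map (snd ?B) (?H (1, z)) = collapse_map (snd ?B) (False, (min 1 (4 * fst z), \<xi> (1, snd z)))"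
    \<comment> \<open>If \<open>s (1, x) = 0\<close>, then \<open>c\<close> is the plain tent and
      \<open>2 * c = 4 * t\<close> on the rising part, while all later points are collapsed.
      Otherwise \<open>\<xi> (1, x) = p\<close>, and both sides are the base point.\<close>
    proof (cases "s (1, x) = 0")
      case True
      then have "c z = tent t" by (simp add: c_def z)
      then show ?thesis using z p xin[of 1 x]
        by (auto simp: tent_def simps simp del: snd_pair_wedge)
    next
      case False
      then have "\<xi> (1, x) = p" using sx[of 1 x] z by auto
      then show ?thesis using z p c01[of z] by (auto simp: simps simp del: snd_pair_wedge)
    qed
  qed
  \<comment> \<open>The slope and the retraction time return to 1 and 0 together. Points over
    \<open>p\<close> stay over \<open>p\<close> since \<open>\<xi>\<close> fixes it.\<close>
  have hF2: "pair_homotopic (susp_pair X p) ?B (\<lambda>z. (False, (min 1 (4 * fst z), \<xi> (1, snd z)))) (\<lambda>z. id (False, z))"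
  proof (rule pair_homotopicI)
    show "pair_map (pair_cyl (susp_pair X p)) ?B
      (\<lambda>w. (False, (min 1 ((4 - 3 * fst w) * fst (snd w)), \<xi> (1 - fst w, snd (snd w)))))"
    proof (rule pair_map_continuous)
      show "continuous_map (fst (pair_cyl (susp_pair X p))) (fst ?B)
        (\<lambda>w. (False, (min 1 ((4 - 3 * fst w) * fst (snd w)), \<xi> (1 - fst w, snd (snd w)))))"
        by (rule intoF, simp, intro slide cmap xI continuous_map_unit_intervalI cmap_real) auto
      show "(\<lambda>w. (False, (min 1 ((4 - 3 * fst w) * fst (snd w)), \<xi> (1 - fst w, snd (snd w)))))
          ` snd (pair_cyl (susp_pair X p)) \<subseteq> snd ?B"
      proof (rule image_subsetI)
        fix w assume "w \<in> snd (pair_cyl (susp_pair X p))"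
        then obtain \<tau> t x where w: "w = (\<tau>, t, x)" "0 \<le> \<tau>" "\<tau> \<le> 1" "(t, x) \<in> snd (susp_pair X p)" by auto
        then have "t = 0 \<or> t = 1 \<or> x = p" "0 \<le> t" "t \<le> 1" "x \<in> topspace X" using p by auto
        then show "(False, (min 1 ((4 - 3 * fst w) * fst (snd w)), \<xi> (1 - fst w, snd (snd w)))) \<in> snd ?B"
          using w xin[of "1 - \<tau>" x] sp[of "1 - \<tau>"] by (auto simp: slide1 LB simp del: snd_pair_wedge)
      qed
    qed
  qed (use s0 in auto)
  have "pair_homotopic ?B ?B (\<psi> \<circ> \<theta>) id"
  proof (rule pair_homotopic_from_wedge, goal_cases)
    case (1 b)
    show ?case
      using hT pair_homotopic_trans[OF hF1 hF2 proper_susp_pair[OF p]] by (cases b) simp_all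
  qed
  with \<psi>m \<theta>m hP show ?thesis unfolding pair_equiv_def by blast
qed

section \<open>Cubes relative to their boundary\<close>

definition cube_pair :: "nat \<Rightarrow> (nat \<Rightarrow> real) pair" where
  "cube_pair n = (cube n, cube_boundary n)"

lemma fst_cube_pair [simp]: "fst (cube_pair n) = cube n"
  and snd_cube_pair [simp]: "snd (cube_pair n) = cube_boundary n"
  by (simp_all add: cube_pair_def)

lemma topspace_cube: "topspace (cube n) = {..<n} \<rightarrow>\<^sub>E {0..1}"
  by (simp add: cube_def)

lemma cube_bounds: "t \<in> topspace (cube n) \<Longrightarrow> i < n \<Longrightarrow> 0 \<le> t i \<and> t i \<le> 1"
  by (auto simp: topspace_cube PiE_iff)

lemma cube_coordinate: "i < n \<Longrightarrow> continuous_map (cube n) unit_interval (\<lambda>t. t i)"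
  unfolding cube_def by (rule continuous_map_product_projection) simp

lemma continuous_map_into_cube:
  "continuous_map Z (cube n) f \<longleftrightarrow>
    f ` topspace Z \<subseteq> extensional {..<n} \<and> (\<forall>i<n. continuous_map Z unit_interval (\<lambda>x. f x i))"
  unfolding cube_def by (auto simp: continuous_map_componentwise)

lemma cube_lc [simp]: "locally_compact_space (cube n)" "Hausdorff_space (cube n)" "compact_space (cube n)"
proof -
  show "compact_space (cube n)"
    unfolding cube_def by (simp add: compact_space_product_topology compact_space_subtopology)
  then show "locally_compact_space (cube n)" by (rule compact_imp_locally_compact_space)
  show "Hausdorff_space (cube n)"
    unfolding cube_def by (simp add: Hausdorff_space_product_topology)
qed

lemma cube_boundary_subset: "cube_boundary n \<subseteq> topspace (cube n)"
  by (auto simp: cube_boundary_def)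

lemma zero_in_cube_boundary: "n \<ge> 1 \<Longrightarrow> (\<lambda>i\<in>{..<n}. 0) \<in> cube_boundary n"
  by (auto simp: cube_boundary_def topspace_cube intro!: exI[of _ 0])

lemma cube_boundary_nonempty: "n \<ge> 1 \<Longrightarrow> cube_boundary n \<noteq> {}"
  using zero_in_cube_boundary by blast

lemma proper_cube_pair: "n \<ge> 1 \<Longrightarrow> proper_pair (cube_pair n)"
  by (simp add: proper_pair_def cube_boundary_subset cube_boundary_nonempty)

section \<open>The sphere as a quotient of the cube\<close>

definition cube_radius :: "nat \<Rightarrow> (nat \<Rightarrow> real) \<Rightarrow> real" where
  "cube_radius m t = Max ((\<lambda>i. \<bar>2 * t i - 1\<bar>) ` {..<m})"

definition cube_sqnorm :: "nat \<Rightarrow> (nat \<Rightarrow> real) \<Rightarrow> real" where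
  "cube_sqnorm m t = (\<Sum>i<m. (2 * t i - 1)^2)"

text \<open>Inverse stereographic projection applied to the point \<open>u / (1 - \<parallel>u\<parallel>)\<close>, where \<open>u = 2 t - 1\<close> and
  the norm is the maximum norm, with cleared denominators.\<close>

definition cube_to_sphere :: "nat \<Rightarrow> (nat \<Rightarrow> real) \<Rightarrow> nat \<Rightarrow> real" where
  "cube_to_sphere m t =
    (let b = 1 - cube_radius m t; S = cube_sqnorm m t in
     (\<lambda>j. if j = 0 then (S - b^2) / (S + b^2)
          else if j \<le> m then 2 * b * (2 * t (j - 1) - 1) / (S + b^2) else 0))"

lemma continuous_map_Max:
  assumes "finite I" "I \<noteq> {}" "\<And>i. i \<in> I \<Longrightarrow> continuous_map X euclideanreal (f i)"
  shows "continuous_map X euclideanreal (\<lambda>x. Max ((\<lambda>i. f i x) ` I))"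
  using assms
proof (induction I rule: finite_ne_induct)
  case (insert i I)
  have "continuous_map X euclideanreal (\<lambda>x. max (f i x) (Max ((\<lambda>i. f i x) ` I)))"
    using insert by (intro continuous_map_real_max) auto
  then show ?case using insert by simp
qed auto

lemma cube_radius_eqI:
  assumes "\<And>i. i < m \<Longrightarrow> \<bar>2 * t i - 1\<bar> \<le> c" "i < m" "\<bar>2 * t i - 1\<bar> = c"
  shows "cube_radius m t = c"
  unfolding cube_radius_def using assms by (intro Max_eqI) auto

lemma cube_radius_ge: "i < m \<Longrightarrow> \<bar>2 * t i - 1\<bar> \<le> cube_radius m t"
  unfolding cube_radius_def by (intro Max_ge) auto

lemma cube_radius_attained: "m \<ge> 1 \<Longrightarrow> \<exists>i<m. cube_radius m t = \<bar>2 * t i - 1\<bar>"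
proof -
  assume "m \<ge> 1"
  then have "0 \<in> {..<m}" by simp
  then have "(\<lambda>i. \<bar>2 * t i - 1\<bar>) ` {..<m} \<noteq> {}" by blast
  from Max_in[OF _ this] show ?thesis unfolding cube_radius_def by auto
qed

lemma cube_radius_le1: "m \<ge> 1 \<Longrightarrow> t \<in> topspace (cube m) \<Longrightarrow> cube_radius m t \<le> 1"
  using cube_radius_attained[of m t] cube_bounds[of t m] by force

lemma cube_radius_eq1_iff:
  assumes "m \<ge> 1" "t \<in> topspace (cube m)"
  shows "cube_radius m t = 1 \<longleftrightarrow> t \<in> cube_boundary m"
proof
  assume "cube_radius m t = 1"
  then obtain i where "i < m" "\<bar>2 * t i - 1\<bar> = 1" using cube_radius_attained[OF assms(1), of t] by auto
  then show "t \<in> cube_boundary m" using assms by (force simp: cube_boundary_def)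
next
  assume "t \<in> cube_boundary m"
  then obtain i where "i < m" "t i = 0 \<or> t i = 1" by (auto simp: cube_boundary_def)
  then have "1 \<le> cube_radius m t" using cube_radius_ge[of i m t] by auto
  then show "cube_radius m t = 1" using cube_radius_le1[OF assms] by simp
qed

text \<open>The two squares cannot vanish together: if the maximum norm of \<open>2 t - 1\<close> is
  1, some coordinate already contributes 1 to the Euclidean norm.\<close>

lemma cube_sphere_denominator:
  assumes "m \<ge> 1"
  shows "cube_sqnorm m t + (1 - cube_radius m t)^2 > 0"
proof (cases "cube_radius m t = 1")
  case True
  then obtain i where i: "i < m" "\<bar>2 * t i - 1\<bar> = 1" using cube_radius_attained[OF assms, of t] by auto
  have "(2 * t i - 1)^2 \<le> cube_sqnorm m t"
    unfolding cube_sqnorm_def using i by (intro member_le_sum) auto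
  moreover have "(2 * t i - 1)^2 = 1" using i by (metis power2_abs one_power2)
  ultimately show ?thesis using True by simp
next
  case False
  then show ?thesis unfolding cube_sqnorm_def
    by (intro add_nonneg_pos sum_nonneg) auto
qed

lemma cube_to_sphere_0: "cube_to_sphere m t 0 =
   (cube_sqnorm m t - (1 - cube_radius m t)^2) / (cube_sqnorm m t + (1 - cube_radius m t)^2)"
  and cube_to_sphere_Suc: "i < m \<Longrightarrow> cube_to_sphere m t (Suc i) =
   2 * (1 - cube_radius m t) * (2 * t i - 1) / (cube_sqnorm m t + (1 - cube_radius m t)^2)"
  and cube_to_sphere_gt: "m < j \<Longrightarrow> cube_to_sphere m t j = 0"
  by (auto simp: cube_to_sphere_def Let_def)

lemma topspace_nsphere: "topspace (nsphere m) = {x. (\<Sum>i\<le>m. (x i)^2) = 1 \<and> (\<forall>i>m. x i = 0)}"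
  by (simp add: nsphere)

text \<open>This is the identity \<open>(S - b^2)^2 + 4 b^2 S = (S + b^2)^2\<close>.\<close>

lemma cube_to_sphere_in:
  assumes "m \<ge> 1"
  shows "cube_to_sphere m t \<in> topspace (nsphere m)"
proof -
  let ?b = "1 - cube_radius m t" and ?S = "cube_sqnorm m t"
  let ?D = "?S + ?b^2"
  have D: "?D > 0" by (rule cube_sphere_denominator[OF assms])
  have "(\<Sum>i<m. (cube_to_sphere m t (Suc i))^2) = (\<Sum>i<m. (4 * ?b^2 / ?D^2) * (2 * t i - 1)^2)"
  proof (intro sum.cong refl)
    have "(2 * b * u / D)^2 = 4 * b^2 / D^2 * u^2" for b u D :: real
      by (simp add: power_divide power_mult_distrib)
    then show "(cube_to_sphere m t (Suc i))^2 = (4 * ?b^2 / ?D^2) * (2 * t i - 1)^2" if "i \<in> {..<m}" for i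
      using that by (simp only: cube_to_sphere_Suc lessThan_iff)
  qed
  also have "\<dots> = 4 * ?b^2 / ?D^2 * ?S" by (simp add: cube_sqnorm_def sum_distrib_left)
  finally have "(\<Sum>i\<le>m. (cube_to_sphere m t i)^2) = ((?S - ?b^2) / ?D)^2 + 4 * ?b^2 / ?D^2 * ?S"
    by (simp add: sum.atMost_shift cube_to_sphere_0)
  also have "\<dots> = ((?S - ?b^2)^2 + 4 * ?b^2 * ?S) / ?D^2"
    by (simp add: power_divide add_divide_distrib)
  also have "(?S - ?b^2)^2 + 4 * ?b^2 * ?S = ?D^2" by (simp add: power2_eq_square algebra_simps)
  also have "?D^2 / ?D^2 = 1" using D by simp
  finally show ?thesis by (simp add: topspace_nsphere cube_to_sphere_gt)
qed

lemma continuous_map_cube_to_sphere: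
  assumes "m \<ge> 1"
  shows "continuous_map (cube m) (nsphere m) (cube_to_sphere m)"
proof -
  have co: "continuous_map (cube m) euclideanreal (\<lambda>t. t i)" if "i < m" for i
    by (rule continuous_map_unit_intervalD[OF cube_coordinate[OF that]])
  have r: "continuous_map (cube m) euclideanreal (cube_radius m)"
    unfolding cube_radius_def
    by (rule continuous_map_Max)
       (use assms in \<open>auto simp: lessThan_empty_iff intro!: continuous_map_real_abs cmap_real co\<close>)
  have S: "continuous_map (cube m) euclideanreal (cube_sqnorm m)"
    unfolding cube_sqnorm_def by (intro continuous_map_sum continuous_map_real_pow cmap_real co) auto
  have D: "cube_sqnorm m t + (1 - cube_radius m t)^2 \<noteq> 0" for t
    using cube_sphere_denominator[OF assms, of t] by simp
  have "continuous_map (cube m) euclideanreal (\<lambda>t. cube_to_sphere m t j)" for j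
  proof -
    consider "j = 0" | i where "j = Suc i" "i < m" | "m < j" using not_less_eq by (cases j) blast+
    then show ?thesis
    proof cases
      case 1
      show ?thesis unfolding 1 cube_to_sphere_0
        by (intro continuous_map_real_divide continuous_map_real_pow cmap_real r S D)
    next
      case (2 i)
      show ?thesis unfolding 2(1) cube_to_sphere_Suc[OF 2(2)]
        by (intro continuous_map_real_divide continuous_map_real_pow cmap_real r S D co 2)
    qed (simp add: cube_to_sphere_gt)
  qed
  then have "continuous_map (cube m) (powertop_real UNIV) (cube_to_sphere m)"
    by (simp add: continuous_map_componentwise_UNIV)
  then show ?thesis
    using cube_to_sphere_in[OF assms] unfolding topspace_nsphere
    by (auto simp: nsphere continuous_map_in_subtopology)
qed

text \<open>The coordinate with index 0 equals 1 exactly if \<open>b = 0\<close>, that is, if the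
  maximum norm of \<open>2 t - 1\<close> is 1.\<close>

lemma cube_to_sphere_base_iff:
  assumes "m \<ge> 1" "t \<in> topspace (cube m)"
  shows "cube_to_sphere m t = (\<lambda>i. if i = 0 then 1 else 0) \<longleftrightarrow> t \<in> cube_boundary m"
proof -
  let ?b = "1 - cube_radius m t" and ?S = "cube_sqnorm m t"
  have D: "?S + ?b^2 > 0" by (rule cube_sphere_denominator[OF assms(1)])
  have "cube_to_sphere m t = (\<lambda>i. if i = 0 then 1 else 0) \<longleftrightarrow> ?b = 0"
  proof
    assume "cube_to_sphere m t = (\<lambda>i. if i = 0 then 1 else 0)"
    then have "cube_to_sphere m t 0 = 1" by simp
    then have "(?S - ?b^2) / (?S + ?b^2) = 1" by (simp only: cube_to_sphere_0)
    then have "?S - ?b^2 = ?S + ?b^2" using D by (simp add: field_simps)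
    then show "?b = 0" by simp
  next
    assume b: "?b = 0"
    show "cube_to_sphere m t = (\<lambda>i. if i = 0 then 1 else 0)"
      using b D by (auto simp: cube_to_sphere_def Let_def fun_eq_iff)
  qed
  then show ?thesis using cube_radius_eq1_iff[OF assms] by auto
qed

text \<open>Stereographic projection from the base point, the division by \<open>1 - y 0\<close>,
  recovers \<open>(2 t - 1) / b\<close>. The maximum norm of that vector is
  \<open>r / (1 - r)\<close> with \<open>r = cube_radius m t\<close>, which determines
  \<open>r\<close> and then \<open>t\<close>.\<close>

lemma cube_to_sphere_inj:
  assumes m: "m \<ge> 1" and t: "t \<in> topspace (cube m)" and t': "t' \<in> topspace (cube m)"
    and eq: "cube_to_sphere m t = cube_to_sphere m t'" and nb: "t \<notin> cube_boundary m"
  shows "t = t'"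
proof -
  let ?b = "1 - cube_radius m t" and ?S = "cube_sqnorm m t"
  let ?b' = "1 - cube_radius m t'" and ?S' = "cube_sqnorm m t'"
  have nb': "t' \<notin> cube_boundary m"
    using nb eq cube_to_sphere_base_iff[OF m t] cube_to_sphere_base_iff[OF m t'] by simp
  have b: "?b > 0" "?b' > 0"
    using cube_radius_le1[OF m t] cube_radius_le1[OF m t'] cube_radius_eq1_iff[OF m t] cube_radius_eq1_iff[OF m t'] nb nb'
    by auto
  have D: "?S + ?b^2 > 0" "?S' + ?b'^2 > 0" using cube_sphere_denominator[OF m] by blast+
  have key: "(2 * t i - 1) / ?b = (2 * t' i - 1) / ?b'" if "i < m" for i
  proof -
    have r: "cube_to_sphere m s (Suc i) / (1 - cube_to_sphere m s 0) = (2 * s i - 1) / (1 - cube_radius m s)"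
      if "1 - cube_radius m s > 0" for s
    proof -
      let ?c = "1 - cube_radius m s" and ?T = "cube_sqnorm m s"
      have D: "?T + ?c^2 > 0" by (rule cube_sphere_denominator[OF m])
      have "1 - cube_to_sphere m s 0 = 2 * ?c^2 / (?T + ?c^2)"
        using D by (simp add: cube_to_sphere_0 field_simps)
      moreover have "cube_to_sphere m s (Suc i) = 2 * ?c * (2 * s i - 1) / (?T + ?c^2)"
        using \<open>i < m\<close> by (rule cube_to_sphere_Suc)
      moreover have "(2 * c * u / E) / (2 * c^2 / E) = u / c" if "c > 0" "E > 0" for c u E :: real
        using that by (simp add: power2_eq_square)
      ultimately show ?thesis using D that by (simp only:)
    qed
    show ?thesis using r[OF b(1)] r[OF b(2)] eq by simp
  qed
  \<comment> \<open>One inequality between the maximum norms of proportional vectors; used in both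
    directions it gives equality.\<close>
  have le: "cube_radius m s / (1 - cube_radius m s) \<le> cube_radius m s' / (1 - cube_radius m s')"
    if k: "\<And>i. i < m \<Longrightarrow> (2 * s i - 1) / (1 - cube_radius m s) = (2 * s' i - 1) / (1 - cube_radius m s')"
      and pos: "1 - cube_radius m s > 0" "1 - cube_radius m s' > 0" for s s'
  proof -
    obtain i where i: "i < m" "cube_radius m s = \<bar>2 * s i - 1\<bar>" using cube_radius_attained[OF m, of s] by auto
    have "cube_radius m s / (1 - cube_radius m s) = \<bar>(2 * s i - 1) / (1 - cube_radius m s)\<bar>"
      unfolding abs_divide i(2)[symmetric] using pos by simp
    also have "\<dots> = \<bar>2 * s' i - 1\<bar> / (1 - cube_radius m s')" using k[OF i(1)] pos by (simp add: abs_divide)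
    also have "\<dots> \<le> cube_radius m s' / (1 - cube_radius m s')"
      using cube_radius_ge[OF i(1), of s'] pos by (intro divide_right_mono) auto
    finally show ?thesis .
  qed
  have "cube_radius m t / ?b = cube_radius m t' / ?b'"
    using le[OF key b] le[OF key[symmetric] b(2,1)] by simp
  then have bb: "?b = ?b'" using b by (simp add: field_simps)
  have "t i = t' i" if "i < m" for i
    using key[OF that] bb b by simp
  then show ?thesis using t t' unfolding topspace_cube by (metis PiE_ext lessThan_iff)
qed

lemma cube_to_sphere_surj:
  assumes m: "m \<ge> 1" and y: "y \<in> topspace (nsphere m)"
  shows "\<exists>t\<in>topspace (cube m). cube_to_sphere m t = y"
proof -
  have sq: "(y 0)^2 + (\<Sum>i<m. (y (Suc i))^2) = 1" and ygt: "\<And>j. j > m \<Longrightarrow> y j = 0"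
    using y by (auto simp: topspace_nsphere sum.atMost_shift)
  have snn: "(\<Sum>i<m. (y (Suc i))^2) \<ge> 0" by (intro sum_nonneg) auto
  show ?thesis
  proof (cases "y 0 = 1")
    case True
    then have z: "(\<Sum>i<m. (y (Suc i))^2) = 0" using sq by simp
    then have "\<forall>i<m. y (Suc i) = 0" by (subst (asm) sum_nonneg_eq_0_iff) auto
    then have "y = (\<lambda>i. if i = 0 then 1 else 0)"
      using True ygt by (intro ext) (metis Suc_pred not_less_eq not_gr0)
    then show ?thesis
      using zero_in_cube_boundary[OF m] cube_to_sphere_base_iff[OF m, of "\<lambda>i\<in>{..<m}. 0"] cube_boundary_subset by blast
  next
    case False
    have "(y 0)^2 \<le> 1" using sq snn by simp
    then have "y 0 \<le> 1" using power2_le_imp_le[of "y 0" 1] by simp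
    with False have y0: "y 0 < 1" by simp
    define x where "x i = y (Suc i) / (1 - y 0)" for i
    define c where "c = Max ((\<lambda>i. \<bar>x i\<bar>) ` {..<m})"
    have ne: "(\<lambda>i. \<bar>x i\<bar>) ` {..<m} \<noteq> {}" using m by (auto simp: lessThan_empty_iff)
    have cge: "\<bar>x i\<bar> \<le> c" if "i < m" for i unfolding c_def using that by (intro Max_ge) auto
    obtain i0 where i0: "i0 < m" "\<bar>x i0\<bar> = c" using Max_in[OF _ ne] unfolding c_def by auto
    have c0: "c \<ge> 0" using i0 by linarith
    \<comment> \<open>\<open>x\<close> is the stereographic image of \<open>y\<close> and
      \<open>c\<close> its maximum norm. Solving \<open>x = u / (1 - r)\<close> for a vector
      \<open>u\<close> of maximum norm \<open>r\<close> gives \<open>r = c / (1 + c)\<close> and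
      \<open>u = x / (1 + c)\<close>, and \<open>t\<close> is chosen with
      \<open>2 t - 1 = u\<close>.\<close>
    define t where "t = (\<lambda>i\<in>{..<m}. (x i / (1 + c) + 1) / 2)"
    have "2 * ((a + 1) / 2) - 1 = a" for a :: real by (simp add: field_simps)
    then have ut: "2 * t i - 1 = x i / (1 + c)" if "i < m" for i
      using that by (simp only: t_def restrict_apply' lessThan_iff)
    have rad: "cube_radius m t = c / (1 + c)"
      by (rule cube_radius_eqI[of m t _ i0])
        (use ut cge i0 c0 in \<open>auto simp: abs_divide intro!: divide_right_mono\<close>)
    have b: "1 - cube_radius m t = 1 / (1 + c)" using c0 by (simp add: rad field_simps)
    have xx: "(\<Sum>i<m. (x i)^2) = (1 + y 0) / (1 - y 0)"
    proof -
      have "(\<Sum>i<m. (x i)^2) = (\<Sum>i<m. (y (Suc i))^2) / (1 - y 0)^2"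
        by (simp add: x_def power_divide sum_divide_distrib)
      also have "(\<Sum>i<m. (y (Suc i))^2) = (1 - y 0) * (1 + y 0)" using sq by (simp add: power2_eq_square algebra_simps)
      finally show ?thesis using y0 by (simp add: power2_eq_square)
    qed
    have S: "cube_sqnorm m t = (1 + y 0) / (1 - y 0) * (1 / (1 + c))^2"
    proof -
      have "cube_sqnorm m t = (\<Sum>i<m. (x i)^2 * (1 / (1 + c))^2)"
        unfolding cube_sqnorm_def by (intro sum.cong) (auto simp: ut power_divide)
      then show ?thesis by (simp only: sum_distrib_right[symmetric] xx)
    qed
    have e: "2 / (1 - y 0) = (1 + y 0) / (1 - y 0) + 1" "2 * y 0 / (1 - y 0) = (1 + y 0) / (1 - y 0) - 1"
      using y0 by (simp_all add: field_simps)
    have D: "cube_sqnorm m t + (1 - cube_radius m t)^2 = 2 / (1 - y 0) * (1 / (1 + c))^2"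
      unfolding S b e by (simp only: distrib_right mult_1)
    have N: "cube_sqnorm m t - (1 - cube_radius m t)^2 = 2 * y 0 / (1 - y 0) * (1 / (1 + c))^2"
      unfolding S b e by (simp only: left_diff_distrib mult_1)
    have q: "(1 / (1 + c))^2 \<noteq> 0" using c0 by simp
    have "cube_to_sphere m t j = y j" for j
    proof -
      consider "j = 0" | i where "j = Suc i" "i < m" | "m < j" using not_less_eq by (cases j) blast+
      then show ?thesis
      proof cases
        case 1
        have "cube_to_sphere m t 0 = (2 * y 0 / (1 - y 0)) / (2 / (1 - y 0))"
          unfolding cube_to_sphere_0 D N using q by (rule nonzero_mult_divide_mult_cancel_right)
        also have "\<dots> = y 0" using y0 by simp
        finally show ?thesis using 1 by simp
      next
        case (2 i)
        have "cube_to_sphere m t (Suc i) = (2 * x i * (1 / (1 + c))^2) / (2 / (1 - y 0) * (1 / (1 + c))^2)"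
          unfolding cube_to_sphere_Suc[OF 2(2)] D unfolding b ut[OF 2(2)] by (simp add: power2_eq_square)
        also have "\<dots> = (2 * x i) / (2 / (1 - y 0))"
          using q by (rule nonzero_mult_divide_mult_cancel_right)
        also have "\<dots> = y (Suc i)" using y0 by (simp add: x_def)
        finally show ?thesis using 2 by simp
      qed (simp add: cube_to_sphere_gt ygt)
    qed
    moreover have "t \<in> topspace (cube m)"
    proof -
      have xc: "\<bar>x i / (1 + c)\<bar> \<le> 1" if "i < m" for i
        using cge[OF that] c0 by (simp add: abs_divide)
      then have "0 \<le> x i / (1 + c) + 1 \<and> x i / (1 + c) + 1 \<le> 2" if "i < m" for i
        using xc[OF that] unfolding abs_le_iff by linarith
      then show ?thesis by (auto simp: t_def topspace_cube)
    qed
    ultimately show ?thesis by blast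
  qed
qed

text \<open>A continuous surjection from a compact space onto a Hausdorff space is closed and hence
  a quotient map.\<close>

lemma pair_presents_sphere:
  assumes m: "m \<ge> 1"
  shows "pair_presents (cube_pair m) (based_sphere m) (cube_to_sphere m)"
  unfolding pair_presents_def
proof (intro conjI ballI impI)
  have H: "Hausdorff_space (nsphere m)"
    unfolding nsphere by (intro Hausdorff_space_subtopology) (simp add: Hausdorff_space_product_topology)
  have "closed_map (cube m) (nsphere m) (cube_to_sphere m)"
    by (rule continuous_imp_closed_map[OF continuous_map_cube_to_sphere[OF m]]) (use H in auto)
  moreover have "cube_to_sphere m ` topspace (cube m) = topspace (nsphere m)"
    using cube_to_sphere_in[OF m] cube_to_sphere_surj[OF m] by blast
  ultimately show "quotient_map (fst (cube_pair m)) (fst (based_sphere m)) (cube_to_sphere m)"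
    using continuous_map_cube_to_sphere[OF m]
    by (simp add: based_sphere_def continuous_closed_imp_quotient_map)
qed (use m cube_to_sphere_base_iff[OF m] cube_to_sphere_inj[OF m] in \<open>auto simp: based_sphere_def proper_cube_pair\<close>)

text \<open>The additional summand, which collapses to a point, keeps the collapsed set nonempty if
  \<open>I\<close> is empty.\<close>

lemma pair_presents_wedge:
  assumes P: "\<And>i. i \<in> I \<Longrightarrow> snd (P i) \<in> topspace (fst (P i))" and i0: "i0 \<notin> I"
    and T: "topspace T \<noteq> {}"
  shows "pair_presents
    (pair_wedge (insert i0 I) (\<lambda>i. if i = i0 then (T, topspace T) else (fst (P i), {snd (P i)})))
    (wedge I P)
    (\<lambda>(i, x). if i = i0 then snd (wedge I P) else collapse_map (snd (wedge I P)) (i, x))"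
proof -
  let ?B = "(\<lambda>i. (i, snd (P i))) ` I"
  let ?Q = "\<lambda>i. if i = i0 then (T, topspace T) else (fst (P i), {snd (P i)})"
  let ?W = "pair_wedge (insert i0 I) ?Q"
  let ?\<kappa> = "\<lambda>(i, x). if i = i0 then ?B else collapse_map ?B (i, x)"
  have sw: "snd (wedge I P) = ?B" by (simp add: wedge_def)
  have fw: "fst (wedge I P) = fst (collapse (sum_topology (\<lambda>i. fst (P i)) I) ?B)"
    by (simp add: wedge_def)
  have sub: "{x. (i, x) \<in> {z \<in> topspace (sum_topology (\<lambda>i. fst (P i)) I). collapse_map ?B z \<in> U}} =
     {x. (i, x) \<in> {z \<in> pt_set ?W. ?\<kappa> z \<in> U}}" if "i \<in> I" for i U
    using that i0 by auto
  \<comment> \<open>In the additional summand the preimage is everything or empty, hence open, so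
    this summand imposes no condition on \<open>U\<close>.\<close>
  have sub0: "{x. (i0, x) \<in> {z \<in> pt_set ?W. ?\<kappa> z \<in> U}} = (if ?B \<in> U then topspace T else {})" for U
    using i0 by auto
  have im: "?\<kappa> ` pt_set ?W = insert ?B (collapse_map ?B ` topspace (sum_topology (\<lambda>i. fst (P i)) I))"
  proof
    show "?\<kappa> ` pt_set ?W \<subseteq> insert ?B (collapse_map ?B ` topspace (sum_topology (\<lambda>i. fst (P i)) I))"
    proof (rule image_subsetI)
      fix z assume z: "z \<in> pt_set ?W"
      obtain i x where ix: "z = (i, x)" by fastforce
      show "?\<kappa> z \<in> insert ?B (collapse_map ?B ` topspace (sum_topology (\<lambda>i. fst (P i)) I))"
      proof (cases "i = i0")
        case False
        then have "(i, x) \<in> topspace (sum_topology (\<lambda>i. fst (P i)) I)" using z ix by auto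
        then show ?thesis using False ix by simp
      qed (use ix in simp)
    qed
    obtain t where t: "t \<in> topspace T" using T by blast
    then have "(i0, t) \<in> pt_set ?W" by simp
    then have "?\<kappa> (i0, t) \<in> ?\<kappa> ` pt_set ?W" by (rule imageI)
    moreover have "collapse_map ?B (i, x) \<in> ?\<kappa> ` pt_set ?W" if "i \<in> I" "x \<in> topspace (fst (P i))" for i x
    proof -
      have "(i, x) \<in> pt_set ?W" "collapse_map ?B (i, x) = ?\<kappa> (i, x)" using that i0 by auto
      then show ?thesis by (intro image_eqI[of _ _ "(i, x)"])
    qed
    ultimately show "insert ?B (collapse_map ?B ` topspace (sum_topology (\<lambda>i. fst (P i)) I)) \<subseteq> ?\<kappa> ` pt_set ?W"
      by auto
  qed
  have "quotient_map (fst ?W) (fst (wedge I P)) ?\<kappa>"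
    unfolding quotient_map_def fw topspace_collapse
  proof (intro conjI allI impI)
    show "?\<kappa> ` pt_set ?W = insert ?B (collapse_map ?B ` topspace (sum_topology (\<lambda>i. fst (P i)) I))"
      by (rule im)
    fix U assume U: "U \<subseteq> insert ?B (collapse_map ?B ` topspace (sum_topology (\<lambda>i. fst (P i)) I))"
    have "openin (fst ?W) {z \<in> pt_set ?W. ?\<kappa> z \<in> U} \<longleftrightarrow>
        (\<forall>i\<in>insert i0 I. openin (fst (?Q i)) {x. (i, x) \<in> {z \<in> pt_set ?W. ?\<kappa> z \<in> U}})"
      unfolding fst_pair_wedge openin_sum_topology by auto
    also have "\<dots> \<longleftrightarrow> (\<forall>i\<in>I. openin (fst (?Q i)) {x. (i, x) \<in> {z \<in> pt_set ?W. ?\<kappa> z \<in> U}})"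
      unfolding ball_simps sub0 by auto
    also have "\<dots> \<longleftrightarrow> (\<forall>i\<in>I. openin (fst (P i))
        {x. (i, x) \<in> {z \<in> topspace (sum_topology (\<lambda>i. fst (P i)) I). collapse_map ?B z \<in> U}})"
      using i0 by (intro ball_cong refl) (auto simp only: sub if_False fst_conv split: if_splits)
    also have "\<dots> \<longleftrightarrow> openin (sum_topology (\<lambda>i. fst (P i)) I)
        {z \<in> topspace (sum_topology (\<lambda>i. fst (P i)) I). collapse_map ?B z \<in> U}"
      unfolding openin_sum_topology by auto
    finally show "openin (fst ?W) {z \<in> pt_set ?W. ?\<kappa> z \<in> U} \<longleftrightarrow>
        openin (fst (collapse (sum_topology (\<lambda>i. fst (P i)) I) ?B)) U"
      using U by (simp add: openin_collapse)
  qed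
  moreover have "proper_pair ?W"
    by (rule proper_pair_wedge) (use P T in \<open>auto simp: proper_pair_def\<close>)
  moreover have "\<forall>z\<in>pt_set ?W. ?\<kappa> z = ?B \<longleftrightarrow> z \<in> snd ?W"
    using i0 by auto
  moreover have "\<forall>z\<in>pt_set ?W. \<forall>z'\<in>pt_set ?W. ?\<kappa> z = ?\<kappa> z' \<longrightarrow> z = z' \<or> z \<in> snd ?W"
  proof (intro ballI impI)
    fix z z' assume z: "z \<in> pt_set ?W" "z' \<in> pt_set ?W" "?\<kappa> z = ?\<kappa> z'"
    obtain i x j y where ij: "z = (i, x)" "z' = (j, y)" by fastforce
    show "z = z' \<or> z \<in> snd ?W"
    proof (cases "i = i0 \<or> (i, x) \<in> ?B")
      case True
      then show ?thesis using z ij by auto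
    next
      case False
      have e: "collapse_map ?B (i, x) = (if j = i0 then ?B else collapse_map ?B (j, y))"
        using z(3) ij False by simp
      show ?thesis
      proof (cases "j = i0")
        case True
        with e have "(i, x) \<in> ?B" by (simp only: if_True simp_thms collapse_map_eq_base)
        with False show ?thesis by blast
      next
        case nj: False
        with e have "collapse_map ?B (i, x) = collapse_map ?B (j, y)" by (simp only: if_False)
        with False ij show ?thesis unfolding collapse_map_eq_iff by blast
      qed
    qed
  qed
  ultimately show ?thesis
    unfolding pair_presents_def sw by blast
qed

section \<open>Wedge decompositions for products\<close>

text \<open>The exponents of the spheres that occur in \<open>S\<^sup>1 \<and> X\<^sub>+\<close>; index \<open>0\<close> is \<open>S\<^sup>1\<close> itself.\<close>

definition shift_dim :: "(nat \<Rightarrow> nat) \<Rightarrow> nat \<Rightarrow> nat" where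
  "shift_dim d m = (if m = 0 then 0 else d m)"

text \<open>A change of encoding: a number becomes a function on \<open>{..<1}\<close>, and the
  one-element wedge index gives the type needed when the summands are collected.\<close>

lemma pair_equiv_circle:
  assumes p: "p \<in> topspace X"
  shows "pair_equiv (circle_pair X p) (pair_wedge {0::nat} (\<lambda>_. cube_pair 1))"
proof (rule pair_equiv_iso)
  show "pair_map (circle_pair X p) (pair_wedge {0::nat} (\<lambda>_. cube_pair 1)) (\<lambda>z. (0, \<lambda>i\<in>{..<1}. fst z))"
  proof (rule pair_map_continuous)
    show "continuous_map (fst (circle_pair X p)) (fst (pair_wedge {0::nat} (\<lambda>_. cube_pair 1))) (\<lambda>z. (0, \<lambda>i\<in>{..<1}. fst z))"
      unfolding fst_pair_wedge
      by (rule continuous_map_into_sum)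
        (auto simp: continuous_map_into_cube continuous_map_fst)
  qed (auto simp: cube_boundary_def topspace_cube)
  show "pair_map (pair_wedge {0::nat} (\<lambda>_. cube_pair 1)) (circle_pair X p) (\<lambda>z. (snd z 0, p))"
  proof (rule pair_map_continuous)
    show "continuous_map (fst (pair_wedge {0::nat} (\<lambda>_. cube_pair 1))) (fst (circle_pair X p)) (\<lambda>z. (snd z 0, p))"
      using p by (auto simp: continuous_map_from_sum_topology intro!: continuous_map_Pair cube_coordinate)
  qed (use p in \<open>auto simp: cube_boundary_def\<close>)
  show "collapse_map (snd (pair_wedge {0::nat} (\<lambda>_. cube_pair 1))) (0, \<lambda>i\<in>{..<1}. fst (snd x 0, p)) =
      collapse_map (snd (pair_wedge {0} (\<lambda>_. cube_pair 1))) x"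
    if "x \<in> pt_set (pair_wedge {0::nat} (\<lambda>_. cube_pair 1))" for x
  proof -
    obtain y where y: "x = (0, y)" "y \<in> topspace (cube 1)" using \<open>x \<in> _\<close> by auto
    have "(\<lambda>i\<in>{..<1}. y 0) = restrict y {..<1}" by (intro restrict_ext) simp
    also have "\<dots> = y" using y(2) unfolding topspace_cube by (rule PiE_restrict)
    finally have "(0, \<lambda>i\<in>{..<1}. fst (snd x 0, p)) = x" using y by simp
    then show ?thesis by simp
  qed
  show "proper_pair (circle_pair X p)" using p by (intro proper_plus_pair) simp
  show "proper_pair (pair_wedge {0::nat} (\<lambda>_. cube_pair 1))" by (intro proper_pair_wedge proper_cube_pair) auto
  show "collapse_map (snd (circle_pair X p)) (snd (0 :: nat, \<lambda>i\<in>{..<1::nat}. fst x) 0, p) =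
      collapse_map (snd (circle_pair X p)) x" if "x \<in> pt_set (circle_pair X p)" for x
  proof -
    have "(snd (0 :: nat, \<lambda>i\<in>{..<1::nat}. fst x) 0, p) = x" using that by auto
    then show ?thesis by (simp only:)
  qed
qed

text \<open>The suspension is replaced by its wedge of spheres, presented with the trivial summand
  \<open>?T\<close> at index 0. The circle that was split off then takes over this index.\<close>

lemma pair_equiv_plus_pair:
  fixes X :: "'a topology"
  assumes wp: "well_pointed (X, p)" and p: "p \<in> topspace X"
    and S: "reduced_suspension (X, p) \<simeq>\<^sub>* wedge {1..k} (\<lambda>m. based_sphere (d m + 1))"
  shows "pair_equiv (plus_pair X) (pair_wedge {0..k} (\<lambda>m. cube_pair (shift_dim d m + 1)))"
proof -
  let ?T = "(cube 1, topspace (cube 1))"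
  let ?Q = "\<lambda>m::nat. if m = 0 then ?T else cube_pair (d m + 1)"
  let ?C = "\<lambda>_::nat. cube_pair 1"
  have T: "topspace (cube 1) \<noteq> {}" by (auto simp: topspace_cube PiE_eq_empty_iff)
  have pT: "proper_pair ?T" using T by (simp add: proper_pair_def)
  have b: "snd (based_sphere m) \<in> topspace (fst (based_sphere m))" for m
    using in_topspace_nsphere by (simp add: based_sphere_def)
  have ps: "proper_pair (fst (based_sphere m), {snd (based_sphere m)})" for m
    using b by (simp add: proper_pair_def)
  have 0: "insert 0 {1..k} = {0..k}" by auto
  have "pair_presents (susp_pair X p) (reduced_suspension (X, p)) (collapse_map (snd (susp_pair X p)))"
    using pair_presents_collapse[OF proper_susp_pair[OF p]] by (simp add: reduced_suspension_def)
  note susp = this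
  note wed = pair_presents_wedge[of "{1..k}" "\<lambda>m. based_sphere (d m + 1)" 0 "cube 1", OF b _ T, unfolded 0]
  have 1: "pair_equiv (susp_pair X p)
     (pair_wedge {0..k} (\<lambda>m. if m = 0 then ?T else (fst (based_sphere (d m + 1)), {snd (based_sphere (d m + 1))})))"
    by (rule pair_equiv_of_based_homotopy_equivalent[OF susp wed S]) simp
  have 2: "pair_equiv (pair_wedge {0..k} (\<lambda>m. if m = 0 then ?T else (fst (based_sphere (d m + 1)), {snd (based_sphere (d m + 1))})))
     (pair_wedge {0..k} ?Q)"
  proof (rule pair_equiv_wedge)
    fix m :: nat
    have "pair_equiv ?T ?T" by (rule pair_equiv_iso[OF pair_map_id pair_map_id]) (auto intro: pT[unfolded One_nat_def])
    moreover have "pair_equiv (fst (based_sphere (d m + 1)), {snd (based_sphere (d m + 1))}) (cube_pair (d m + 1))"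
      by (rule pair_equiv_presented[OF pair_presents_self[OF b] pair_presents_sphere]) simp
    ultimately show "pair_equiv (if m = 0 then ?T else (fst (based_sphere (d m + 1)), {snd (based_sphere (d m + 1))})) (?Q m)"
      by simp
  qed (auto intro: pT[unfolded One_nat_def] ps proper_cube_pair)
  have pw: "proper_pair (pair_wedge {0..k} ?Q)"
    by (rule proper_pair_wedge) (auto intro: pT[unfolded One_nat_def] proper_cube_pair)
  have 3: "pair_equiv (susp_pair X p) (pair_wedge {0..k} ?Q)"
    by (rule pair_equiv_trans[OF 1 2 proper_susp_pair[OF p] _ pw])
      (rule proper_pair_wedge, auto intro: pT[unfolded One_nat_def] ps)
  let ?E = "\<lambda>b. if b then pair_wedge {0} ?C else pair_wedge {0..k} ?Q"
  have pE: "proper_pair (?E b)" for b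
    using pw by (cases b) (auto intro!: proper_pair_wedge proper_cube_pair)
  have 4: "pair_equiv (split_pair X p) (pair_wedge UNIV ?E)"
  proof (rule pair_equiv_wedge)
    show "pair_equiv (if b then circle_pair X p else susp_pair X p) (?E b)" for b
      using 3 pair_equiv_circle[OF p] by simp
  qed (use pE p in \<open>auto intro: proper_susp_pair proper_plus_pair\<close>)
  let ?F = "pair_wedge {0..k} (\<lambda>m. cube_pair (shift_dim d m + 1))"
  have pF: "proper_pair ?F" by (rule proper_pair_wedge) (auto intro: proper_cube_pair)
  have z: "(\<lambda>i\<in>{..<1}. 0) \<in> cube_boundary 1" by (rule zero_in_cube_boundary) simp
  have z': "(\<lambda>i\<in>{..<1}. 0) \<in> topspace (cube 1)" using z cube_boundary_subset by blast
  have 5: "pair_equiv (pair_wedge UNIV ?E) ?F"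
  proof (rule pair_equiv_iso)
    \<comment> \<open>The trivial summand goes to a vertex of the interval at index 0, hence to the
      base point. This does not disturb the inverse, since that summand is collapsed
      entirely.\<close>
    let ?f = "\<lambda>(b, m, x). if b then (0::nat, x) else if m = 0 then (0, \<lambda>i\<in>{..<1}. 0) else (m, x)"
    let ?g = "\<lambda>(m, x). if m = 0 then (True, (0::nat, x)) else (False, (m, x))"
    show "pair_map (pair_wedge UNIV ?E) ?F ?f"
    proof (rule pair_map_from_wedge)
      fix b :: bool
      have "pair_map (pair_wedge {0} ?C) ?F (\<lambda>x. ?f (True, x))"
      proof (rule pair_map_from_wedge)
        fix i :: nat assume "i \<in> {0}"
        then show "pair_map (?C i) ?F (\<lambda>x. ?f (True, i, x))"
          using pair_map_into_wedge[of 0 "{0..k}" "\<lambda>m. cube_pair (shift_dim d m + 1)"] by (simp add: shift_dim_def)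
      qed
      moreover have "pair_map (pair_wedge {0..k} ?Q) ?F (\<lambda>x. ?f (False, x))"
      proof (rule pair_map_from_wedge)
        fix i assume i: "i \<in> {0..k}"
        show "pair_map (?Q i) ?F (\<lambda>x. ?f (False, i, x))"
        proof (cases "i = 0")
          case True
          have "continuous_map (cube 1) (fst ?F) (\<lambda>x. (0, \<lambda>i\<in>{..<1}. 0))"
            using z' by (intro continuous_map_constI) (auto simp: shift_dim_def)
          then have "pair_map ?T ?F (\<lambda>x. (0, \<lambda>i\<in>{..<1}. 0))"
            using z by (intro pair_map_continuous) (auto simp: shift_dim_def)
          then show ?thesis using True by simp
        next
          case False
          then show ?thesis
            using pair_map_into_wedge[OF i, of "\<lambda>m. cube_pair (shift_dim d m + 1)"] by (simp add: shift_dim_def)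
        qed
      qed
      ultimately show "pair_map (?E b) ?F (\<lambda>x. ?f (b, x))" by (cases b) simp_all
    qed
    show "pair_map ?F (pair_wedge UNIV ?E) ?g"
    proof (rule pair_map_from_wedge)
      fix m assume m: "m \<in> {0..k}"
      have "pair_map (cube_pair 1) (pair_wedge UNIV ?E) (\<lambda>x. (True, (0, x)))"
        using pair_map_compose[OF pair_map_into_wedge[of "0::nat" "{0}" ?C] pair_map_into_wedge[of True UNIV ?E, unfolded if_True]]
          pE[of True] by (simp add: o_def)
      moreover have "pair_map (?Q m) (pair_wedge UNIV ?E) (\<lambda>x. (False, (m, x)))"
        using pair_map_compose[OF pair_map_into_wedge[OF m, of ?Q] pair_map_into_wedge[of False UNIV ?E, unfolded if_False] pw]
        by (simp add: o_def)
      ultimately show "pair_map (cube_pair (shift_dim d m + 1)) (pair_wedge UNIV ?E) (\<lambda>x. ?g (m, x))"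
        by (cases "m = 0") (auto simp: shift_dim_def)
    qed
    show "proper_pair (pair_wedge UNIV ?E)" by (rule proper_pair_wedge) (use pE in auto)
    show "collapse_map (snd (pair_wedge UNIV ?E)) (?g (?f x)) = collapse_map (snd (pair_wedge UNIV ?E)) x"
      if "x \<in> pt_set (pair_wedge UNIV ?E)" for x
      using that z by (auto simp: collapse_map_eq_iff split: if_splits)
    show "collapse_map (snd ?F) (?f (?g x)) = collapse_map (snd ?F) x" if "x \<in> pt_set ?F" for x
      using that by (auto simp: split: if_splits)
  qed (rule pF)
  have pw': "proper_pair (pair_wedge UNIV ?E)" by (rule proper_pair_wedge) (use pE in auto)
  have pp: "proper_pair (plus_pair X)" using p by (auto intro: proper_plus_pair)
  show ?thesis
    by (rule pair_equiv_trans[OF pair_equiv_plus_split[OF wp p] pair_equiv_trans[OF 4 5 proper_split_pair[OF p] pw' pF]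
      pp proper_split_pair[OF p] pF])
qed

lemma pair_equiv_smash_wedge:
  assumes P: "\<And>i. i \<in> I \<Longrightarrow> proper_pair (P i)" and I: "I \<noteq> {}"
    and R: "snd R \<subseteq> pt_set R" "pt_set R \<noteq> {}"
  shows "pair_equiv (pair_smash R (pair_wedge I P)) (pair_wedge I (\<lambda>i. pair_smash R (P i)))"
proof (rule pair_equiv_iso)
  show "pair_map (pair_smash R (pair_wedge I P)) (pair_wedge I (\<lambda>i. pair_smash R (P i))) (\<lambda>(r, i, x). (i, r, x))"
  proof (rule pair_map_continuous)
    show "continuous_map (fst (pair_smash R (pair_wedge I P))) (fst (pair_wedge I (\<lambda>i. pair_smash R (P i)))) (\<lambda>(r, i, x). (i, r, x))"
      unfolding fst_pair_smash fst_pair_wedge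
    proof (rule continuous_map_from_prod_sum_topology)
      fix i assume "i \<in> I"
      then show "continuous_map (prod_topology (fst R) (fst (P i)))
          (sum_topology (\<lambda>i. prod_topology (fst R) (fst (P i))) I) (\<lambda>(t, x). case (t, i, x) of (r, i, x) \<Rightarrow> (i, r, x))"
        using continuous_map_component_injection[of i I "\<lambda>i. prod_topology (fst R) (fst (P i))"]
        by (simp add: case_prod_unfold)
    qed
  qed auto
  show "pair_map (pair_wedge I (\<lambda>i. pair_smash R (P i))) (pair_smash R (pair_wedge I P)) (\<lambda>(i, r, x). (r, i, x))"
  proof (rule pair_map_continuous)
    show "continuous_map (fst (pair_wedge I (\<lambda>i. pair_smash R (P i)))) (fst (pair_smash R (pair_wedge I P))) (\<lambda>(i, r, x). (r, i, x))"
      by (auto simp: continuous_map_from_sum_topology case_prod_unfold intro!: cmap continuous_map_into_sum)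
  qed (use R in auto)
  show "proper_pair (pair_smash R (pair_wedge I P))"
    by (intro proper_pair_smash proper_pair_wedge P I R)
  show "proper_pair (pair_wedge I (\<lambda>i. pair_smash R (P i)))"
    by (intro proper_pair_smash proper_pair_wedge P I R)
qed auto

text \<open>Used to merge an index of the last factor and a tuple for the earlier factors into one
  longer tuple.\<close>

lemma pair_equiv_nested_wedge:
  assumes bij: "bij_betw (\<lambda>(i, j). \<phi> i j) (Sigma I J) L"
    and P: "\<And>i j. i \<in> I \<Longrightarrow> j \<in> J i \<Longrightarrow> P i j = Q (\<phi> i j)"
    and Q: "\<And>l. l \<in> L \<Longrightarrow> proper_pair (Q l)" and ne: "I \<noteq> {}" "\<And>i. i \<in> I \<Longrightarrow> J i \<noteq> {}"
  shows "pair_equiv (pair_wedge I (\<lambda>i. pair_wedge (J i) (P i))) (pair_wedge L Q)"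
proof -
  define \<iota> where "\<iota> = inv_into (Sigma I J) (\<lambda>(i, j). \<phi> i j)"
  have \<phi>L: "\<phi> i j \<in> L" if "i \<in> I" "j \<in> J i" for i j
    using bij that by (auto simp: bij_betw_def)
  have \<iota>1: "\<iota> (\<phi> i j) = (i, j)" if "i \<in> I" "j \<in> J i" for i j
    using bij_betw_inv_into_left[OF bij, of "(i, j)"] that by (simp add: \<iota>_def)
  have \<iota>2: "\<exists>i j. \<iota> l = (i, j) \<and> i \<in> I \<and> j \<in> J i \<and> \<phi> i j = l" if "l \<in> L" for l
  proof -
    have "\<iota> l \<in> Sigma I J" using bij that by (metis bij_betw_def \<iota>_def inv_into_into)
    moreover have "(\<lambda>(i, j). \<phi> i j) (\<iota> l) = l" using bij_betw_inv_into_right[OF bij that] by (simp add: \<iota>_def)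
    ultimately show ?thesis by (cases "\<iota> l") auto
  qed
  have PP: "proper_pair (P i j)" if "i \<in> I" "j \<in> J i" for i j
    using P Q \<phi>L that by simp
  have Lne: "L \<noteq> {}" using ne \<phi>L by blast
  have pw: "proper_pair (pair_wedge (J i) (P i))" if "i \<in> I" for i
    using that by (intro proper_pair_wedge PP ne)
  show ?thesis
  proof (rule pair_equiv_iso)
    show "pair_map (pair_wedge I (\<lambda>i. pair_wedge (J i) (P i))) (pair_wedge L Q) (\<lambda>(i, j, x). (\<phi> i j, x))"
    proof (rule pair_map_from_wedge, rule pair_map_from_wedge)
      fix i j assume ij: "i \<in> I" "j \<in> J i"
      show "pair_map (P i j) (pair_wedge L Q) (\<lambda>x. case (i, j, x) of (i, j, x) \<Rightarrow> (\<phi> i j, x))"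
        using pair_map_into_wedge[OF \<phi>L[OF ij], of Q] P[OF ij] by simp
    qed
    show "pair_map (pair_wedge L Q) (pair_wedge I (\<lambda>i. pair_wedge (J i) (P i)))
        (\<lambda>(l, x). (fst (\<iota> l), snd (\<iota> l), x))"
    proof (rule pair_map_from_wedge)
      fix l assume l: "l \<in> L"
      obtain i j where ij: "\<iota> l = (i, j)" "i \<in> I" "j \<in> J i" "\<phi> i j = l" using \<iota>2[OF l] by blast
      have "pair_map (P i j) (pair_wedge I (\<lambda>i. pair_wedge (J i) (P i))) ((\<lambda>x. (i, x)) \<circ> (\<lambda>x. (j, x)))"
        by (rule pair_map_compose[OF pair_map_into_wedge[OF ij(3), of "P i"]
          pair_map_into_wedge[OF ij(2), of "\<lambda>i. pair_wedge (J i) (P i)"] pw[OF ij(2)]])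
      then show "pair_map (Q l) (pair_wedge I (\<lambda>i. pair_wedge (J i) (P i)))
        (\<lambda>x. case (l, x) of (l, x) \<Rightarrow> (fst (\<iota> l), snd (\<iota> l), x))"
        using ij P by (simp add: o_def)
    qed
    show "proper_pair (pair_wedge I (\<lambda>i. pair_wedge (J i) (P i)))"
      by (intro proper_pair_wedge[of I] pw ne)
    show "proper_pair (pair_wedge L Q)" by (intro proper_pair_wedge Q Lne)
    show "collapse_map (snd (pair_wedge I (\<lambda>i. pair_wedge (J i) (P i))))
        ((\<lambda>(l, x). (fst (\<iota> l), snd (\<iota> l), x)) ((\<lambda>(i, j, x). (\<phi> i j, x)) z)) =
        collapse_map (snd (pair_wedge I (\<lambda>i. pair_wedge (J i) (P i)))) z"
      if z: "z \<in> pt_set (pair_wedge I (\<lambda>i. pair_wedge (J i) (P i)))" for z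
    proof -
      obtain i j x where "z = (i, j, x)" "i \<in> I" "j \<in> J i" using z by auto
      then show ?thesis by (simp add: \<iota>1)
    qed
    show "collapse_map (snd (pair_wedge L Q))
        ((\<lambda>(i, j, x). (\<phi> i j, x)) ((\<lambda>(l, x). (fst (\<iota> l), snd (\<iota> l), x)) z)) =
        collapse_map (snd (pair_wedge L Q)) z" if z: "z \<in> pt_set (pair_wedge L Q)" for z
    proof -
      obtain l x where l: "z = (l, x)" "l \<in> L" using z by auto
      obtain i j where "\<iota> l = (i, j)" "\<phi> i j = l" using \<iota>2[OF l(2)] by blast
      then show ?thesis by (simp add: l)
    qed
  qed
qed

section \<open>Half-smash products of cubes with a space\<close>

abbreviation cube_times :: "nat \<Rightarrow> 'a topology \<Rightarrow> ((nat \<Rightarrow> real) \<times> 'a) pair" where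
  "cube_times n X \<equiv> pair_smash (cube_pair n) (X, {})"

lemma proper_cube_times: "n \<ge> 1 \<Longrightarrow> topspace X \<noteq> {} \<Longrightarrow> proper_pair (cube_times n X)"
  using cube_boundary_nonempty[of n] cube_boundary_subset[of n] by (auto simp: proper_pair_def)

lemma pair_equiv_homeomorphism:
  assumes f: "continuous_map (fst P) (fst Q) f" and g: "continuous_map (fst Q) (fst P) g"
    and gf: "\<And>x. x \<in> pt_set P \<Longrightarrow> g (f x) = x" and fg: "\<And>y. y \<in> pt_set Q \<Longrightarrow> f (g y) = y"
    and L: "\<And>x. x \<in> pt_set P \<Longrightarrow> f x \<in> snd Q \<longleftrightarrow> x \<in> snd P"
    and P: "proper_pair P" and Q: "proper_pair Q"
  shows "pair_equiv P Q"
proof (rule pair_equiv_iso)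
  show "pair_map P Q f" using f L P by (intro pair_map_continuous) (auto simp: proper_pair_def)
  have "g y \<in> snd P" if "y \<in> snd Q" for y
  proof -
    have "y \<in> pt_set Q" using that Q by (auto simp: proper_pair_def)
    then show ?thesis using L[of "g y"] g fg[of y] that by (auto simp: continuous_map_def)
  qed
  then show "pair_map Q P g" using g by (intro pair_map_continuous) auto
qed (use assms in auto)

lemma cube_boundary_iff:
  "t \<in> topspace (cube n) \<Longrightarrow> t \<in> cube_boundary n \<longleftrightarrow> (\<exists>i<n. t i = 0 \<or> t i = 1)"
  by (simp add: cube_boundary_def)

text \<open>This represents \<open>S^(n-1) \<and> V_+\<close>. For \<open>n = 1\<close> the cube is
  a point with empty boundary, so the collapsed set is empty and the quotient is \<open>V_+\<close>;
  as a smash parameter this is admissible.\<close>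

abbreviation cube_parameter :: "nat \<Rightarrow> 'v topology \<Rightarrow> ('v \<times> (nat \<Rightarrow> real)) pair" where
  "cube_parameter n V \<equiv> pair_smash (V, {}) (cube_pair (n - 1))"

text \<open>The last cube coordinate is grouped with the last factor of the product. A point of the
  cube is on the boundary if its first \<open>n - 1\<close> coordinates are, or if the last one is 0
  or 1; this matches the two parts of the collapsed set of the smash product.\<close>

lemma pair_equiv_cube_plus:
  fixes X :: "nat \<Rightarrow> 'a topology"
  assumes n: "n \<ge> 1" and ne: "\<And>i. i \<in> {1..Suc N} \<Longrightarrow> topspace (X i) \<noteq> {}"
  shows "pair_equiv (cube_times n (product_topology X {1..Suc N}))
    (pair_smash (cube_parameter n (product_topology X {1..N})) (plus_pair (X (Suc N))))"
proof (rule pair_equiv_homeomorphism)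
  let ?f = "\<lambda>z. ((restrict (snd z) {1..N}, restrict (fst z) {..<n - 1}), (fst z (n - 1), snd z (Suc N)))"
  let ?g = "\<lambda>w. (\<lambda>i\<in>{..<n}. if i < n - 1 then snd (fst w) i else fst (snd w),
                 \<lambda>i\<in>{1..Suc N}. if i = Suc N then snd (snd w) else fst (fst w) i)"
  let ?P = "cube_times n (product_topology X {1..Suc N})"
  let ?Q = "pair_smash (cube_parameter n (product_topology X {1..N})) (plus_pair (X (Suc N)))"
  have c1: "continuous_map (fst ?P) unit_interval (\<lambda>z. fst z i)" if "i < n" for i
    using continuous_map_compose[OF continuous_map_fst cube_coordinate[OF that]] by (simp add: o_def)
  have c2: "continuous_map (fst ?P) (X i) (\<lambda>z. snd z i)" if "i \<in> {1..Suc N}" for i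
    using continuous_map_compose[OF continuous_map_snd continuous_map_product_projection[OF that]] by (simp add: o_def)
  show "continuous_map (fst ?P) (fst ?Q) ?f"
    unfolding fst_pair_smash fst_plus_pair fst_conv fst_cube_pair
  proof (intro continuous_map_Pair)
    show "continuous_map (prod_topology (cube n) (product_topology X {1..Suc N})) (product_topology X {1..N}) (\<lambda>z. restrict (snd z) {1..N})"
      using c2 by (auto simp: continuous_map_componentwise)
    show "continuous_map (prod_topology (cube n) (product_topology X {1..Suc N})) (cube (n - 1)) (\<lambda>z. restrict (fst z) {..<n - 1})"
      using c1 by (auto simp: continuous_map_into_cube)
  qed (use c1 c2 n in auto)
  have d1: "continuous_map (fst ?Q) unit_interval (\<lambda>w. snd (fst w) i)" if "i < n - 1" for i
    unfolding fst_pair_smash fst_plus_pair fst_conv fst_cube_pair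
    using continuous_map_compose[OF continuous_map_projections(4) cube_coordinate[OF that]] by (simp add: o_def)
  have d2: "continuous_map (fst ?Q) (X i) (\<lambda>w. fst (fst w) i)" if "i \<in> {1..N}" for i
    unfolding fst_pair_smash fst_plus_pair fst_conv fst_cube_pair
    using continuous_map_compose[OF continuous_map_projections(3) continuous_map_product_projection[OF that]] by (simp add: o_def)
  have d3: "continuous_map (fst ?Q) unit_interval (\<lambda>w. fst (snd w))" "continuous_map (fst ?Q) (X (Suc N)) (\<lambda>w. snd (snd w))"
    unfolding fst_pair_smash fst_plus_pair by (intro cmap)+
  show "continuous_map (fst ?Q) (fst ?P) ?g"
    unfolding fst_pair_smash[of "cube_pair n"] fst_conv
  proof (intro continuous_map_Pair)
    show "continuous_map (fst ?Q) (fst (cube_pair n)) (\<lambda>w. \<lambda>i\<in>{..<n}. if i < n - 1 then snd (fst w) i else fst (snd w))"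
      unfolding fst_cube_pair continuous_map_into_cube
    proof (intro conjI allI impI)
      show "continuous_map (fst ?Q) unit_interval (\<lambda>x. (\<lambda>i\<in>{..<n}. if i < n - 1 then snd (fst x) i else fst (snd x)) i)" if "i < n" for i
        using d1[of i] d3(1) that by (cases "i < n - 1") auto
    qed auto
    show "continuous_map (fst ?Q) (product_topology X {1..Suc N}) (\<lambda>w. \<lambda>i\<in>{1..Suc N}. if i = Suc N then snd (snd w) else fst (fst w) i)"
      unfolding continuous_map_componentwise
    proof (intro conjI ballI)
      show "continuous_map (fst ?Q) (X i) (\<lambda>x. (\<lambda>i\<in>{1..Suc N}. if i = Suc N then snd (snd x) else fst (fst x) i) i)" if "i \<in> {1..Suc N}" for i
        using d2[of i] d3(2) that by (cases "i = Suc N") auto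
    qed auto
  qed
  show "?g (?f z) = z" if z: "z \<in> pt_set ?P" for z
  proof -
    obtain t x where tx: "z = (t, x)" "t \<in> {..<n} \<rightarrow>\<^sub>E {0..1}" "x \<in> (\<Pi>\<^sub>E i\<in>{1..Suc N}. topspace (X i))"
      using z by (auto simp: topspace_cube)
    have "(\<lambda>i\<in>{..<n}. if i < n - 1 then restrict t {..<n - 1} i else t (n - 1)) = t"
    proof -
      have "(\<lambda>i\<in>{..<n}. if i < n - 1 then restrict t {..<n - 1} i else t (n - 1)) = restrict t {..<n}"
        using n by (intro restrict_ext) (auto intro!: arg_cong[of _ _ t])
      then show ?thesis using PiE_restrict[OF tx(2)] by simp
    qed
    moreover have "(\<lambda>i\<in>{1..Suc N}. if i = Suc N then x (Suc N) else restrict x {1..N} i) = x"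
      using tx(3) by (intro PiE_ext[OF _ tx(3)]) (auto simp: PiE_iff)
    ultimately show ?thesis unfolding tx(1) fst_conv snd_conv by (simp only:)
  qed
  show "?f (?g w) = w" if w: "w \<in> pt_set ?Q" for w
  proof -
    obtain v s t x where vs: "w = ((v, s), (t, x))" "s \<in> {..<n - 1} \<rightarrow>\<^sub>E {0..1}" "v \<in> (\<Pi>\<^sub>E i\<in>{1..N}. topspace (X i))"
      using w by (auto simp: topspace_cube)
    have "restrict (\<lambda>i\<in>{..<n}. if i < n - 1 then s i else t) {..<n - 1} = s"
      using vs(2) by (intro PiE_ext[OF _ vs(2)]) (auto simp: PiE_iff)
    moreover have "restrict (\<lambda>i\<in>{1..Suc N}. if i = Suc N then x else v i) {1..N} = v"
      using vs(3) by (intro PiE_ext[OF _ vs(3)]) (auto simp: PiE_iff)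
    moreover have "(\<lambda>i\<in>{..<n}. if i < n - 1 then s i else t) (n - 1) = t"
      "(\<lambda>i\<in>{1..Suc N}. if i = Suc N then x else v i) (Suc N) = x" using n by auto
    ultimately show ?thesis unfolding vs(1) fst_conv snd_conv by (simp only:)
  qed
  show "?f z \<in> snd ?Q \<longleftrightarrow> z \<in> snd ?P" if z: "z \<in> pt_set ?P" for z
  proof -
    obtain t x where tx: "z = (t, x)" "t \<in> topspace (cube n)" "x \<in> topspace (product_topology X {1..Suc N})"
      using z by auto
    have r: "restrict t {..<n - 1} \<in> topspace (cube (n - 1))" "restrict x {1..N} \<in> topspace (product_topology X {1..N})"
      using tx by (auto simp: topspace_cube PiE_iff)
    have "(\<exists>i<n. t i = 0 \<or> t i = 1) \<longleftrightarrow> (\<exists>i<n - 1. t i = 0 \<or> t i = 1) \<or> t (n - 1) = 0 \<or> t (n - 1) = 1"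
      using n by (metis (no_types, opaque_lifting) One_nat_def Suc_pred less_Suc_eq not_gr0 not_one_le_zero)
    then have e: "t \<in> cube_boundary n \<longleftrightarrow> restrict t {..<n - 1} \<in> cube_boundary (n - 1) \<or> t (n - 1) = 0 \<or> t (n - 1) = 1"
      using cube_boundary_iff[OF tx(2)] cube_boundary_iff[OF r(1)] by auto
    have m: "x (Suc N) \<in> topspace (X (Suc N))" "0 \<le> t (n - 1)" "t (n - 1) \<le> 1"
      using tx cube_bounds[OF tx(2), of "n - 1"] n by (auto simp: PiE_iff)
    show ?thesis unfolding tx(1) fst_conv snd_conv using e r m tx(2,3) by auto
  qed
  show "proper_pair ?P" using n ne by (intro proper_cube_times) (auto simp: PiE_eq_empty_iff)
  have "topspace (cube (n - 1)) \<noteq> {}" by (auto simp: topspace_cube PiE_eq_empty_iff)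
  then show "proper_pair ?Q"
    using ne cube_boundary_subset[of "n - 1"]
    by (intro proper_pair_smash proper_plus_pair) (auto simp: PiE_eq_empty_iff)
qed

text \<open>Concatenation of coordinates, \<open>(n - 1) + (e + 1) = n + e\<close>: the coordinate
  given to the last factor comes back together with the \<open>e\<close> dimensions of its
  sphere.\<close>

lemma pair_equiv_cube_join:
  assumes n: "n \<ge> 1" and V: "topspace V \<noteq> {}"
  shows "pair_equiv (pair_smash (cube_parameter n V) (cube_pair (e + 1))) (cube_times (n + e) V)"
proof (rule pair_equiv_homeomorphism)
  let ?f = "\<lambda>w. (\<lambda>i\<in>{..<n + e}. if i < n - 1 then snd (fst w) i else snd w (i - (n - 1)), fst (fst w))"
  let ?g = "\<lambda>z. ((snd z, restrict (fst z) {..<n - 1}), (\<lambda>i\<in>{..<e + 1}. fst z (i + (n - 1))))"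
  let ?P = "pair_smash (cube_parameter n V) (cube_pair (e + 1))"
  let ?Q = "cube_times (n + e) V"
  have c1: "continuous_map (fst ?Q) unit_interval (\<lambda>z. fst z i)" if "i < n + e" for i
    using continuous_map_compose[OF continuous_map_fst cube_coordinate[OF that]] by (simp add: o_def)
  show "continuous_map (fst ?Q) (fst ?P) ?g"
    unfolding fst_pair_smash fst_conv fst_cube_pair
  proof (intro continuous_map_Pair continuous_map_snd)
    show "continuous_map (prod_topology (cube (n + e)) V) (cube (n - 1)) (\<lambda>z. restrict (fst z) {..<n - 1})"
      using c1 by (auto simp: continuous_map_into_cube)
    show "continuous_map (prod_topology (cube (n + e)) V) (cube (e + 1)) (\<lambda>z. \<lambda>i\<in>{..<e + 1}. fst z (i + (n - 1)))"
      using c1 n by (auto simp: continuous_map_into_cube)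
  qed
  have d1: "continuous_map (fst ?P) unit_interval (\<lambda>w. snd (fst w) i)" if "i < n - 1" for i
    unfolding fst_pair_smash fst_plus_pair fst_conv fst_cube_pair
    using continuous_map_compose[OF continuous_map_projections(4) cube_coordinate[OF that]] by (simp add: o_def)
  have d2: "continuous_map (fst ?P) unit_interval (\<lambda>w. snd w i)" if "i < e + 1" for i
    unfolding fst_pair_smash fst_plus_pair fst_conv fst_cube_pair
    using continuous_map_compose[OF continuous_map_snd cube_coordinate[OF that]] by (simp add: o_def)
  show "continuous_map (fst ?P) (fst ?Q) ?f"
    unfolding fst_pair_smash[of "cube_pair (n + e)"] fst_conv
  proof (intro continuous_map_Pair)
    show "continuous_map (fst ?P) (fst (cube_pair (n + e))) (\<lambda>w. \<lambda>i\<in>{..<n + e}. if i < n - 1 then snd (fst w) i else snd w (i - (n - 1)))"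
      unfolding fst_cube_pair continuous_map_into_cube
    proof (intro conjI allI impI)
      show "continuous_map (fst ?P) unit_interval (\<lambda>x. (\<lambda>i\<in>{..<n + e}. if i < n - 1 then snd (fst x) i else snd x (i - (n - 1))) i)" if "i < n + e" for i
        using d1[of i] d2[of "i - (n - 1)"] that by (cases "i < n - 1") auto
    qed auto
    show "continuous_map (fst ?P) V (\<lambda>w. fst (fst w))"
      unfolding fst_pair_smash fst_conv by (intro cmap)
  qed
  show "?f (?g z) = z" if z: "z \<in> pt_set ?Q" for z
  proof -
    obtain t x where tx: "z = (t, x)" "t \<in> {..<n + e} \<rightarrow>\<^sub>E {0..1}"
      using z by (auto simp: topspace_cube)
    have "(\<lambda>i\<in>{..<n + e}. if i < n - 1 then restrict t {..<n - 1} i else (\<lambda>i\<in>{..<e + 1}. t (i + (n - 1))) (i - (n - 1))) = t"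
      using tx(2) n by (intro PiE_ext[OF _ tx(2)]) (auto simp: not_less PiE_iff)
    then show ?thesis unfolding tx(1) fst_conv snd_conv by (simp only:)
  qed
  show "?g (?f w) = w" if w: "w \<in> pt_set ?P" for w
  proof -
    obtain v s u where vs: "w = ((v, s), u)" "s \<in> {..<n - 1} \<rightarrow>\<^sub>E {0..1}" "u \<in> {..<e + 1} \<rightarrow>\<^sub>E {0..1}"
      using w by (auto simp: topspace_cube)
    let ?j = "\<lambda>i\<in>{..<n + e}. if i < n - 1 then s i else u (i - (n - 1))"
    have "restrict ?j {..<n - 1} = s"
      using vs(2) by (intro PiE_ext[OF _ vs(2)]) (auto simp: PiE_iff)
    moreover have "(\<lambda>i\<in>{..<e + 1}. ?j (i + (n - 1))) = u"
      using vs(3) n by (intro PiE_ext[OF _ vs(3)]) (auto simp: PiE_iff)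
    ultimately show ?thesis unfolding vs(1) fst_conv snd_conv by (simp only:)
  qed
  show "?f w \<in> snd ?Q \<longleftrightarrow> w \<in> snd ?P" if w: "w \<in> pt_set ?P" for w
  proof -
    obtain v s u where vs: "w = ((v, s), u)" "v \<in> topspace V" "s \<in> topspace (cube (n - 1))" "u \<in> topspace (cube (e + 1))"
      using w by auto
    let ?j = "\<lambda>i\<in>{..<n + e}. if i < n - 1 then s i else u (i - (n - 1))"
    have j: "?j \<in> topspace (cube (n + e))"
      using vs by (auto simp: topspace_cube PiE_iff)
    have "?j \<in> cube_boundary (n + e) \<longleftrightarrow> s \<in> cube_boundary (n - 1) \<or> u \<in> cube_boundary (e + 1)"
      unfolding cube_boundary_iff[OF j] cube_boundary_iff[OF vs(3)] cube_boundary_iff[OF vs(4)]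
    proof
      assume "\<exists>i<n + e. ?j i = 0 \<or> ?j i = 1"
      then obtain i where i: "i < n + e" "?j i = 0 \<or> ?j i = 1" by blast
      show "(\<exists>i<n - 1. s i = 0 \<or> s i = 1) \<or> (\<exists>i<e + 1. u i = 0 \<or> u i = 1)"
      proof (cases "i < n - 1")
        case False
        then have "i - (n - 1) < e + 1" using i n by auto
        then show ?thesis using i False by auto
      qed (use i in auto)
    next
      assume "(\<exists>i<n - 1. s i = 0 \<or> s i = 1) \<or> (\<exists>i<e + 1. u i = 0 \<or> u i = 1)"
      then show "\<exists>i<n + e. ?j i = 0 \<or> ?j i = 1"
      proof
        assume "\<exists>i<n - 1. s i = 0 \<or> s i = 1"
        then obtain i where "i < n - 1" "s i = 0 \<or> s i = 1" by blast
        then show ?thesis by (intro exI[of _ i]) auto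
      next
        assume "\<exists>i<e + 1. u i = 0 \<or> u i = 1"
        then obtain i where "i < e + 1" "u i = 0 \<or> u i = 1" by blast
        then show ?thesis using n by (intro exI[of _ "i + (n - 1)"]) auto
      qed
    qed
    then show ?thesis unfolding vs(1) fst_conv snd_conv using vs(2-4) j by auto
  qed
  show "proper_pair ?Q" using n V by (intro proper_cube_times) auto
  have "topspace (cube (n - 1)) \<noteq> {}" by (auto simp: topspace_cube PiE_eq_empty_iff)
  then show "proper_pair ?P"
    using V cube_boundary_subset[of "n - 1"]
    by (intro proper_pair_smash proper_cube_pair) auto
qed

section \<open>Recursion for the index tuples\<close>

definition all_tuples :: "nat \<Rightarrow> (nat \<Rightarrow> nat) \<Rightarrow> (nat \<times> nat) list set" where
  "all_tuples N k = {ts. sorted_wrt (<) (map fst ts) \<and> (\<forall>(i, m)\<in>set ts. i \<in> {1..N} \<and> m \<in> {1..k i})}"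

text \<open>The empty tuple accounts for the sphere \<open>S^n\<close> itself and, in the end, for
  the summand \<open>G_n(Y)\<close>.\<close>

lemma all_tuples_0: "all_tuples 0 k = {[]}"
proof -
  have "ts = []" if "ts \<in> all_tuples 0 k" for ts
    using that by (cases ts) (auto simp: all_tuples_def)
  moreover have "[] \<in> all_tuples 0 k" by (simp add: all_tuples_def)
  ultimately show ?thesis by blast
qed

definition extend_tuple :: "nat \<Rightarrow> nat \<Rightarrow> (nat \<times> nat) list \<Rightarrow> (nat \<times> nat) list" where
  "extend_tuple N m ts = (if m = 0 then ts else ts @ [(Suc N, m)])"

text \<open>Since the first components increase strictly, \<open>Suc N\<close> can occur only in the
  last entry, and there at most once.\<close>

lemma all_tuples_Suc_bij:
  "bij_betw (\<lambda>(m, ts). extend_tuple N m ts) (Sigma {0..k (Suc N)} (\<lambda>_. all_tuples N k)) (all_tuples (Suc N) k)"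
  unfolding bij_betw_def
proof
  have nin: "(Suc N, m) \<notin> set ts" if "ts \<in> all_tuples N k" for m ts
    using that by (auto simp: all_tuples_def)
  have ne: "ts \<noteq> ts' @ [(Suc N, m)]" if "ts \<in> all_tuples N k" for m ts ts'
    using nin[OF that, of m] by auto
  show "inj_on (\<lambda>(m, ts). extend_tuple N m ts) (Sigma {0..k (Suc N)} (\<lambda>_. all_tuples N k))"
    by (rule inj_onI) (auto simp: extend_tuple_def dest: ne ne[THEN not_sym] split: if_splits)
  show "(\<lambda>(m, ts). extend_tuple N m ts) ` Sigma {0..k (Suc N)} (\<lambda>_. all_tuples N k) = all_tuples (Suc N) k"
  proof
    show "(\<lambda>(m, ts). extend_tuple N m ts) ` Sigma {0..k (Suc N)} (\<lambda>_. all_tuples N k) \<subseteq> all_tuples (Suc N) k"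
      by (fastforce simp: extend_tuple_def all_tuples_def sorted_wrt_append)
    show "all_tuples (Suc N) k \<subseteq> (\<lambda>(m, ts). extend_tuple N m ts) ` Sigma {0..k (Suc N)} (\<lambda>_. all_tuples N k)"
    proof
      fix us assume us: "us \<in> all_tuples (Suc N) k"
      show "us \<in> (\<lambda>(m, ts). extend_tuple N m ts) ` Sigma {0..k (Suc N)} (\<lambda>_. all_tuples N k)"
      proof (cases "\<exists>m. (Suc N, m) \<in> set us")
        case False
        have "i \<le> N" if "(i, m) \<in> set us" for i m
        proof -
          have "i \<le> Suc N" using us that by (auto simp: all_tuples_def)
          moreover have "i \<noteq> Suc N" using False that by auto
          ultimately show ?thesis by simp
        qed
        then have "us \<in> all_tuples N k" using us by (fastforce simp: all_tuples_def)
        then show ?thesis by (intro image_eqI[of _ _ "(0, us)"]) (auto simp: extend_tuple_def)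
      next
        case True
        then have ne: "us \<noteq> []" by auto
        then obtain ts i m where ts: "us = ts @ [(i, m)]" by (metis append_butlast_last_id surj_pair)
        have ord: "j < i" if "(j, l) \<in> set ts" for j l
          using us that by (force simp: all_tuples_def ts sorted_wrt_append)
        have i: "i \<le> Suc N" "1 \<le> m" "m \<le> k i" using us by (auto simp: all_tuples_def ts)
        have "i = Suc N" using True ord i by (auto simp: ts) fastforce
        moreover have "ts \<in> all_tuples N k"
          using us ord i by (fastforce simp: all_tuples_def ts sorted_wrt_append)
        ultimately show ?thesis using i
          by (intro image_eqI[of _ _ "(m, ts)"]) (auto simp: extend_tuple_def ts)
      qed
    qed
  qed
qed

definition tuple_dim :: "(nat \<Rightarrow> nat \<Rightarrow> nat) \<Rightarrow> (nat \<times> nat) list \<Rightarrow> nat" where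
  "tuple_dim d ts = (\<Sum>(i, m)\<leftarrow>ts. d i m)"

lemma tuple_dim_extend: "tuple_dim d (extend_tuple N m ts) = shift_dim (d (Suc N)) m + tuple_dim d ts"
  by (simp add: tuple_dim_def extend_tuple_def shift_dim_def)

text \<open>\<open>n\<close> is generalised in the induction because each sphere of the last factor
  leaves the remaining product with a cube of larger dimension.\<close>

theorem pair_equiv_cube_product:
  fixes X :: "nat \<Rightarrow> 'a based_space"
  assumes "\<And>i. i \<in> {1..N} \<Longrightarrow> admissible_space (X i)"
    and "\<And>i. i \<in> {1..N} \<Longrightarrow>
           reduced_suspension (X i) \<simeq>\<^sub>* wedge {1..k i} (\<lambda>m. based_sphere (d i m + 1))"
    and "n \<ge> 1"
  shows "pair_equiv (cube_times n (product_topology (\<lambda>i. fst (X i)) {1..N}))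
    (pair_wedge (all_tuples N k) (\<lambda>ts. cube_pair (n + tuple_dim d ts)))"
  using assms
proof (induction N arbitrary: n)
  case 0
  show ?case
  proof (rule pair_equiv_homeomorphism)
    let ?P = "cube_times n (product_topology (\<lambda>i. fst (X i)) {1..0})"
    let ?Q = "pair_wedge (all_tuples 0 k) (\<lambda>ts. cube_pair (n + tuple_dim d ts))"
    have d0: "tuple_dim d [] = 0" by (simp add: tuple_dim_def)
    show "continuous_map (fst ?P) (fst ?Q) (\<lambda>z. ([], fst z))"
      by (auto simp: all_tuples_0 d0 intro!: continuous_map_into_sum continuous_map_fst)
    \<comment> \<open>The empty product has exactly one point,
      \<open>\<lambda>_. undefined\<close>.\<close>
    show "continuous_map (fst ?Q) (fst ?P) (\<lambda>z. (snd z, \<lambda>_. undefined))"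
      by (auto simp: all_tuples_0 d0 continuous_map_from_sum_topology intro!: cmap)
    show "proper_pair ?P" using 0 by (intro proper_cube_times) auto
    show "proper_pair ?Q" using 0 by (intro proper_pair_wedge proper_cube_pair) (auto simp: all_tuples_0)
  qed (auto simp: all_tuples_0 tuple_dim_def)
next
  case (Suc N)
  let ?V = "product_topology (\<lambda>i. fst (X i)) {1..N}"
  let ?W = "fst (X (Suc N))" and ?p = "snd (X (Suc N))"
  let ?d = "shift_dim (d (Suc N))"
  let ?R = "cube_parameter n ?V"
  let ?K = "{0..k (Suc N)}"
  have ad: "admissible_space (X i)" if "i \<in> {1..Suc N}" for i using Suc.prems(1) that by blast
  have ne: "topspace (fst (X i)) \<noteq> {}" if "i \<in> {1..Suc N}" for i
    using ad[OF that] by (auto simp: admissible_space_def)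
  have V: "topspace ?V \<noteq> {}" using ne by (auto simp: PiE_eq_empty_iff)
  \<comment> \<open>The product of the remaining factors becomes a smash parameter, so it has to be
    locally compact and Hausdorff.\<close>
  have Vlc: "locally_compact_space ?V" "Hausdorff_space ?V"
    using ad by (auto simp: locally_compact_space_product_topology Hausdorff_space_product_topology admissible_space_def)
  have T: "topspace (cube (n - 1)) \<noteq> {}" by (auto simp: topspace_cube PiE_eq_empty_iff)
  have R: "locally_compact_space (fst ?R)" "Hausdorff_space (fst ?R)" "snd ?R \<subseteq> pt_set ?R" "pt_set ?R \<noteq> {}"
    using Vlc V T cube_boundary_subset[of "n - 1"]
    by (auto simp: locally_compact_space_prod_topology Hausdorff_space_prod_topology)
  have wp: "well_pointed (?W, ?p)" and p: "?p \<in> topspace ?W"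
    using ad[of "Suc N"] by (auto simp: admissible_space_def)
  let ?S = "pair_wedge ?K (\<lambda>m. cube_pair (?d m + 1))"
  have S: "pair_equiv (plus_pair ?W) ?S"
    by (rule pair_equiv_plus_pair[OF wp p]) (use Suc.prems(2)[of "Suc N"] in simp)
  have pS: "proper_pair ?S" by (intro proper_pair_wedge proper_cube_pair) auto
  have pW: "proper_pair (plus_pair ?W)" using p by (intro proper_plus_pair) auto
  let ?A = "cube_times n (product_topology (\<lambda>i. fst (X i)) {1..Suc N})"
  let ?B = "pair_smash ?R (plus_pair ?W)"
  let ?C = "pair_smash ?R ?S"
  let ?D = "pair_wedge ?K (\<lambda>m. pair_smash ?R (cube_pair (?d m + 1)))"
  let ?E = "pair_wedge ?K (\<lambda>m. cube_times (n + ?d m) ?V)"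
  let ?F = "pair_wedge ?K (\<lambda>m. pair_wedge (all_tuples N k) (\<lambda>ts. cube_pair (n + ?d m + tuple_dim d ts)))"
  let ?G = "pair_wedge (all_tuples (Suc N) k) (\<lambda>ts. cube_pair (n + tuple_dim d ts))"
  have tne: "all_tuples M k \<noteq> {}" for M
    by (auto simp: all_tuples_def intro!: exI[of _ "[]"])
  have nn: "n + a \<ge> 1" for a using Suc.prems(3) by simp
  have pA: "proper_pair ?A" using ne Suc.prems(3) by (intro proper_cube_times) (auto simp: PiE_eq_empty_iff)
  have pB: "proper_pair ?B" by (rule proper_pair_smash[OF pW R(3,4)])
  have pC: "proper_pair ?C" by (rule proper_pair_smash[OF pS R(3,4)])
  have pd: "proper_pair (pair_smash ?R (cube_pair (?d m + 1)))" for m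
    by (rule proper_pair_smash[OF proper_cube_pair R(3,4)]) simp
  have pe: "proper_pair (cube_times (n + ?d m) ?V)" for m
    by (rule proper_cube_times[OF nn V])
  have pf: "proper_pair (pair_wedge (all_tuples N k) (\<lambda>ts. cube_pair (n + ?d m + tuple_dim d ts)))" for m
    by (intro proper_pair_wedge proper_cube_pair tne) (use nn[of "?d m + _"] in \<open>simp add: add.assoc\<close>)
  have pD: "proper_pair ?D" by (rule proper_pair_wedge[OF pd]) auto
  have pE: "proper_pair ?E" by (rule proper_pair_wedge[OF pe]) auto
  have pF: "proper_pair ?F" by (rule proper_pair_wedge[OF pf]) auto
  have pG: "proper_pair ?G" by (intro proper_pair_wedge proper_cube_pair tne nn)
  have "pair_equiv ?A ?B" using pair_equiv_cube_plus[OF Suc.prems(3), of N "\<lambda>i. fst (X i)"] ne by blast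
  moreover have "pair_equiv ?B ?C" by (rule pair_equiv_smash[OF S pS pW R])
  ultimately have AC: "pair_equiv ?A ?C" using pair_equiv_trans pA pB pC by blast
  have "pair_equiv ?C ?D"
    by (rule pair_equiv_smash_wedge[OF _ _ R(3,4)]) (auto intro: proper_cube_pair)
  with AC have AD: "pair_equiv ?A ?D" using pair_equiv_trans pA pC pD by blast
  have "pair_equiv ?D ?E"
    by (rule pair_equiv_wedge[OF pair_equiv_cube_join[OF Suc.prems(3) V] pd pe])
  with AD have AE: "pair_equiv ?A ?E" using pair_equiv_trans pA pD pE by blast
  have "pair_equiv ?E ?F"
  proof (rule pair_equiv_wedge[OF _ pe pf])
    show "pair_equiv (cube_times (n + ?d m) ?V) (pair_wedge (all_tuples N k) (\<lambda>ts. cube_pair (n + ?d m + tuple_dim d ts)))" for m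
      by (rule Suc.IH) (use Suc.prems nn in auto)
  qed
  with AE have AF: "pair_equiv ?A ?F" using pair_equiv_trans pA pE pF by blast
  have "pair_equiv ?F ?G"
    by (rule pair_equiv_nested_wedge[OF all_tuples_Suc_bij])
      (use tne nn in \<open>auto simp: tuple_dim_extend add.assoc intro: proper_cube_pair\<close>)
  with AF show ?case using pair_equiv_trans pA pF pG by blast
qed

section \<open>The compact-open topology\<close>

lemma mapsI: "continuous_map X Z f \<Longrightarrow> (\<lambda>x\<in>topspace X. f x) \<in> maps X Z"
  by (auto simp: maps_def intro: continuous_map_eq)

lemma continuous_map_into_mapping_space:
  "continuous_map T (mapping_space X Z) g \<longleftrightarrow> (\<forall>t\<in>topspace T. g t \<in> maps X Z) \<and>
    (\<forall>K U. compactin X K \<and> openin Z U \<longrightarrow> openin T {t \<in> topspace T. g t ` K \<subseteq> U})"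
proof -
  have un: "\<Union> {{f \<in> maps X Z. f ` K \<subseteq> U} | K U. compactin X K \<and> openin Z U} = maps X Z"
    using topspace_mapping_space[of X Z] by (simp only: mapping_space_def topology_generated_by_topspace)
  have eq: "g -` {f \<in> maps X Z. f ` K \<subseteq> U} \<inter> topspace T = {t \<in> topspace T. g t ` K \<subseteq> U}"
    if "\<forall>t\<in>topspace T. g t \<in> maps X Z" for K U
    using that by auto
  show ?thesis
    unfolding mapping_space_def continuous_on_generated_topo_iff un
  proof safe
    fix K U assume a: "\<forall>U. U \<in> {{f \<in> maps X Z. f ` K \<subseteq> U} | K U. compactin X K \<and> openin Z U} \<longrightarrow> openin T (g -` U \<inter> topspace T)"
      "g ` topspace T \<subseteq> maps X Z" "compactin X K" "openin Z U"
    then have "openin T (g -` {f \<in> maps X Z. f ` K \<subseteq> U} \<inter> topspace T)" by blast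
    moreover have "\<forall>t\<in>topspace T. g t \<in> maps X Z" using a(2) by blast
    ultimately show "openin T {t \<in> topspace T. g t ` K \<subseteq> U}" by (simp only: eq)
  next
    fix K U assume a: "\<forall>t\<in>topspace T. g t \<in> maps X Z"
      "\<forall>K U. compactin X K \<and> openin Z U \<longrightarrow> openin T {t \<in> topspace T. g t ` K \<subseteq> U}" "compactin X K" "openin Z U"
    then show "openin T (g -` {f \<in> maps X Z. f ` K \<subseteq> U} \<inter> topspace T)" by (simp only: eq)
  qed auto
qed

text \<open>By the tube lemma, the \<open>t\<close> for which the compact set \<open>K\<close> is
  mapped into \<open>U\<close> form an open set. The domain \<open>X\<close> is arbitrary, and this
  is used where it is the null component.\<close>

lemma continuous_map_curry:
  assumes F: "continuous_map (prod_topology T X) Z F"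
  shows "continuous_map T (mapping_space X Z) (\<lambda>t. \<lambda>x\<in>topspace X. F (t, x))"
  unfolding continuous_map_into_mapping_space
proof (safe)
  show "(\<lambda>x\<in>topspace X. F (t, x)) \<in> maps X Z" if t: "t \<in> topspace T" for t
  proof (rule mapsI)
    have "continuous_map X (prod_topology T X) (\<lambda>x. (t, x))"
      using t by (intro continuous_map_Pair continuous_map_constI continuous_map_ident)
    from continuous_map_compose[OF this F] show "continuous_map X Z (\<lambda>x. F (t, x))" by (simp add: o_def)
  qed
  fix K U assume K: "compactin X K" and U: "openin Z U"
  have KX: "K \<subseteq> topspace X" using K by (rule compactin_subset_topspace)
  let ?W = "{z \<in> topspace (prod_topology T X). F z \<in> U}"
  have W: "openin (prod_topology T X) ?W" using F U by (rule openin_continuous_map_preimage)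
  show "openin T {t \<in> topspace T. (\<lambda>x\<in>topspace X. F (t, x)) ` K \<subseteq> U}"
  proof (subst openin_subopen, intro ballI)
    fix t assume t: "t \<in> {t \<in> topspace T. (\<lambda>x\<in>topspace X. F (t, x)) ` K \<subseteq> U}"
    then have "{t} \<times> K \<subseteq> ?W" using KX by (auto simp: image_subset_iff subset_iff)
    then obtain A B where "openin T A" "openin X B" "t \<in> A" "K \<subseteq> B" "A \<times> B \<subseteq> ?W"
      using tube_lemma_right[OF W K, of t] t by auto
    then show "\<exists>A. openin T A \<and> t \<in> A \<and> A \<subseteq> {t \<in> topspace T. (\<lambda>x\<in>topspace X. F (t, x)) ` K \<subseteq> U}"
      using KX openin_subset by (intro exI[of _ A]) (fastforce simp: subset_iff)
  qed
qed

text \<open>Near \<open>x\<close>, choose a compact neighbourhood \<open>K\<close> that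
  \<open>g t\<close> maps into \<open>U\<close>. The maps sending \<open>K\<close> into
  \<open>U\<close> form a subbasic open set, which controls all nearby parameters at once.\<close>

lemma continuous_map_uncurry:
  assumes g: "continuous_map T (mapping_space X Z) g"
    and X: "locally_compact_space X" "Hausdorff_space X"
  shows "continuous_map (prod_topology T X) Z (\<lambda>(t, x). g t x)"
proof -
  have gm: "g t \<in> maps X Z" if "t \<in> topspace T" for t
    using g that by (simp add: continuous_map_into_mapping_space)
  have nb: "neighbourhood_base_of (compactin X) X"
    using X locally_compact_space_neighbourhood_base by blast
  show ?thesis
    unfolding continuous_map_def
  proof (intro conjI allI impI)
    show "(\<lambda>(t, x). g t x) \<in> topspace (prod_topology T X) \<rightarrow> topspace Z"
      using gm by (fastforce simp: maps_def continuous_map_def)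
    fix U assume U: "openin Z U"
    show "openin (prod_topology T X) {z \<in> topspace (prod_topology T X). (case z of (t, x) \<Rightarrow> g t x) \<in> U}"
      unfolding openin_prod_topology_alt
    proof (intro allI impI)
      fix t x assume "(t, x) \<in> {z \<in> topspace (prod_topology T X). (case z of (t, x) \<Rightarrow> g t x) \<in> U}"
      then have t: "t \<in> topspace T" and x: "x \<in> topspace X" and gU: "g t x \<in> U" by auto
      have "openin X {x \<in> topspace X. g t x \<in> U}"
        using gm[OF t] U by (auto simp: maps_def intro: openin_continuous_map_preimage)
      then obtain B K where BK: "openin X B" "compactin X K" "x \<in> B" "B \<subseteq> K" "K \<subseteq> {x \<in> topspace X. g t x \<in> U}"
        using nb x gU unfolding neighbourhood_base_of by (metis (no_types, lifting) mem_Collect_eq)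
      let ?A = "{t \<in> topspace T. g t ` K \<subseteq> U}"
      have "openin T ?A" using g BK(2) U by (simp add: continuous_map_into_mapping_space)
      moreover have "t \<in> ?A" using t BK by auto
      moreover have "?A \<times> B \<subseteq> {z \<in> topspace (prod_topology T X). (case z of (t, x) \<Rightarrow> g t x) \<in> U}"
        using BK openin_subset[OF BK(1)] by (auto simp: image_subset_iff subset_iff)
      ultimately show "\<exists>A B. openin T A \<and> openin X B \<and> t \<in> A \<and> x \<in> B \<and>
          A \<times> B \<subseteq> {z \<in> topspace (prod_topology T X). (case z of (t, x) \<Rightarrow> g t x) \<in> U}"
        using BK by blast
    qed
  qed
qed

text \<open>Points are compact, so evaluation at a fixed point is available for the self-maps of the
  null component as well.\<close>

lemma continuous_map_eval_point:
  assumes "x \<in> topspace X"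
  shows "continuous_map (mapping_space X Z) Z (\<lambda>f. f x)"
proof -
  have "openin (mapping_space X Z) {f \<in> topspace (mapping_space X Z). f x \<in> U}" if "openin Z U" for U
  proof -
    have "continuous_map (mapping_space X Z) (mapping_space X Z) (\<lambda>f. f)" by (rule continuous_map_ident)
    then have "openin (mapping_space X Z) {f \<in> topspace (mapping_space X Z). f ` {x} \<subseteq> U}"
      using that assms unfolding continuous_map_into_mapping_space by (metis compactin_sing)
    then show ?thesis by simp
  qed
  then show ?thesis
    using assms unfolding continuous_map_def topspace_mapping_space
    by (auto simp: maps_def continuous_map_def)
qed

text \<open>Pulling a family of maps back to a locally compact \<open>X'\<close> makes the
  uncurrying lemma applicable even if \<open>X\<close> is not locally compact.\<close>

lemma continuous_map_precompose:
  assumes c: "continuous_map X' X c" and g: "continuous_map T (mapping_space X Z) g"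
  shows "continuous_map T (mapping_space X' Z) (\<lambda>t. \<lambda>x\<in>topspace X'. g t (c x))"
  unfolding continuous_map_into_mapping_space
proof (safe)
  have gm: "continuous_map X Z (g t)" if "t \<in> topspace T" for t
    using g that by (simp add: continuous_map_into_mapping_space maps_def)
  show "(\<lambda>x\<in>topspace X'. g t (c x)) \<in> maps X' Z" if "t \<in> topspace T" for t
    using continuous_map_compose[OF c gm[OF that]] by (intro mapsI) (simp add: o_def)
  fix K U assume K: "compactin X' K" and U: "openin Z U"
  have "openin T {t \<in> topspace T. g t ` (c ` K) \<subseteq> U}"
    using g image_compactin[OF K c] U by (simp add: continuous_map_into_mapping_space)
  moreover have "(\<lambda>x\<in>topspace X'. g t (c x)) ` K = g t ` (c ` K)" for t
    using compactin_subset_topspace[OF K] by (auto simp: image_iff subset_iff)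
  ultimately show "openin T {t \<in> topspace T. (\<lambda>x\<in>topspace X'. g t (c x)) ` K \<subseteq> U}" by simp
qed

section \<open>Cubes and loops\<close>

lemma continuous_map_cube_update:
  assumes "n \<ge> 1" "continuous_map Z (cube n) g" "continuous_map Z unit_interval w"
  shows "continuous_map Z (cube n) (\<lambda>z. (g z)(0 := w z))"
  unfolding continuous_map_into_cube
proof (intro conjI allI impI)
  show "(\<lambda>z. (g z)(0 := w z)) ` topspace Z \<subseteq> extensional {..<n}"
    using assms by (auto simp: continuous_map_into_cube extensional_def image_subset_iff)
  show "continuous_map Z unit_interval (\<lambda>z. ((g z)(0 := w z)) i)" if "i < n" for i
    using assms that by (cases "i = 0") (auto simp: continuous_map_into_cube)
qed

text \<open>If another coordinate puts \<open>t\<close> on the boundary, it still does so after the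
  update; the last hypothesis covers the case in which only coordinate 0 does.\<close>

lemma cube_boundary_update:
  assumes "t \<in> cube_boundary n" "n \<ge> 1" "0 \<le> w" "w \<le> 1" "t 0 = 0 \<or> t 0 = 1 \<Longrightarrow> w = 0 \<or> w = 1"
  shows "t(0 := w) \<in> cube_boundary n"
proof -
  obtain i where i: "i < n" "t i = 0 \<or> t i = 1" and t: "t \<in> topspace (cube n)"
    using assms(1) by (auto simp: cube_boundary_def)
  have "t(0 := w) \<in> topspace (cube n)"
    using t assms(2-4) by (auto simp: topspace_cube PiE_iff extensional_def)
  then show ?thesis
    using i assms(5) unfolding cube_boundary_def by (cases "i = 0") (auto intro!: exI[of _ i])
qed

lemma cube_update_in_boundary:
  assumes "t \<in> topspace (cube n)" "n \<ge> 1" "w = 0 \<or> w = 1"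
  shows "t(0 := w) \<in> cube_boundary n"
  using assms unfolding cube_boundary_def
  by (auto simp: topspace_cube PiE_iff extensional_def intro!: exI[of _ 0])

text \<open>Shrinking the cube towards a vertex joins every value of a map on the cube to its value on the
  boundary.\<close>

lemma cube_path_component:
  assumes n: "n \<ge> 1" and g: "continuous_map (cube n) S g" and b: "\<And>t. t \<in> cube_boundary n \<Longrightarrow> g t = a"
    and t: "t \<in> topspace (cube n)"
  shows "path_component_of S a (g t)"
proof -
  let ?p = "\<lambda>s::real. \<lambda>i\<in>{..<n}. s * t i"
  have "continuous_map unit_interval (cube n) ?p"
    unfolding continuous_map_into_cube
  proof (intro conjI allI impI)
    show "continuous_map unit_interval unit_interval (\<lambda>s. ?p s i)" if "i < n" for i
      using that cube_bounds[OF t that]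
      by (auto simp: mult_le_one intro!: continuous_map_unit_intervalI continuous_intros)
  qed auto
  from continuous_map_compose[OF this g] have "pathin S (g \<circ> ?p)" by (simp add: pathin_def)
  moreover have "?p 0 = (\<lambda>i\<in>{..<n}. 0)" by auto
  then have "(g \<circ> ?p) 0 = a" using b zero_in_cube_boundary[OF n] by (simp only: o_apply)
  moreover have "?p 1 = t" using t by (auto simp: topspace_cube restrict_def PiE_iff extensional_def)
  then have "(g \<circ> ?p) 1 = g t" by (simp only: o_apply)
  ultimately show ?thesis unfolding path_component_of_def by blast
qed

section \<open>Homotopy of maps relative to the collapsed set\<close>

definition rel_homotopic :: "'k pair \<Rightarrow> 'b based_space \<Rightarrow> ('k \<Rightarrow> 'b) \<Rightarrow> ('k \<Rightarrow> 'b) \<Rightarrow> bool" where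
  "rel_homotopic P Y = homotopic_with (\<lambda>h. \<forall>l\<in>snd P. h l = snd Y) (fst P) (fst Y)"

definition based_map :: "'k pair \<Rightarrow> 'b based_space \<Rightarrow> ('k \<Rightarrow> 'b) \<Rightarrow> bool" where
  "based_map P Y f \<longleftrightarrow> continuous_map (fst P) (fst Y) f \<and> (\<forall>l\<in>snd P. f l = snd Y)"

lemma rel_homotopic_iff:
  assumes "snd P \<subseteq> pt_set P"
  shows "rel_homotopic P Y f g \<longleftrightarrow> (\<exists>h. continuous_map (prod_topology unit_interval (fst P)) (fst Y) h \<and>
    (\<forall>x\<in>pt_set P. h (0, x) = f x) \<and> (\<forall>x\<in>pt_set P. h (1, x) = g x) \<and>
    (\<forall>t\<in>{0..1}. \<forall>l\<in>snd P. h (t, l) = snd Y))"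
  unfolding rel_homotopic_def
  by (rule homotopic_with) (use assms in \<open>auto simp: subset_iff\<close>)

lemma rel_homotopic_refl: "based_map P Y f \<Longrightarrow> rel_homotopic P Y f f"
  by (simp add: rel_homotopic_def based_map_def)

lemma rel_homotopic_sym: "rel_homotopic P Y f g \<Longrightarrow> rel_homotopic P Y g f"
  unfolding rel_homotopic_def by (rule homotopic_with_symD)

lemma rel_homotopic_trans: "rel_homotopic P Y f g \<Longrightarrow> rel_homotopic P Y g h \<Longrightarrow> rel_homotopic P Y f h"
  unfolding rel_homotopic_def by (rule homotopic_with_trans)

lemma rel_homotopic_based: "rel_homotopic P Y f g \<Longrightarrow> based_map P Y f" "rel_homotopic P Y f g \<Longrightarrow> based_map P Y g"
  unfolding rel_homotopic_def based_map_def
  using homotopic_with_imp_continuous_maps homotopic_with_imp_property by blast+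

lemma rel_homotopic_eq:
  assumes "based_map P Y f" "\<And>x. x \<in> pt_set P \<Longrightarrow> f x = g x" "snd P \<subseteq> pt_set P"
  shows "rel_homotopic P Y f g"
  unfolding rel_homotopic_def
  by (rule homotopic_with_equal) (use assms in \<open>auto simp: based_map_def subset_iff\<close>)

text \<open>\<open>f\<close> is constant on the collapsed set, so composing it with the possibly
  discontinuous homotopy of pairs gives a genuine continuous homotopy, and its ends are the right
  ones even though they were known only up to the collapse.\<close>

lemma rel_homotopic_pair_homotopic:
  assumes h: "pair_homotopic P Q \<theta> \<theta>'" and f: "based_map Q Y f"
    and P: "proper_pair P" and Q: "proper_pair Q"
  shows "rel_homotopic P Y (f \<circ> \<theta>) (f \<circ> \<theta>')"
proof -
  obtain h where h: "pair_map (pair_cyl P) Q h"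
    "\<forall>x\<in>pt_set P. collapse_map (snd Q) (h (0, x)) = collapse_map (snd Q) (\<theta> x) \<and>
         collapse_map (snd Q) (h (1, x)) = collapse_map (snd Q) (\<theta>' x)"
    using h unfolding pair_homotopic_def by auto
  have fc: "f x = f y" if "collapse_map (snd Q) x = collapse_map (snd Q) y" for x y
    using that f by (auto simp: collapse_map_eq_iff based_map_def)
  have "continuous_map (fst (pair_cyl P)) (fst Y) (f \<circ> h)"
    by (rule pair_map_lift0[OF h(1) Q]) (use f in \<open>auto simp: based_map_def\<close>)
  moreover have "(f \<circ> h) (t, l) = snd Y" if "t \<in> {0..1}" "l \<in> snd P" for t l
  proof -
    have "h (t, l) \<in> snd Q" using that by (intro pair_map_base[OF h(1)]) auto
    then show ?thesis using f by (simp add: based_map_def)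
  qed
  moreover have "(f \<circ> h) (0, x) = (f \<circ> \<theta>) x \<and> (f \<circ> h) (1, x) = (f \<circ> \<theta>') x" if "x \<in> pt_set P" for x
    using h(2) fc that unfolding o_apply by blast
  moreover have "snd P \<subseteq> pt_set P" using P by (simp add: proper_pair_def)
  ultimately show ?thesis by (subst rel_homotopic_iff) auto
qed

text \<open>The interval is the locally compact parameter of the lifting lemma.\<close>

lemma rel_homotopic_compose_pair_map:
  assumes h: "rel_homotopic Q Y f g" and \<theta>: "pair_map P Q \<theta>" and P: "proper_pair P" and Q: "proper_pair Q"
  shows "rel_homotopic P Y (f \<circ> \<theta>) (g \<circ> \<theta>)"
proof -
  have PL: "snd P \<subseteq> pt_set P" "snd Q \<subseteq> pt_set Q" using P Q by (auto simp: proper_pair_def)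
  obtain h where h: "continuous_map (prod_topology unit_interval (fst Q)) (fst Y) h"
    "\<forall>x\<in>pt_set Q. h (0, x) = f x" "\<forall>x\<in>pt_set Q. h (1, x) = g x" "\<forall>t\<in>{0..1}. \<forall>l\<in>snd Q. h (t, l) = snd Y"
    using h unfolding rel_homotopic_iff[OF PL(2)] by blast
  have "continuous_map (prod_topology unit_interval (fst P)) (fst Y) (\<lambda>(v, k). h (v, \<theta> k))"
    by (rule pair_map_lift[OF \<theta> Q _ _ h(1)]) (use h(4) in auto)
  then show ?thesis
    unfolding rel_homotopic_iff[OF PL(1)]
    by (rule exI[of _ "\<lambda>(v, k). h (v, \<theta> k)", OF conjI])
      (use h(2-4) pair_map_in[OF \<theta>] pair_map_base[OF \<theta>] in auto)
qed

lemma rel_homotopic_from_wedge: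
  assumes h: "\<And>i. i \<in> I \<Longrightarrow> rel_homotopic (P i) Y (\<lambda>x. f (i, x)) (\<lambda>x. g (i, x))"
    and P: "\<And>i. i \<in> I \<Longrightarrow> proper_pair (P i)"
  shows "rel_homotopic (pair_wedge I P) Y f g"
proof -
  have PL: "snd (P i) \<subseteq> pt_set (P i)" if "i \<in> I" for i using P that by (auto simp: proper_pair_def)
  then have WL: "snd (pair_wedge I P) \<subseteq> pt_set (pair_wedge I P)" by (auto simp: subset_iff)
  have "\<forall>i\<in>I. \<exists>h. continuous_map (prod_topology unit_interval (fst (P i))) (fst Y) h \<and>
    (\<forall>x\<in>pt_set (P i). h (0, x) = f (i, x)) \<and> (\<forall>x\<in>pt_set (P i). h (1, x) = g (i, x)) \<and>
    (\<forall>t\<in>{0..1}. \<forall>l\<in>snd (P i). h (t, l) = snd Y)"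
    using h by (simp add: rel_homotopic_iff[OF PL])
  from bchoice[OF this] obtain H where "\<forall>i\<in>I. continuous_map (prod_topology unit_interval (fst (P i))) (fst Y) (H i) \<and>
    (\<forall>x\<in>pt_set (P i). H i (0, x) = f (i, x)) \<and> (\<forall>x\<in>pt_set (P i). H i (1, x) = g (i, x)) \<and>
    (\<forall>t\<in>{0..1}. \<forall>l\<in>snd (P i). H i (t, l) = snd Y)" ..
  then have H: "\<And>i. i \<in> I \<Longrightarrow> continuous_map (prod_topology unit_interval (fst (P i))) (fst Y) (H i)"
    "\<And>i x. i \<in> I \<Longrightarrow> x\<in>pt_set (P i) \<Longrightarrow> H i (0, x) = f (i, x)"
    "\<And>i x. i \<in> I \<Longrightarrow> x\<in>pt_set (P i) \<Longrightarrow> H i (1, x) = g (i, x)"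
    "\<And>i t l. i \<in> I \<Longrightarrow> t\<in>{0..1} \<Longrightarrow> l\<in>snd (P i) \<Longrightarrow> H i (t, l) = snd Y"
    by blast+
  have "continuous_map (prod_topology unit_interval (fst (pair_wedge I P))) (fst Y) (\<lambda>(t, i, x). H i (t, x))"
    unfolding fst_pair_wedge
    by (rule continuous_map_from_prod_sum_topology) (use H(1) in \<open>auto simp: case_prod_unfold\<close>)
  then show ?thesis
    unfolding rel_homotopic_iff[OF WL]
    by (rule exI[of _ "\<lambda>(t, i, x). H i (t, x)", OF conjI]) (use H in auto)
qed

section \<open>Homotopy groups and Gottlieb groups\<close>

lemma loop_homotopic_eq: "loop_homotopic n P = rel_homotopic (cube_pair n) P"
  by (simp add: loop_homotopic_def rel_homotopic_def)

lemma cube_loops_eq: "f \<in> cube_loops n P \<longleftrightarrow> based_map (cube_pair n) P f"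
  by (simp add: cube_loops_def based_map_def)

lemma loop_class_eq_iff:
  assumes "f \<in> cube_loops n P"
  shows "loop_class n P f = loop_class n P g \<longleftrightarrow> rel_homotopic (cube_pair n) P f g"
proof
  assume "loop_class n P f = loop_class n P g"
  moreover have "f \<in> loop_class n P f"
    using assms by (simp add: loop_class_def loop_homotopic_eq rel_homotopic_refl cube_loops_eq)
  ultimately have "rel_homotopic (cube_pair n) P g f" by (simp add: loop_class_def loop_homotopic_eq)
  then show "rel_homotopic (cube_pair n) P f g" by (rule rel_homotopic_sym)
next
  assume "rel_homotopic (cube_pair n) P f g"
  then show "loop_class n P f = loop_class n P g"
    unfolding loop_class_def loop_homotopic_eq
    using rel_homotopic_sym rel_homotopic_trans by blast
qed

lemma loop_class_self: "f \<in> cube_loops n P \<Longrightarrow> f \<in> loop_class n P f"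
  by (simp add: loop_class_def loop_homotopic_eq rel_homotopic_refl cube_loops_eq)

lemma loop_classD: "g \<in> loop_class n P f \<Longrightarrow> rel_homotopic (cube_pair n) P f g"
  by (simp add: loop_class_def loop_homotopic_eq)

lemma cube_boundary_subset': "snd (cube_pair n) \<subseteq> pt_set (cube_pair n)"
  by (simp add: cube_boundary_subset)

lemma loop_concat_homotopic:
  assumes n: "n \<ge> 1" and f: "rel_homotopic (cube_pair n) P f f'" and g: "rel_homotopic (cube_pair n) P g g'"
  shows "rel_homotopic (cube_pair n) P (loop_concat f g) (loop_concat f' g')"
proof -
  obtain F where F: "continuous_map (prod_topology unit_interval (cube n)) (fst P) F"
    "\<forall>x\<in>topspace (cube n). F (0, x) = f x" "\<forall>x\<in>topspace (cube n). F (1, x) = f' x"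
    "\<forall>t\<in>{0..1}. \<forall>l\<in>cube_boundary n. F (t, l) = snd P"
    using f unfolding rel_homotopic_iff[OF cube_boundary_subset'] fst_cube_pair snd_cube_pair by blast
  obtain G where G: "continuous_map (prod_topology unit_interval (cube n)) (fst P) G"
    "\<forall>x\<in>topspace (cube n). G (0, x) = g x" "\<forall>x\<in>topspace (cube n). G (1, x) = g' x"
    "\<forall>t\<in>{0..1}. \<forall>l\<in>cube_boundary n. G (t, l) = snd P"
    using g unfolding rel_homotopic_iff[OF cube_boundary_subset'] fst_cube_pair snd_cube_pair by blast
  let ?I = "prod_topology unit_interval (cube n)"
  have c0: "continuous_map ?I euclideanreal (\<lambda>z. snd z 0)"
    using continuous_map_compose[OF continuous_map_snd cube_coordinate[of 0 n]] n
    by (auto simp: o_def intro: continuous_map_unit_intervalD)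
  define u where "u z = (snd z)(0 := min 1 (2 * snd z 0))" for z :: "real \<times> (nat \<Rightarrow> real)"
  define v where "v z = (snd z)(0 := max 0 (2 * snd z 0 - 1))" for z :: "real \<times> (nat \<Rightarrow> real)"
  have b0: "0 \<le> snd z 0 \<and> snd z 0 \<le> 1" if "z \<in> topspace ?I" for z
    using that cube_bounds[of "snd z" n 0] n by auto
  have uc: "continuous_map ?I (cube n) u" unfolding u_def
    using b0 by (intro continuous_map_cube_update[OF n] continuous_map_snd continuous_map_unit_intervalI cmap_real c0) force
  have vc: "continuous_map ?I (cube n) v" unfolding v_def
    using b0 by (intro continuous_map_cube_update[OF n] continuous_map_snd continuous_map_unit_intervalI cmap_real c0) force
  have Fc: "continuous_map ?I (fst P) (\<lambda>z. F (fst z, u z))"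
    using continuous_map_compose[OF continuous_map_Pair[OF continuous_map_fst uc] F(1)] by (simp add: o_def)
  have Gc: "continuous_map ?I (fst P) (\<lambda>z. G (fst z, v z))"
    using continuous_map_compose[OF continuous_map_Pair[OF continuous_map_fst vc] G(1)] by (simp add: o_def)
  have ub: "u (s, t) \<in> cube_boundary n" if "t \<in> cube_boundary n" for s t
    unfolding u_def snd_conv using that n b0[of "(0, t)"] cube_boundary_subset[of n]
    by (intro cube_boundary_update) auto
  have vb: "v (s, t) \<in> cube_boundary n" if "t \<in> cube_boundary n" for s t
    unfolding v_def snd_conv using that n b0[of "(0, t)"] cube_boundary_subset[of n]
    by (intro cube_boundary_update) auto
  show ?thesis
    unfolding rel_homotopic_iff[OF cube_boundary_subset'] fst_cube_pair snd_cube_pair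
  proof (intro exI conjI ballI)
    let ?H = "\<lambda>z. if snd z 0 \<le> 1/2 then F (fst z, u z) else G (fst z, v z)"
    show "continuous_map ?I (fst P) ?H"
    proof (rule continuous_map_cases_le)
      show "F (fst z, u z) = G (fst z, v z)" if z: "z \<in> topspace ?I" "snd z 0 = 1/2" for z
      proof -
        have "u z \<in> cube_boundary n" "v z \<in> cube_boundary n"
          unfolding u_def v_def using z n by (auto intro!: cube_update_in_boundary)
        then show ?thesis using z F(4) G(4) by auto
      qed
    qed (auto intro: c0 Fc Gc continuous_map_from_subtopology)
    fix t assume t: "t \<in> topspace (cube n)"
    have uv: "u (s, t) = t(0 := 2 * t 0)" if "t 0 \<le> 1/2" for s using that by (simp add: u_def)
    have vv: "v (s, t) = t(0 := 2 * t 0 - 1)" if "\<not> t 0 \<le> 1/2" for s using that by (simp add: v_def)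
    have ut: "u (s, t) \<in> topspace (cube n)" "v (s, t) \<in> topspace (cube n)" if "s \<in> {0..1}" for s
      using uc vc t that by (auto simp: continuous_map_def)
    show "?H (0, t) = loop_concat f g t"
      using F(2) G(2) ut[of 0] uv[of 0] vv[of 0] by (auto simp: loop_concat_def)
    show "?H (1, t) = loop_concat f' g' t"
      using F(3) G(3) ut[of 1] uv[of 1] vv[of 1] by (auto simp: loop_concat_def)
  next
    fix s :: real and l assume "s \<in> {0..1}" "l \<in> cube_boundary n"
    then show "(if snd (s, l) 0 \<le> 1/2 then F (fst (s, l), u (s, l)) else G (fst (s, l), v (s, l))) = snd P"
      using ub vb F(4) G(4) by auto
  qed
qed

text \<open>The product is defined as a union over all representatives; concatenation respects
  homotopy, so all sets in the union coincide.\<close>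

lemma homotopy_group_mult:
  assumes n: "n \<ge> 1" and f: "f \<in> cube_loops n P" and g: "g \<in> cube_loops n P"
  shows "loop_class n P f \<otimes>\<^bsub>homotopy_group n P\<^esub> loop_class n P g = loop_class n P (loop_concat f g)"
proof -
  have eq: "loop_class n P (loop_concat f' g') = loop_class n P (loop_concat f g)"
    if "f' \<in> loop_class n P f" "g' \<in> loop_class n P g" for f' g'
  proof -
    have "rel_homotopic (cube_pair n) P (loop_concat f g) (loop_concat f' g')"
      using that by (intro loop_concat_homotopic[OF n] loop_classD)
    moreover from rel_homotopic_based(1)[OF this] have "loop_concat f g \<in> cube_loops n P" by (simp add: cube_loops_eq)
    ultimately show ?thesis by (metis loop_class_eq_iff)
  qed
  have "(\<Union>f'\<in>loop_class n P f. \<Union>g'\<in>loop_class n P g. loop_class n P (loop_concat f' g')) =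
      (\<Union>f'\<in>loop_class n P f. \<Union>g'\<in>loop_class n P g. loop_class n P (loop_concat f g))"
    using eq by (intro SUP_cong refl)
  also have "\<dots> = loop_class n P (loop_concat f g)" using loop_class_self[OF f] loop_class_self[OF g] by blast
  finally show ?thesis by (simp add: homotopy_group_def)
qed

section \<open>Affiliated maps\<close>

text \<open>\<open>F\<close> is the adjoint of a map from \<open>P\<close> to the pair of \<open>aut\<^sub>1 Y\<close> and the identity.\<close>

definition affiliated :: "'k pair \<Rightarrow> 'b topology \<Rightarrow> ('b \<times> 'k \<Rightarrow> 'b) \<Rightarrow> bool" where
  "affiliated P Y F \<longleftrightarrow> continuous_map (prod_topology Y (fst P)) Y F \<and>
     (\<forall>y\<in>topspace Y. \<forall>l\<in>snd P. F (y, l) = y)"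

lemma affiliated_based_map:
  assumes "affiliated P (fst Y) F" "snd Y \<in> topspace (fst Y)"
  shows "based_map P Y (\<lambda>k. F (snd Y, k))"
proof -
  have "continuous_map (fst P) (prod_topology (fst Y) (fst P)) (\<lambda>k. (snd Y, k))"
    using assms by (intro continuous_map_Pair continuous_map_constI continuous_map_ident)
  from continuous_map_compose[OF this, of "fst Y" F] show ?thesis
    using assms by (simp add: affiliated_def based_map_def o_def)
qed

lemma affiliated_compose:
  assumes F: "affiliated P Y F" and G: "affiliated P Y G"
  shows "affiliated P Y (\<lambda>(y, k). F (G (y, k), k))"
proof -
  have "continuous_map (prod_topology Y (fst P)) (prod_topology Y (fst P)) (\<lambda>z. (G z, snd z))"
    using G by (intro continuous_map_Pair continuous_map_snd) (simp add: affiliated_def)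
  from continuous_map_compose[OF this, of Y F] show ?thesis
    using F G by (auto simp: affiliated_def o_def case_prod_unfold)
qed

text \<open>For fixed \<open>y\<close> the map \<open>F (y, -)\<close> is constant on the collapsed
  set, with a value that depends on \<open>y\<close>. This is the fibrewise condition of the lifting
  lemma, with \<open>Y\<close> as the locally compact parameter.\<close>

lemma affiliated_pair_map:
  assumes F: "affiliated Q Y F" and \<theta>: "pair_map P Q \<theta>" and Q: "proper_pair Q"
    and Y: "locally_compact_space Y" "Hausdorff_space Y"
  shows "affiliated P Y (\<lambda>(y, k). F (y, \<theta> k))"
  using pair_map_lift[OF \<theta> Q Y, of Y F] F pair_map_base[OF \<theta>]
  by (auto simp: affiliated_def)

section \<open>Gottlieb groups in terms of affiliated maps\<close>

lemma topspace_map_component: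
  "topspace (fst (map_component X Y f)) = path_component_of_set (mapping_space X Y) f"
  using path_component_of_subset_topspace[of "mapping_space X Y" f]
  by (auto simp: map_component_def)

text \<open>No condition on components is needed in the hypotheses: shrinking the cube towards a
  vertex joins every value to the identity.\<close>

lemma loops_into_aut1:
  assumes n: "n \<ge> 1" and \<gamma>: "continuous_map (cube n) (mapping_space Z Z) \<gamma>"
    and b: "\<And>t. t \<in> cube_boundary n \<Longrightarrow> \<gamma> t = (\<lambda>x\<in>topspace Z. x)"
  shows "\<gamma> \<in> cube_loops n (aut1 (Z, z))"
  using cube_path_component[OF n \<gamma> b] \<gamma> b
  by (auto simp: cube_loops_def aut1_def map_component_def continuous_map_in_subtopology)

lemma aut1_loopsD:
  assumes "\<gamma> \<in> cube_loops n (aut1 (Z, z))"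
  shows "continuous_map (cube n) (mapping_space Z Z) \<gamma>"
    "\<And>t. t \<in> cube_boundary n \<Longrightarrow> \<gamma> t = (\<lambda>x\<in>topspace Z. x)"
  using assms by (auto simp: cube_loops_def aut1_def map_component_def continuous_map_in_subtopology)

lemma eval_loop:
  assumes \<gamma>: "\<gamma> \<in> cube_loops n (aut1 (Z, z))" and z: "z \<in> topspace Z"
  shows "(\<lambda>t. \<gamma> t z) \<in> cube_loops n (Z, z)"
  using continuous_map_compose[OF aut1_loopsD(1)[OF \<gamma>] continuous_map_eval_point[OF z]] aut1_loopsD(2)[OF \<gamma>] z
  by (auto simp: cube_loops_def o_def)

text \<open>Evaluation carries homotopic loops to homotopic loops, so the union that defines the
  induced map consists of a single class.\<close>

lemma carrier_gottlieb_group: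
  assumes z: "z \<in> topspace Z"
  shows "carrier (gottlieb_group n (Z, z)) =
    (\<lambda>\<gamma>. loop_class n (Z, z) (\<lambda>t. \<gamma> t z)) ` cube_loops n (aut1 (Z, z))"
proof -
  let ?\<omega> = "\<lambda>\<alpha>::'a \<Rightarrow> 'a. \<alpha> z"
  have \<omega>: "continuous_map (fst (aut1 (Z, z))) Z ?\<omega>"
    using continuous_map_eval_point[OF z, of Z]
    by (auto simp: aut1_def map_component_def intro: continuous_map_from_subtopology)
  have "homotopy_group_map n (Z, z) ?\<omega> (loop_class n (aut1 (Z, z)) \<gamma>) = loop_class n (Z, z) (\<lambda>t. \<gamma> t z)"
    if \<gamma>: "\<gamma> \<in> cube_loops n (aut1 (Z, z))" for \<gamma>
  proof -
    have eq: "loop_class n (Z, z) (?\<omega> \<circ> \<delta>) = loop_class n (Z, z) (\<lambda>t. \<gamma> t z)"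
      if "\<delta> \<in> loop_class n (aut1 (Z, z)) \<gamma>" for \<delta>
    proof -
      have "rel_homotopic (cube_pair n) (aut1 (Z, z)) \<gamma> \<delta>" using that by (rule loop_classD)
      then have "rel_homotopic (cube_pair n) (Z, z) (?\<omega> \<circ> \<gamma>) (?\<omega> \<circ> \<delta>)"
        unfolding rel_homotopic_def
        by (rule homotopic_with_compose_continuous_map_left)
          (use \<omega> z in \<open>auto simp: aut1_def map_component_def\<close>)
      then have "rel_homotopic (cube_pair n) (Z, z) (\<lambda>t. \<gamma> t z) (?\<omega> \<circ> \<delta>)" by (simp add: o_def)
      with loop_class_eq_iff[OF eval_loop[OF \<gamma> z]] show ?thesis by blast
    qed
    have "(\<Union>\<delta>\<in>loop_class n (aut1 (Z, z)) \<gamma>. loop_class n (Z, z) (?\<omega> \<circ> \<delta>)) =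
       (\<Union>\<delta>\<in>loop_class n (aut1 (Z, z)) \<gamma>. loop_class n (Z, z) (\<lambda>t. \<gamma> t z))"
      using eq by (intro SUP_cong refl)
    then show ?thesis using loop_class_self[OF \<gamma>] by (auto simp: homotopy_group_map_def)
  qed
  then show ?thesis
    by (simp add: gottlieb_group_def homotopy_group_def image_image cong: image_cong)
qed

lemma mult_gottlieb_group [simp]: "mult (gottlieb_group n P) = mult (homotopy_group n P)"
  and one_gottlieb_group [simp]: "one (gottlieb_group n P) = one (homotopy_group n P)"
  by (simp_all add: gottlieb_group_def)

text \<open>Concatenation and pointwise composition agree, because the two factors can be moved apart in the
  first coordinate of the cube.\<close>

lemma gottlieb_group_mult:
  assumes n: "n \<ge> 1" and z: "z \<in> topspace Z"
    and \<gamma>: "\<gamma> \<in> cube_loops n (aut1 (Z, z))" and \<beta>: "\<beta> \<in> cube_loops n (Z, z)"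
  shows "loop_class n (Z, z) (\<lambda>t. \<gamma> t z) \<otimes>\<^bsub>homotopy_group n (Z, z)\<^esub> loop_class n (Z, z) \<beta> =
    loop_class n (Z, z) (\<lambda>t. \<gamma> t (\<beta> t))"
proof -
  note \<gamma>c = aut1_loopsD(1)[OF \<gamma>] and \<gamma>b = aut1_loopsD(2)[OF \<gamma>]
  have \<beta>c: "continuous_map (cube n) Z \<beta>" and \<beta>b: "\<And>t. t \<in> cube_boundary n \<Longrightarrow> \<beta> t = z"
    using \<beta> by (auto simp: cube_loops_def)
  have \<beta>in: "\<beta> t \<in> topspace Z" if "t \<in> topspace (cube n)" for t
    using \<beta>c that by (auto simp: continuous_map_def)
  let ?I = "prod_topology unit_interval (cube n)"
  \<comment> \<open>The self-maps of \<open>Z\<close> are first pulled back along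
    \<open>\<beta>\<close> to the compact cube and then uncurried, since \<open>Z\<close> may be the
    null component.\<close>
  have "continuous_map (prod_topology (cube n) (cube n)) Z (\<lambda>(s, t). (\<lambda>t\<in>topspace (cube n). \<gamma> s (\<beta> t)) t)"
    by (rule continuous_map_uncurry[OF continuous_map_precompose[OF \<beta>c \<gamma>c]]) simp_all
  then have E: "continuous_map (prod_topology (cube n) (cube n)) Z (\<lambda>z. \<gamma> (fst z) (\<beta> (snd z)))"
    by (rule continuous_map_eq) auto
  \<comment> \<open>At time 0 the coordinates \<open>a\<close> and \<open>b\<close> run at double
    speed on the first and the second half and rest otherwise, which is the concatenation. At time 1
    both equal coordinate 0, which is the pointwise composition. The map \<open>E\<close> in two
    cube variables lets them move independently.\<close>
  define a where "a w = (1 - fst w) * min 1 (2 * snd w 0) + fst w * snd w 0" for w :: "real \<times> (nat \<Rightarrow> real)"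
  define b where "b w = (1 - fst w) * max 0 (2 * snd w 0 - 1) + fst w * snd w 0" for w :: "real \<times> (nat \<Rightarrow> real)"
  define u where "u w = (snd w)(0 := a w)" for w
  define v where "v w = (snd w)(0 := b w)" for w
  have b0: "0 \<le> snd w 0 \<and> snd w 0 \<le> 1" if "w \<in> topspace ?I" for w
    using that cube_bounds[of "snd w" n 0] n by auto
  have a01: "0 \<le> a w \<and> a w \<le> 1" and b01: "0 \<le> b w \<and> b w \<le> 1" if "w \<in> topspace ?I" for w
    unfolding a_def b_def using b0[OF that] that by (intro unit_convex; force)+
  have c0: "continuous_map ?I euclideanreal (\<lambda>w. snd w 0)"
    using continuous_map_compose[OF continuous_map_snd cube_coordinate[of 0 n]] n
    by (auto simp: o_def intro: continuous_map_unit_intervalD)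
  have ac: "continuous_map ?I unit_interval a"
  proof (rule continuous_map_unit_intervalI)
    show "continuous_map ?I euclideanreal a" unfolding a_def by (intro cmap_real c0)
  qed (rule a01)
  have bc: "continuous_map ?I unit_interval b"
  proof (rule continuous_map_unit_intervalI)
    show "continuous_map ?I euclideanreal b" unfolding b_def by (intro cmap_real c0)
  qed (rule b01)
  have uc: "continuous_map ?I (cube n) u" and vc: "continuous_map ?I (cube n) v"
    unfolding u_def v_def by (intro continuous_map_cube_update[OF n] continuous_map_snd ac bc)+
  have H: "continuous_map ?I Z (\<lambda>w. \<gamma> (u w) (\<beta> (v w)))"
    using continuous_map_compose[OF continuous_map_Pair[OF uc vc] E] by (simp add: o_def)
  have bd: "u (s, t) \<in> cube_boundary n" "v (s, t) \<in> cube_boundary n"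
    if "t \<in> cube_boundary n" "s \<in> {0..1}" for s t
  proof -
    have st: "(s, t) \<in> topspace ?I" using that cube_boundary_subset[of n] by auto
    show "u (s, t) \<in> cube_boundary n" unfolding u_def snd_conv
      using that a01[OF st] by (intro cube_boundary_update[OF _ n]) (auto simp: a_def)
    show "v (s, t) \<in> cube_boundary n" unfolding v_def snd_conv
      using that b01[OF st] by (intro cube_boundary_update[OF _ n]) (auto simp: b_def)
  qed
  have "rel_homotopic (cube_pair n) (Z, z) (loop_concat (\<lambda>t. \<gamma> t z) \<beta>) (\<lambda>t. \<gamma> t (\<beta> t))"
    unfolding rel_homotopic_iff[OF cube_boundary_subset'] fst_cube_pair snd_cube_pair fst_conv snd_conv
  proof (intro exI conjI ballI)
    show "continuous_map ?I Z (\<lambda>w. \<gamma> (u w) (\<beta> (v w)))" by (rule H)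
    fix t assume t: "t \<in> topspace (cube n)"
    have t0: "0 \<le> t 0" "t 0 \<le> 1" using cube_bounds[OF t] n by auto
    show "\<gamma> (u (0, t)) (\<beta> (v (0, t))) = loop_concat (\<lambda>t. \<gamma> t z) \<beta> t"
    proof (cases "t 0 \<le> 1/2")
      case True
      then have "u (0, t) = t(0 := 2 * t 0)" "v (0, t) = t(0 := 0)" by (auto simp: u_def v_def a_def b_def)
      moreover have "t(0 := 0) \<in> cube_boundary n" by (rule cube_update_in_boundary[OF t n]) simp
      ultimately show ?thesis using True \<beta>b by (simp add: loop_concat_def)
    next
      case False
      then have uv: "u (0, t) = t(0 := 1)" "v (0, t) = t(0 := 2 * t 0 - 1)" by (auto simp: u_def v_def a_def b_def)
      have "t(0 := 1) \<in> cube_boundary n" by (rule cube_update_in_boundary[OF t n]) simp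
      moreover have "v (0, t) \<in> topspace (cube n)" using vc t by (auto simp: continuous_map_def)
      ultimately show ?thesis using False \<gamma>b \<beta>in uv by (simp add: loop_concat_def)
    qed
    show "\<gamma> (u (1, t)) (\<beta> (v (1, t))) = \<gamma> t (\<beta> t)"
      by (simp add: u_def v_def a_def b_def)
  next
    fix s :: real and l assume "s \<in> {0..1}" "l \<in> cube_boundary n"
    then show "\<gamma> (u (s, l)) (\<beta> (v (s, l))) = z"
      using bd[of l s] \<gamma>b \<beta>b z by simp
  qed
  moreover have "loop_class n (Z, z) (\<lambda>t. \<gamma> t z) \<otimes>\<^bsub>homotopy_group n (Z, z)\<^esub> loop_class n (Z, z) \<beta> =
      loop_class n (Z, z) (loop_concat (\<lambda>t. \<gamma> t z) \<beta>)"
    by (rule homotopy_group_mult[OF n eval_loop[OF \<gamma> z] \<beta>])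
  moreover have "loop_concat (\<lambda>t. \<gamma> t z) \<beta> \<in> cube_loops n (Z, z)"
    using rel_homotopic_based(1)[OF calculation(1)] by (simp add: cube_loops_eq)
  ultimately show ?thesis using loop_class_eq_iff by metis
qed

definition loop_of :: "'b based_space \<Rightarrow> ('b \<times> 'k \<Rightarrow> 'b) \<Rightarrow> 'k \<Rightarrow> 'b" where
  "loop_of Y F k = F (snd Y, k)"

lemma based_map_loop_of:
  "affiliated P (fst Y) F \<Longrightarrow> snd Y \<in> topspace (fst Y) \<Longrightarrow> based_map P Y (loop_of Y F)"
  unfolding loop_of_def[abs_def] by (rule affiliated_based_map)

lemma affiliated_aut1:
  assumes F: "affiliated (cube_pair n) Y F" and n: "n \<ge> 1"
  shows "(\<lambda>t. \<lambda>y\<in>topspace Y. F (y, t)) \<in> cube_loops n (aut1 (Y, y0))"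
proof (rule loops_into_aut1[OF n])
  have "continuous_map (prod_topology (cube n) Y) Y (\<lambda>w. F (snd w, fst w))"
    using F continuous_map_compose[OF continuous_map_Pair[OF continuous_map_snd continuous_map_fst], of _ _ Y F]
    by (simp add: affiliated_def o_def)
  from continuous_map_curry[OF this]
  show "continuous_map (cube n) (mapping_space Y Y) (\<lambda>t. \<lambda>y\<in>topspace Y. F (y, t))" by simp
qed (use F in \<open>auto simp: affiliated_def intro!: restrict_ext\<close>)

text \<open>Here the full adjunction is available because \<open>Y\<close> is locally compact; for
  the null component it is replaced by restriction to constant maps.\<close>

lemma aut1_affiliated:
  assumes \<gamma>: "\<gamma> \<in> cube_loops n (aut1 (Y, y0))"
    and Y: "locally_compact_space Y" "Hausdorff_space Y"
  shows "affiliated (cube_pair n) Y (\<lambda>(y, t). \<gamma> t y)"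
proof -
  have "continuous_map (prod_topology (cube n) Y) Y (\<lambda>(t, y). \<gamma> t y)"
    by (rule continuous_map_uncurry[OF aut1_loopsD(1)[OF \<gamma>] Y])
  from continuous_map_compose[OF continuous_map_Pair[OF continuous_map_snd continuous_map_fst] this]
  show ?thesis using aut1_loopsD(2)[OF \<gamma>] by (auto simp: affiliated_def o_def case_prod_unfold)
qed

lemma carrier_gottlieb_affiliated:
  assumes n: "n \<ge> 1" and y0: "snd Y \<in> topspace (fst Y)"
    and Y: "locally_compact_space (fst Y)" "Hausdorff_space (fst Y)"
  shows "carrier (gottlieb_group n Y) = {loop_class n Y (loop_of Y F) | F. affiliated (cube_pair n) (fst Y) F}"
proof -
  obtain T y where Yd: "Y = (T, y)" by fastforce
  have car: "carrier (gottlieb_group n Y) = (\<lambda>\<gamma>. loop_class n Y (\<lambda>t. \<gamma> t y)) ` cube_loops n (aut1 (T, y))"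
    unfolding Yd by (rule carrier_gottlieb_group) (use y0 Yd in simp)
  show ?thesis
    unfolding car
  proof (intro subset_antisym subsetI)
    fix c assume "c \<in> (\<lambda>\<gamma>. loop_class n Y (\<lambda>t. \<gamma> t y)) ` cube_loops n (aut1 (T, y))"
    then obtain \<gamma> where \<gamma>: "c = loop_class n Y (\<lambda>t. \<gamma> t y)" "\<gamma> \<in> cube_loops n (aut1 (T, y))" by blast
    have "c = loop_class n Y (loop_of Y (\<lambda>(y, t). \<gamma> t y))" by (simp add: \<gamma>(1) loop_of_def[abs_def] Yd)
    moreover have "affiliated (cube_pair n) (fst Y) (\<lambda>(y, t). \<gamma> t y)"
      using aut1_affiliated[OF \<gamma>(2)] Y Yd by simp
    ultimately show "c \<in> {loop_class n Y (loop_of Y F) | F. affiliated (cube_pair n) (fst Y) F}" by blast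
  next
    fix c assume "c \<in> {loop_class n Y (loop_of Y F) | F. affiliated (cube_pair n) (fst Y) F}"
    then obtain F where F: "c = loop_class n Y (loop_of Y F)" "affiliated (cube_pair n) T F" by (auto simp: Yd)
    then have "c = loop_class n Y (\<lambda>t. (\<lambda>y\<in>topspace T. F (y, t)) y)"
      using y0 by (simp add: loop_of_def[abs_def] Yd)
    then show "c \<in> (\<lambda>\<gamma>. loop_class n Y (\<lambda>t. \<gamma> t y)) ` cube_loops n (aut1 (T, y))"
      using affiliated_aut1[OF F(2) n, of y] by (intro image_eqI)
  qed
qed

lemma gottlieb_mult_affiliated:
  assumes n: "n \<ge> 1" and y0: "snd Y \<in> topspace (fst Y)"
    and F: "affiliated (cube_pair n) (fst Y) F" and G: "based_map (cube_pair n) Y g"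
  shows "loop_class n Y (loop_of Y F) \<otimes>\<^bsub>homotopy_group n Y\<^esub> loop_class n Y g =
    loop_class n Y (\<lambda>t. F (g t, t))"
proof -
  obtain T y where Yd: "Y = (T, y)" by fastforce
  let ?\<gamma> = "\<lambda>t. \<lambda>y\<in>topspace T. F (y, t)"
  have \<gamma>: "?\<gamma> \<in> cube_loops n (aut1 (T, y))" using affiliated_aut1[of n T F y] F n Yd by simp
  have g: "g \<in> cube_loops n (T, y)" using G Yd by (simp add: cube_loops_eq)
  have y: "y \<in> topspace T" using y0 Yd by simp
  have gin: "g t \<in> topspace T" if "t \<in> topspace (cube n)" for t
    using G that Yd by (auto simp: based_map_def continuous_map_def)
  have "loop_class n Y (loop_of Y F) \<otimes>\<^bsub>homotopy_group n Y\<^esub> loop_class n Y g = loop_class n Y (\<lambda>t. ?\<gamma> t (g t))"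
    using gottlieb_group_mult[OF n y \<gamma> g] y by (simp add: Yd loop_of_def[abs_def])
  also have "\<dots> = loop_class n Y (\<lambda>t. F (g t, t))"
  proof -
    have c: "continuous_map (cube n) T (\<lambda>t. F (g t, t))"
      using continuous_map_compose[OF continuous_map_Pair[OF _ continuous_map_ident], of "cube n" T g T F] F G Yd
      by (simp add: affiliated_def based_map_def o_def)
    have b: "based_map (cube_pair n) Y (\<lambda>t. F (g t, t))"
      using c F G y Yd cube_boundary_subset[of n] by (auto simp: based_map_def affiliated_def)
    have "rel_homotopic (cube_pair n) Y (\<lambda>t. F (g t, t)) (\<lambda>t. ?\<gamma> t (g t))"
      by (rule rel_homotopic_eq[OF b _ cube_boundary_subset']) (use gin in auto)
    then show ?thesis
      by (intro loop_class_eq_iff[THEN iffD2, symmetric]) (use b in \<open>simp add: cube_loops_eq\<close>)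
  qed
  finally show ?thesis .
qed

lemma gottlieb_mult_compose:
  assumes n: "n \<ge> 1" and y0: "snd Y \<in> topspace (fst Y)"
    and F: "affiliated (cube_pair n) (fst Y) F" and G: "affiliated (cube_pair n) (fst Y) G"
  shows "loop_class n Y (loop_of Y F) \<otimes>\<^bsub>homotopy_group n Y\<^esub> loop_class n Y (loop_of Y G) =
    loop_class n Y (loop_of Y (\<lambda>(y, k). F (G (y, k), k)))"
  using gottlieb_mult_affiliated[OF n y0 F based_map_loop_of[OF G y0]]
  by (simp add: loop_of_def[abs_def])

lemma gottlieb_inverse:
  assumes n: "n \<ge> 1" and y0: "snd Y \<in> topspace (fst Y)" and F: "affiliated (cube_pair n) (fst Y) F"
  defines "F' \<equiv> \<lambda>(y, t). F (y, t(0 := 1 - t 0))"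
  shows "affiliated (cube_pair n) (fst Y) F'"
    "loop_class n Y (loop_of Y F') \<otimes>\<^bsub>homotopy_group n Y\<^esub> loop_class n Y (loop_of Y F) = loop_class n Y (\<lambda>_. snd Y)"
proof -
  have c0: "continuous_map (cube n) euclideanreal (\<lambda>t. t 0)"
    using cube_coordinate[of 0 n] n by (auto intro: continuous_map_unit_intervalD)
  have t0: "0 \<le> t 0 \<and> t 0 \<le> 1" if "t \<in> topspace (cube n)" for t using cube_bounds[OF that] n by simp
  have rc: "continuous_map (cube n) (cube n) (\<lambda>t. t(0 := 1 - t 0))"
    using t0 by (intro continuous_map_cube_update[OF n] continuous_map_ident continuous_map_unit_intervalI cmap_real c0) auto
  have rb: "t(0 := 1 - t 0) \<in> cube_boundary n" if "t \<in> cube_boundary n" for t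
    using that t0[of t] cube_boundary_subset[of n] by (intro cube_boundary_update[OF _ n]) auto
  have "continuous_map (prod_topology (fst Y) (cube n)) (prod_topology (fst Y) (cube n)) (\<lambda>w. (fst w, (snd w)(0 := 1 - snd w 0)))"
    using continuous_map_compose[OF continuous_map_snd rc]
    by (intro continuous_map_Pair continuous_map_fst) (simp add: o_def)
  from continuous_map_compose[OF this, of "fst Y" F] show F': "affiliated (cube_pair n) (fst Y) F'"
    using F rb by (auto simp: affiliated_def F'_def o_def case_prod_unfold)
  note fl = based_map_loop_of[OF F y0] and fl' = based_map_loop_of[OF F' y0]
  have mult: "loop_class n Y (loop_of Y F') \<otimes>\<^bsub>homotopy_group n Y\<^esub> loop_class n Y (loop_of Y F) =
      loop_class n Y (loop_concat (loop_of Y F') (loop_of Y F))"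
    using homotopy_group_mult[OF n] fl fl' by (simp add: cube_loops_eq)
  let ?I = "prod_topology unit_interval (cube n)"
  \<comment> \<open>The reversed loop followed by the loop is the loop evaluated at the first
    coordinate \<open>\<bar>2 * t 0 - 1\<bar>\<close>. Pushing that coordinate linearly to 1, which
    is on the boundary, contracts it.\<close>
  define a where "a w = (1 - fst w) * \<bar>2 * snd w 0 - 1\<bar> + fst w * 1" for w :: "real \<times> (nat \<Rightarrow> real)"
  have c0': "continuous_map ?I euclideanreal (\<lambda>w. snd w 0)"
    using continuous_map_compose[OF continuous_map_snd c0] by (simp add: o_def)
  have a01: "0 \<le> a w \<and> a w \<le> 1" if "w \<in> topspace ?I" for w
    unfolding a_def using t0[of "snd w"] that by (intro unit_convex) (auto simp: abs_le_iff)
  have ac: "continuous_map ?I unit_interval a"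
  proof (rule continuous_map_unit_intervalI)
    show "continuous_map ?I euclideanreal a" unfolding a_def by (intro cmap_real continuous_map_real_abs c0')
  qed (rule a01)
  have uc: "continuous_map ?I (cube n) (\<lambda>w. (snd w)(0 := a w))"
    by (intro continuous_map_cube_update[OF n] continuous_map_snd ac)
  have "rel_homotopic (cube_pair n) Y (loop_concat (loop_of Y F') (loop_of Y F)) (\<lambda>_. snd Y)"
    unfolding rel_homotopic_iff[OF cube_boundary_subset'] fst_cube_pair snd_cube_pair
  proof (intro exI conjI ballI)
    show "continuous_map ?I (fst Y) (\<lambda>w. loop_of Y F ((snd w)(0 := a w)))"
      using continuous_map_compose[OF uc, of "fst Y" "loop_of Y F"] fl by (simp add: based_map_def o_def)
    fix t assume t: "t \<in> topspace (cube n)"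
    show "loop_of Y F ((snd (0, t))(0 := a (0, t))) = loop_concat (loop_of Y F') (loop_of Y F) t"
    proof (cases "t 0 \<le> 1/2")
      case True
      then have "a (0, t) = 1 - 2 * t 0" by (simp add: a_def)
      then show ?thesis using True by (simp add: loop_concat_def loop_of_def F'_def)
    next
      case False
      then have "a (0, t) = 2 * t 0 - 1" by (simp add: a_def)
      then show ?thesis using False by (simp add: loop_concat_def loop_of_def)
    qed
    have "t(0 := 1) \<in> cube_boundary n" by (rule cube_update_in_boundary[OF t n]) simp
    then show "loop_of Y F ((snd (1, t))(0 := a (1, t))) = snd Y"
      using fl by (simp add: a_def based_map_def)
  next
    fix s :: real and l assume s: "s \<in> {0..1}" "l \<in> cube_boundary n"
    have "(s, l) \<in> topspace ?I" using s cube_boundary_subset[of n] by auto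
    from a01[OF this] have "l(0 := a (s, l)) \<in> cube_boundary n"
      using s by (intro cube_boundary_update[OF _ n]) (auto simp: a_def)
    then show "loop_of Y F ((snd (s, l))(0 := a (s, l))) = snd Y"
      using fl by (simp add: based_map_def)
  qed
  moreover from rel_homotopic_based(1)[OF this] have "loop_concat (loop_of Y F') (loop_of Y F) \<in> cube_loops n Y"
    by (simp add: cube_loops_eq)
  ultimately show "loop_class n Y (loop_of Y F') \<otimes>\<^bsub>homotopy_group n Y\<^esub> loop_class n Y (loop_of Y F) = loop_class n Y (\<lambda>_. snd Y)"
    unfolding mult by (simp add: loop_class_eq_iff)
qed

text \<open>The projection \<open>fst\<close> represents the neutral element, and the unit and
  associative laws hold strictly for composition of affiliated maps; only inverses require a
  homotopy. The group property is what makes the carriers of the direct sums computable.\<close>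

theorem group_gottlieb_group:
  assumes n: "n \<ge> 1" and y0: "snd Y \<in> topspace (fst Y)"
    and Y: "locally_compact_space (fst Y)" "Hausdorff_space (fst Y)"
  shows "group (gottlieb_group n Y)"
proof (rule groupI)
  note car = carrier_gottlieb_affiliated[OF n y0 Y]
  note mul = gottlieb_mult_compose[OF n y0]
  have one: "\<one>\<^bsub>gottlieb_group n Y\<^esub> = loop_class n Y (loop_of Y fst)"
    by (simp add: homotopy_group_def loop_of_def[abs_def])
  have fst: "affiliated (cube_pair n) (fst Y) fst" by (simp add: affiliated_def continuous_map_fst)
  show "\<one>\<^bsub>gottlieb_group n Y\<^esub> \<in> carrier (gottlieb_group n Y)"
    unfolding one car using fst by blast
  fix x assume "x \<in> carrier (gottlieb_group n Y)"
  then obtain F where F: "x = loop_class n Y (loop_of Y F)" "affiliated (cube_pair n) (fst Y) F"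
    unfolding car by blast
  show "\<one>\<^bsub>gottlieb_group n Y\<^esub> \<otimes>\<^bsub>gottlieb_group n Y\<^esub> x = x"
    unfolding one F(1) mult_gottlieb_group mul[OF fst F(2)] by (simp add: case_prod_unfold)
  show "\<exists>y\<in>carrier (gottlieb_group n Y). y \<otimes>\<^bsub>gottlieb_group n Y\<^esub> x = \<one>\<^bsub>gottlieb_group n Y\<^esub>"
    using gottlieb_inverse[OF n y0 F(2)] unfolding car F(1) by (auto simp: homotopy_group_def)
  fix y assume "y \<in> carrier (gottlieb_group n Y)"
  then obtain G where G: "y = loop_class n Y (loop_of Y G)" "affiliated (cube_pair n) (fst Y) G"
    unfolding car by blast
  show "x \<otimes>\<^bsub>gottlieb_group n Y\<^esub> y \<in> carrier (gottlieb_group n Y)"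
    unfolding F(1) G(1) mult_gottlieb_group mul[OF F(2) G(2)] car
    using affiliated_compose[OF F(2) G(2)] by blast
  fix z assume "z \<in> carrier (gottlieb_group n Y)"
  then obtain H where H: "z = loop_class n Y (loop_of Y H)" "affiliated (cube_pair n) (fst Y) H"
    unfolding car by blast
  show "x \<otimes>\<^bsub>gottlieb_group n Y\<^esub> y \<otimes>\<^bsub>gottlieb_group n Y\<^esub> z = x \<otimes>\<^bsub>gottlieb_group n Y\<^esub> (y \<otimes>\<^bsub>gottlieb_group n Y\<^esub> z)"
    unfolding F(1) G(1) H(1) mult_gottlieb_group mul[OF F(2) G(2)] mul[OF G(2) H(2)]
      mul[OF affiliated_compose[OF F(2) G(2)] H(2)] mul[OF F(2) affiliated_compose[OF G(2) H(2)]]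
    by (simp add: case_prod_unfold)
qed

section \<open>The Gottlieb group of the null component\<close>

definition adjoint_loop :: "'x topology \<Rightarrow> ('k \<times> 'x \<Rightarrow> 'b) \<Rightarrow> 'k \<Rightarrow> 'x \<Rightarrow> 'b" where
  "adjoint_loop X f t = (\<lambda>x\<in>topspace X. f (t, x))"

lemma null_map_component_simps:
  "fst (null_map_component X Y) = subtopology (mapping_space X (fst Y))
     (path_component_of_set (mapping_space X (fst Y)) (\<lambda>x\<in>topspace X. snd Y))"
  "snd (null_map_component X Y) = (\<lambda>x\<in>topspace X. snd Y)"
  by (simp_all add: null_map_component_def map_component_def)

lemma topspace_null_map_component:
  "topspace (fst (null_map_component X Y)) =
     path_component_of_set (mapping_space X (fst Y)) (\<lambda>x\<in>topspace X. snd Y)"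
  by (simp add: null_map_component_def topspace_map_component)

lemma null_map_component_maps: "f \<in> topspace (fst (null_map_component X Y)) \<Longrightarrow> f \<in> maps X (fst Y)"
  unfolding topspace_null_map_component
  using path_component_of_subset_topspace[of "mapping_space X (fst Y)"] by (auto simp: topspace_mapping_space)

lemma null_map_component_incl:
  "continuous_map T (fst (null_map_component X Y)) g \<Longrightarrow> continuous_map T (mapping_space X (fst Y)) g"
  by (simp add: null_map_component_simps continuous_map_in_subtopology)

lemma null_map_component_base:
  assumes "snd Y \<in> topspace (fst Y)"
  shows "snd (null_map_component X Y) \<in> topspace (fst (null_map_component X Y))"
proof -
  have "continuous_map X (fst Y) (\<lambda>_. snd Y)" using assms by (rule continuous_map_constI)
  from mapsI[OF this] show ?thesis
    by (simp add: topspace_null_map_component null_map_component_simps path_component_of_refl topspace_mapping_space)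
qed

lemma adjoint_loop_cube_loops:
  assumes n: "n \<ge> 1" and f: "based_map (cube_times n X) Y f"
  shows "adjoint_loop X f \<in> cube_loops n (null_map_component X Y)"
proof -
  have "continuous_map (prod_topology (cube n) X) (fst Y) f" using f by (simp add: based_map_def)
  then have c: "continuous_map (cube n) (mapping_space X (fst Y)) (adjoint_loop X f)"
    unfolding adjoint_loop_def[abs_def] by (rule continuous_map_curry)
  have b: "adjoint_loop X f t = (\<lambda>x\<in>topspace X. snd Y)" if "t \<in> cube_boundary n" for t
    unfolding adjoint_loop_def by (rule restrict_ext) (use f that in \<open>simp add: based_map_def\<close>)
  show ?thesis
    using c b cube_path_component[OF n c b]
    by (auto simp: cube_loops_def null_map_component_simps continuous_map_in_subtopology)
qed

text \<open>The exponential law for \<open>X\<close>, applied to homotopies. In the direction from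
  \<open>Y\<close> to the mapping space, the homotopy also has to stay in the null
  component.\<close>

lemma rel_homotopic_adjoint:
  assumes n: "n \<ge> 1" and X: "locally_compact_space X" "Hausdorff_space X"
    and f: "based_map (cube_times n X) Y f" and g: "based_map (cube_times n X) Y g"
  shows "rel_homotopic (cube_pair n) (null_map_component X Y) (adjoint_loop X f) (adjoint_loop X g)
    \<longleftrightarrow> rel_homotopic (cube_times n X) Y f g"
proof -
  let ?M = "null_map_component X Y"
  let ?I = "prod_topology unit_interval (cube n)"
  have L: "snd (cube_times n X) \<subseteq> pt_set (cube_times n X)" using cube_boundary_subset[of n] by auto
  show ?thesis
  proof
    assume "rel_homotopic (cube_pair n) ?M (adjoint_loop X f) (adjoint_loop X g)"
    then obtain h where h: "continuous_map ?I (fst ?M) h"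
      "\<forall>t\<in>topspace (cube n). h (0, t) = adjoint_loop X f t" "\<forall>t\<in>topspace (cube n). h (1, t) = adjoint_loop X g t"
      "\<forall>s\<in>{0..1}. \<forall>l\<in>cube_boundary n. h (s, l) = snd ?M"
      unfolding rel_homotopic_iff[OF cube_boundary_subset'] fst_cube_pair snd_cube_pair by blast
    have "continuous_map (prod_topology ?I X) (fst Y) (\<lambda>(t, x). h t x)"
      by (rule continuous_map_uncurry[OF null_map_component_incl[OF h(1)] X])
    moreover have "continuous_map (prod_topology unit_interval (prod_topology (cube n) X)) (prod_topology ?I X)
        (\<lambda>w. ((fst w, fst (snd w)), snd (snd w)))" by (intro cmap)
    ultimately have "continuous_map (prod_topology unit_interval (prod_topology (cube n) X)) (fst Y)
        ((\<lambda>(t, x). h t x) \<circ> (\<lambda>w. ((fst w, fst (snd w)), snd (snd w))))" by (rule continuous_map_compose[rotated])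
    then show "rel_homotopic (cube_times n X) Y f g"
      unfolding rel_homotopic_iff[OF L] fst_pair_smash fst_cube_pair fst_conv
      by (rule exI[of _ "(\<lambda>(t, x). h t x) \<circ> (\<lambda>w. ((fst w, fst (snd w)), snd (snd w)))", OF conjI])
        (use h(2-4) in \<open>auto simp: adjoint_loop_def null_map_component_simps\<close>)
  next
    assume "rel_homotopic (cube_times n X) Y f g"
    then obtain h where h: "continuous_map (prod_topology unit_interval (prod_topology (cube n) X)) (fst Y) h"
      "\<forall>k\<in>topspace (prod_topology (cube n) X). h (0, k) = f k"
      "\<forall>k\<in>topspace (prod_topology (cube n) X). h (1, k) = g k"
      "\<forall>s\<in>{0..1}. \<forall>l\<in>snd (cube_times n X). h (s, l) = snd Y"
      unfolding rel_homotopic_iff[OF L] fst_pair_smash fst_cube_pair fst_conv by blast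
    let ?h = "\<lambda>w. \<lambda>x\<in>topspace X. h (fst w, (snd w, x))"
    have "continuous_map (prod_topology ?I X) (fst Y) (\<lambda>w. h (fst (fst w), (snd (fst w), snd w)))"
    proof -
      have "continuous_map (prod_topology ?I X) (prod_topology unit_interval (prod_topology (cube n) X))
         (\<lambda>w. (fst (fst w), (snd (fst w), snd w)))" by (intro cmap)
      from continuous_map_compose[OF this h(1)] show ?thesis by (simp add: o_def)
    qed
    from continuous_map_curry[OF this] have c: "continuous_map ?I (mapping_space X (fst Y)) ?h" by simp
    have b: "?h (s, l) = (\<lambda>x\<in>topspace X. snd Y)" if "s \<in> {0..1}" "l \<in> cube_boundary n" for s l
      by (rule restrict_ext) (use h(4) that in auto)
    \<comment> \<open>Each stage of the homotopy is a cube whose boundary goes to the null map, so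
      shrinking it gives the required paths.\<close>
    have pc: "path_component_of (mapping_space X (fst Y)) (\<lambda>x\<in>topspace X. snd Y) (?h (s, t))"
      if s: "s \<in> {0..1}" and t: "t \<in> topspace (cube n)" for s t
    proof (rule cube_path_component[OF n _ _ t, of _ "\<lambda>t. ?h (s, t)"])
      have "continuous_map (cube n) ?I (\<lambda>t. (s, t))"
        using s by (intro continuous_map_Pair continuous_map_constI continuous_map_ident) simp
      from continuous_map_compose[OF this c]
      show "continuous_map (cube n) (mapping_space X (fst Y)) (\<lambda>t. ?h (s, t))" by (simp add: o_def)
    qed (rule b[OF s])
    show "rel_homotopic (cube_pair n) ?M (adjoint_loop X f) (adjoint_loop X g)"
      unfolding rel_homotopic_iff[OF cube_boundary_subset'] fst_cube_pair snd_cube_pair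
    proof (intro exI conjI ballI)
      show "continuous_map ?I (fst ?M) ?h"
        using c pc by (auto simp: null_map_component_simps continuous_map_in_subtopology)
      show "?h (0, t) = adjoint_loop X f t" if "t \<in> topspace (cube n)" for t
        unfolding adjoint_loop_def by (rule restrict_ext) (use that h(2) in auto)
      show "?h (1, t) = adjoint_loop X g t" if "t \<in> topspace (cube n)" for t
        unfolding adjoint_loop_def by (rule restrict_ext) (use that h(3) in auto)
      show "?h (s, l) = snd ?M" if "s \<in> {0..1}" "l \<in> cube_boundary n" for s l
        using b[OF that] by (simp add: null_map_component_simps)
    qed
  qed
qed

text \<open>The evaluation of maps in the null component at points of \<open>X\<close> is continuous
  because \<open>X\<close> is locally compact. Currying over \<open>X\<close> and then over the null
  component gives the loop of self-maps; neither currying asks for local compactness of its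
  domain.\<close>

lemma affiliated_aut1_null_component:
  assumes n: "n \<ge> 1" and X: "locally_compact_space X" "Hausdorff_space X"
    and F: "affiliated (cube_times n X) (fst Y) F"
  shows "(\<lambda>t. \<lambda>f\<in>topspace (fst (null_map_component X Y)). \<lambda>x\<in>topspace X. F (f x, (t, x)))
     \<in> cube_loops n (aut1 (fst (null_map_component X Y), m))"
proof (rule loops_into_aut1[OF n])
  let ?M = "fst (null_map_component X Y)"
  have Fc: "continuous_map (prod_topology (fst Y) (prod_topology (cube n) X)) (fst Y) F"
    and Fb: "\<And>y t x. \<lbrakk>y \<in> topspace (fst Y); t \<in> cube_boundary n; x \<in> topspace X\<rbrakk> \<Longrightarrow> F (y, (t, x)) = y"
    using F by (auto simp: affiliated_def)
  have E: "continuous_map (prod_topology ?M X) (fst Y) (\<lambda>(f, x). f x)"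
    by (rule continuous_map_uncurry[OF null_map_component_incl[OF continuous_map_ident] X])
  have "continuous_map (prod_topology (prod_topology (cube n) ?M) X) (fst Y) (\<lambda>w. snd (fst w) (snd w))"
    using continuous_map_compose[OF continuous_map_Pair[OF continuous_map_projections(4) continuous_map_snd] E]
    by (simp add: o_def)
  then have "continuous_map (prod_topology (prod_topology (cube n) ?M) X) (prod_topology (fst Y) (prod_topology (cube n) X))
    (\<lambda>w. (snd (fst w) (snd w), (fst (fst w), snd w)))"
    by (intro continuous_map_Pair continuous_map_snd continuous_map_projections)
  from continuous_map_compose[OF this Fc]
  have "continuous_map (prod_topology (prod_topology (cube n) ?M) X) (fst Y)
    (\<lambda>w. F (snd (fst w) (snd w), (fst (fst w), snd w)))" by (simp add: o_def)
  from continuous_map_curry[OF this]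
  have c: "continuous_map (prod_topology (cube n) ?M) (mapping_space X (fst Y))
    (\<lambda>p. \<lambda>x\<in>topspace X. F (snd p x, (fst p, x)))" by simp
  have bd: "(\<lambda>x\<in>topspace X. F (f x, (t, x))) = f" if f: "f \<in> topspace ?M" and t: "t \<in> cube_boundary n" for f t
  proof -
    have fm: "f \<in> maps X (fst Y)" by (rule null_map_component_maps[OF f])
    then have "(\<lambda>x\<in>topspace X. F (f x, (t, x))) = restrict f (topspace X)"
      by (intro restrict_ext) (use Fb t in \<open>auto simp: maps_def continuous_map_def\<close>)
    also have "\<dots> = f" using fm by (intro extensional_restrict) (simp add: maps_def)
    finally show ?thesis .
  qed
  \<comment> \<open>For fixed \<open>f\<close> the cube of maps has boundary value \<open>f\<close>,
    so all its values lie in the component of \<open>f\<close>.\<close>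
  have "path_component_of (mapping_space X (fst Y)) (\<lambda>x\<in>topspace X. snd Y) (\<lambda>x\<in>topspace X. F (f x, (t, x)))"
    if t: "t \<in> topspace (cube n)" and f: "f \<in> topspace ?M" for t f
  proof (rule path_component_of_trans)
    show "path_component_of (mapping_space X (fst Y)) (\<lambda>x\<in>topspace X. snd Y) f"
      using f by (simp add: topspace_null_map_component)
    have "continuous_map (cube n) (prod_topology (cube n) ?M) (\<lambda>t. (t, f))"
      using f by (intro continuous_map_Pair continuous_map_constI continuous_map_ident)
    from continuous_map_compose[OF this c]
    have "continuous_map (cube n) (mapping_space X (fst Y)) (\<lambda>t. \<lambda>x\<in>topspace X. F (f x, (t, x)))"
      by (simp add: o_def)
    from cube_path_component[OF n this bd[OF f] t]
    show "path_component_of (mapping_space X (fst Y)) f (\<lambda>x\<in>topspace X. F (f x, (t, x)))" .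
  qed
  with c have "continuous_map (prod_topology (cube n) ?M) ?M (\<lambda>p. \<lambda>x\<in>topspace X. F (snd p x, (fst p, x)))"
    unfolding null_map_component_simps continuous_map_in_subtopology
    by (auto simp: null_map_component_simps[symmetric])
  from continuous_map_curry[OF this]
  show "continuous_map (cube n) (mapping_space ?M ?M) (\<lambda>t. \<lambda>f\<in>topspace ?M. \<lambda>x\<in>topspace X. F (f x, (t, x)))"
    by simp
  show "(\<lambda>f\<in>topspace ?M. \<lambda>x\<in>topspace X. F (f x, (t, x))) = (\<lambda>x\<in>topspace ?M. x)"
    if "t \<in> cube_boundary n" for t
    by (rule restrict_ext) (use bd that in simp)
qed

text \<open>The family of constant maps is continuous in its value, and path connectedness of
  \<open>Y\<close> places it in the null component. Along this family, indexed by the locally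
  compact space \<open>Y\<close>, the loop of self-maps can be evaluated jointly.\<close>

lemma aut1_null_component_affiliated:
  assumes X: "locally_compact_space X" "Hausdorff_space X"
    and Y: "locally_compact_space (fst Y)" "Hausdorff_space (fst Y)" "path_connected_space (fst Y)"
    and y0: "snd Y \<in> topspace (fst Y)"
    and \<gamma>: "\<gamma> \<in> cube_loops n (aut1 (fst (null_map_component X Y), m))"
  shows "affiliated (cube_times n X) (fst Y) (\<lambda>(y, (t, x)). \<gamma> t (\<lambda>x\<in>topspace X. y) x)"
proof -
  let ?M = "fst (null_map_component X Y)"
  let ?c = "\<lambda>y. \<lambda>x\<in>topspace X. y"
  have cc: "continuous_map (fst Y) (mapping_space X (fst Y)) ?c"
    using continuous_map_curry[OF continuous_map_fst, of "fst Y" X] by simp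
  have "path_component_of (mapping_space X (fst Y)) (?c (snd Y)) (?c y)" if yT: "y \<in> topspace (fst Y)" for y
  proof -
    obtain g where g: "pathin (fst Y) g" "g 0 = snd Y" "g 1 = y"
      using Y(3) y0 yT unfolding path_connected_space_def by blast
    show ?thesis
      unfolding path_component_of_def
      by (intro exI[of _ "?c \<circ> g"] conjI pathin_compose[OF g(1) cc]) (simp_all add: g)
  qed
  with cc have c: "continuous_map (fst Y) ?M ?c"
    by (auto simp: null_map_component_simps continuous_map_in_subtopology)
  have "continuous_map (prod_topology (cube n) (fst Y)) ?M (\<lambda>(t, y). (\<lambda>y\<in>topspace (fst Y). \<gamma> t (?c y)) y)"
    by (rule continuous_map_uncurry[OF continuous_map_precompose[OF c aut1_loopsD(1)[OF \<gamma>]] Y(1,2)])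
  then have "continuous_map (prod_topology (cube n) (fst Y)) ?M (\<lambda>p. \<gamma> (fst p) (?c (snd p)))"
    by (rule continuous_map_eq) auto
  from continuous_map_uncurry[OF null_map_component_incl[OF this] X]
  have e: "continuous_map (prod_topology (prod_topology (cube n) (fst Y)) X) (fst Y) (\<lambda>w. \<gamma> (fst (fst w)) (?c (snd (fst w))) (snd w))"
    by (simp add: case_prod_unfold)
  have "continuous_map (prod_topology (fst Y) (prod_topology (cube n) X)) (prod_topology (prod_topology (cube n) (fst Y)) X)
      (\<lambda>w. ((fst (snd w), fst w), snd (snd w)))" by (intro cmap)
  from continuous_map_compose[OF this e]
  have "continuous_map (prod_topology (fst Y) (prod_topology (cube n) X)) (fst Y) (\<lambda>(y, (t, x)). \<gamma> t (?c y) x)"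
    by (simp add: o_def case_prod_unfold)
  moreover have "\<gamma> t (?c y) x = y" if "y \<in> topspace (fst Y)" "t \<in> cube_boundary n" "x \<in> topspace X" for y t x
    using aut1_loopsD(2)[OF \<gamma> that(2)] c that by (auto simp: continuous_map_def)
  ultimately show ?thesis by (auto simp: affiliated_def)
qed

text \<open>The passages between self-maps and affiliated maps need not be mutually inverse. Both
  preserve the value at the null map, up to equality on the cube, and that value determines the
  Gottlieb class.\<close>

lemma carrier_gottlieb_null_component:
  assumes n: "n \<ge> 1" and X: "locally_compact_space X" "Hausdorff_space X"
    and Y: "locally_compact_space (fst Y)" "Hausdorff_space (fst Y)" "path_connected_space (fst Y)"
    and y0: "snd Y \<in> topspace (fst Y)"
  defines "M \<equiv> null_map_component X Y"
  shows "carrier (gottlieb_group n M) =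
    {loop_class n M (adjoint_loop X (loop_of Y F)) | F. affiliated (cube_times n X) (fst Y) F}"
proof -
  have m0: "snd M \<in> topspace (fst M)" unfolding M_def by (rule null_map_component_base[OF y0])
  have car: "carrier (gottlieb_group n M) = (\<lambda>\<gamma>. loop_class n M (\<lambda>t. \<gamma> t (snd M))) ` cube_loops n (aut1 (fst M, snd M))"
    using carrier_gottlieb_group[OF m0, of n] by simp
  show ?thesis
    unfolding car
  proof (intro subset_antisym subsetI)
    fix C assume "C \<in> (\<lambda>\<gamma>. loop_class n M (\<lambda>t. \<gamma> t (snd M))) ` cube_loops n (aut1 (fst M, snd M))"
    then obtain \<gamma> where \<gamma>: "C = loop_class n M (\<lambda>t. \<gamma> t (snd M))" "\<gamma> \<in> cube_loops n (aut1 (fst M, snd M))" by blast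
    let ?F = "\<lambda>(y, (t, x)). \<gamma> t (\<lambda>x\<in>topspace X. y) x"
    have F: "affiliated (cube_times n X) (fst Y) ?F"
      by (rule aut1_null_component_affiliated[OF X Y y0 \<gamma>(2)[unfolded M_def]])
    have l: "(\<lambda>t. \<gamma> t (snd M)) \<in> cube_loops n M" using eval_loop[OF \<gamma>(2) m0] by simp
    have "\<gamma> t (snd M) = adjoint_loop X (loop_of Y ?F) t" if t: "t \<in> topspace (cube n)" for t
    proof -
      have "\<gamma> t (snd M) \<in> topspace (fst M)" using l t by (auto simp: cube_loops_def continuous_map_def)
      then have "\<gamma> t (snd M) \<in> extensional (topspace X)" using null_map_component_maps[of _ X Y] unfolding M_def maps_def by blast
      then have "\<gamma> t (snd M) = restrict (\<gamma> t (snd M)) (topspace X)" by (rule extensional_restrict[symmetric])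
      also have "\<dots> = adjoint_loop X (loop_of Y ?F) t"
        by (simp add: adjoint_loop_def loop_of_def M_def null_map_component_simps)
      finally show ?thesis .
    qed
    then have "rel_homotopic (cube_pair n) M (\<lambda>t. \<gamma> t (snd M)) (adjoint_loop X (loop_of Y ?F))"
      using l by (intro rel_homotopic_eq[OF _ _ cube_boundary_subset']) (auto simp: cube_loops_eq)
    then have "C = loop_class n M (adjoint_loop X (loop_of Y ?F))" using loop_class_eq_iff[OF l] \<gamma>(1) by blast
    with F show "C \<in> {loop_class n M (adjoint_loop X (loop_of Y F)) | F. affiliated (cube_times n X) (fst Y) F}" by blast
  next
    fix C assume "C \<in> {loop_class n M (adjoint_loop X (loop_of Y F)) | F. affiliated (cube_times n X) (fst Y) F}"
    then obtain F where F: "C = loop_class n M (adjoint_loop X (loop_of Y F))" "affiliated (cube_times n X) (fst Y) F" by blast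
    let ?\<gamma> = "\<lambda>t. \<lambda>f\<in>topspace (fst M). \<lambda>x\<in>topspace X. F (f x, (t, x))"
    have "adjoint_loop X (loop_of Y F) = (\<lambda>t. ?\<gamma> t (snd M))"
    proof
      fix t show "adjoint_loop X (loop_of Y F) t = ?\<gamma> t (snd M)"
        using m0 by (auto simp: adjoint_loop_def loop_of_def M_def null_map_component_simps(2) intro!: restrict_ext)
    qed
    moreover have "?\<gamma> \<in> cube_loops n (aut1 (fst M, snd M))"
      unfolding M_def by (rule affiliated_aut1_null_component[OF n X F(2)])
    ultimately show "C \<in> (\<lambda>\<gamma>. loop_class n M (\<lambda>t. \<gamma> t (snd M))) ` cube_loops n (aut1 (fst M, snd M))"
      unfolding F(1) by (intro image_eqI) simp_all
  qed
qed

lemma gottlieb_mult_null_component: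
  assumes n: "n \<ge> 1" and X: "locally_compact_space X" "Hausdorff_space X"
    and y0: "snd Y \<in> topspace (fst Y)"
    and F: "affiliated (cube_times n X) (fst Y) F" and G: "affiliated (cube_times n X) (fst Y) G"
  defines "M \<equiv> null_map_component X Y"
  shows "loop_class n M (adjoint_loop X (loop_of Y F)) \<otimes>\<^bsub>homotopy_group n M\<^esub> loop_class n M (adjoint_loop X (loop_of Y G)) =
    loop_class n M (adjoint_loop X (loop_of Y (\<lambda>(y, k). F (G (y, k), k))))"
proof -
  have m0: "snd M \<in> topspace (fst M)" unfolding M_def by (rule null_map_component_base[OF y0])
  let ?\<gamma> = "\<lambda>t. \<lambda>f\<in>topspace (fst M). \<lambda>x\<in>topspace X. F (f x, (t, x))"
  let ?\<beta> = "adjoint_loop X (loop_of Y G)"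
  let ?FG = "\<lambda>(y, k). F (G (y, k), k)"
  have \<gamma>: "?\<gamma> \<in> cube_loops n (aut1 (fst M, snd M))"
    unfolding M_def by (rule affiliated_aut1_null_component[OF n X F])
  have \<beta>: "?\<beta> \<in> cube_loops n (fst M, snd M)"
    using adjoint_loop_cube_loops[OF n based_map_loop_of[OF G y0]] by (simp add: M_def)
  have FG: "adjoint_loop X (loop_of Y ?FG) \<in> cube_loops n M"
    using adjoint_loop_cube_loops[OF n based_map_loop_of[OF affiliated_compose[OF F G] y0]] by (simp add: M_def)
  have "adjoint_loop X (loop_of Y F) = (\<lambda>t. ?\<gamma> t (snd M))"
  proof
    fix t show "adjoint_loop X (loop_of Y F) t = ?\<gamma> t (snd M)"
      using m0 by (auto simp: adjoint_loop_def loop_of_def M_def null_map_component_simps(2) intro!: restrict_ext)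
  qed
  then have "loop_class n M (adjoint_loop X (loop_of Y F)) \<otimes>\<^bsub>homotopy_group n M\<^esub> loop_class n M ?\<beta> =
      loop_class n M (\<lambda>t. ?\<gamma> t (?\<beta> t))"
    using gottlieb_group_mult[OF n m0 \<gamma> \<beta>] by simp
  also have "\<dots> = loop_class n M (adjoint_loop X (loop_of Y ?FG))"
  proof -
    have "adjoint_loop X (loop_of Y ?FG) t = ?\<gamma> t (?\<beta> t)" if t: "t \<in> topspace (cube n)" for t
    proof -
      have "?\<beta> t \<in> topspace (fst M)" using \<beta> t by (auto simp: cube_loops_def continuous_map_def)
      then show ?thesis by (auto simp: adjoint_loop_def loop_of_def intro!: restrict_ext)
    qed
    then have "rel_homotopic (cube_pair n) M (adjoint_loop X (loop_of Y ?FG)) (\<lambda>t. ?\<gamma> t (?\<beta> t))"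
      using FG by (intro rel_homotopic_eq[OF _ _ cube_boundary_subset']) (auto simp: cube_loops_eq)
    then show ?thesis using loop_class_eq_iff[OF FG] by blast
  qed
  finally show ?thesis .
qed

section \<open>The decomposition\<close>

lemma carrier_sum_group_finite:
  assumes "finite I" "\<And>i. i \<in> I \<Longrightarrow> group (G i)"
  shows "carrier (sum_group I G) = (\<Pi>\<^sub>E i\<in>I. carrier (G i))"
  using assms by (simp add: carrier_sum_group)

lemma finite_all_tuples: "finite (all_tuples N k)"
proof (induction N)
  case (Suc N)
  then have "finite (Sigma {0..k (Suc N)} (\<lambda>_. all_tuples N k))" by simp
  then show ?case using bij_betw_finite[OF all_tuples_Suc_bij] by blast
qed (simp add: all_tuples_0)

text \<open>The first components are distinct elements of \<open>{1..N}\<close>; this bounds the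
  range of \<open>r\<close> in the outer sum.\<close>

lemma length_all_tuples: "ts \<in> all_tuples N k \<Longrightarrow> length ts \<le> N"
proof -
  assume ts: "ts \<in> all_tuples N k"
  then have "sorted_wrt (<) (map fst ts)" by (simp add: all_tuples_def)
  then have "distinct (map fst ts)" by (metis strict_sorted_iff)
  then have "length ts = card (set (map fst ts))" using distinct_card by fastforce
  also have "\<dots> \<le> card {1..N}" using ts by (intro card_mono) (auto simp: all_tuples_def)
  finally show ?thesis by simp
qed

lemma index_tuples_eq: "index_tuples N k r = {ts \<in> all_tuples N k. length ts = r}"
  by (auto simp: index_tuples_def all_tuples_def)

lemma finite_index_tuples: "finite (index_tuples N k r)"
  by (simp add: index_tuples_eq finite_all_tuples)

lemma Nil_all_tuples: "[] \<in> all_tuples N k"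
  by (simp add: all_tuples_def)

text \<open>The result is a jointly injective and jointly surjective family of homomorphisms rather
  than one isomorphism, so that the index set can be regrouped afterwards.\<close>

theorem gottlieb_decomposition:
  fixes X :: "'x topology" and Y :: "'b based_space" and J :: "'j set" and e :: "'j \<Rightarrow> nat"
  assumes n: "n \<ge> 1" and X: "locally_compact_space X" "Hausdorff_space X" "topspace X \<noteq> {}"
    and Y: "admissible_space Y"
    and eq: "pair_equiv (cube_times n X) (pair_wedge J (\<lambda>j. cube_pair (n + e j)))"
    and J: "J \<noteq> {}"
  obtains \<Theta> where
    "\<And>j. j \<in> J \<Longrightarrow> \<Theta> j \<in> hom (gottlieb_group n (null_map_component X Y)) (gottlieb_group (n + e j) Y)"
    "\<And>C C'. \<lbrakk>C \<in> carrier (gottlieb_group n (null_map_component X Y));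
       C' \<in> carrier (gottlieb_group n (null_map_component X Y)); \<And>j. j \<in> J \<Longrightarrow> \<Theta> j C = \<Theta> j C'\<rbrakk> \<Longrightarrow> C = C'"
    "\<And>g. (\<And>j. j \<in> J \<Longrightarrow> g j \<in> carrier (gottlieb_group (n + e j) Y)) \<Longrightarrow>
       \<exists>C \<in> carrier (gottlieb_group n (null_map_component X Y)). \<forall>j\<in>J. \<Theta> j C = g j"
proof -
  let ?P = "cube_times n X"
  let ?Q = "\<lambda>j. cube_pair (n + e j)"
  let ?W = "pair_wedge J ?Q"
  define M where "M = null_map_component X Y"
  have y0: "snd Y \<in> topspace (fst Y)" and Ylc: "locally_compact_space (fst Y)" "Hausdorff_space (fst Y)"
    and Ypc: "path_connected_space (fst Y)"
    using Y by (auto simp: admissible_space_def)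
  have nn: "n + e j \<ge> 1" for j using n by simp
  have P: "proper_pair ?P" by (rule proper_cube_times[OF n X(3)])
  have Q: "proper_pair (?Q j)" for j by (rule proper_cube_pair[OF nn])
  have W: "proper_pair ?W" by (intro proper_pair_wedge Q J)
  have QL: "snd (?Q j) \<subseteq> pt_set (?Q j)" for j using Q by (simp add: proper_pair_def)
  have PL: "snd ?P \<subseteq> pt_set ?P" using P by (simp add: proper_pair_def)
  obtain \<psi> \<theta> where \<psi>: "pair_map ?P ?W \<psi>" and \<theta>: "pair_map ?W ?P \<theta>"
    and h1: "pair_homotopic ?P ?P (\<theta> \<circ> \<psi>) id" and h2: "pair_homotopic ?W ?W (\<psi> \<circ> \<theta>) id"
    using eq unfolding pair_equiv_def by blast
  have \<theta>j: "pair_map (?Q j) ?P (\<lambda>s. \<theta> (j, s))" if "j \<in> J" for j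
    using pair_map_compose[OF pair_map_into_wedge[OF that, of ?Q] \<theta> W] by (simp add: o_def)
  have carM: "carrier (gottlieb_group n M) = {loop_class n M (adjoint_loop X (loop_of Y F)) | F. affiliated ?P (fst Y) F}"
    unfolding M_def by (rule carrier_gottlieb_null_component[OF n X(1,2) Ylc Ypc y0])
  have carY: "carrier (gottlieb_group (n + e j) Y) = {loop_class (n + e j) Y (loop_of Y F) | F. affiliated (?Q j) (fst Y) F}" for j
    by (rule carrier_gottlieb_affiliated[OF nn y0 Ylc])
  \<comment> \<open>Restriction along the \<open>j\<close>-th sphere of the wedge, mapped by
    \<open>\<theta>\<close> to \<open>S^n \<and> X_+\<close>.\<close>
  define res where "res j F = (\<lambda>(y, s). F (y, \<theta> (j, s)))" for j and F :: "'b \<times> ((nat \<Rightarrow> real) \<times> 'x) \<Rightarrow> 'b"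
  have res: "affiliated (?Q j) (fst Y) (res j F)" if "j \<in> J" "affiliated ?P (fst Y) F" for j F
    unfolding res_def by (rule affiliated_pair_map[OF that(2) \<theta>j[OF that(1)] P Ylc])
  have lr: "loop_of Y (res j F) = loop_of Y F \<circ> (\<lambda>s. \<theta> (j, s))" for j F
    by (auto simp: loop_of_def res_def)
  have loopM: "adjoint_loop X (loop_of Y F) \<in> cube_loops n M" if "affiliated ?P (fst Y) F" for F
    unfolding M_def by (rule adjoint_loop_cube_loops[OF n based_map_loop_of[OF that y0]])
  have classM: "loop_class n M (adjoint_loop X (loop_of Y F)) = loop_class n M (adjoint_loop X (loop_of Y F')) \<longleftrightarrow>
      rel_homotopic ?P Y (loop_of Y F) (loop_of Y F')" if "affiliated ?P (fst Y) F" "affiliated ?P (fst Y) F'" for F F'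
    using loop_class_eq_iff[OF loopM[OF that(1)]]
      rel_homotopic_adjoint[OF n X(1,2) based_map_loop_of[OF that(1) y0] based_map_loop_of[OF that(2) y0]]
    by (simp add: M_def)
  have classY: "loop_class (n + e j) Y (loop_of Y F) = loop_class (n + e j) Y g \<longleftrightarrow>
      rel_homotopic (?Q j) Y (loop_of Y F) g" if "affiliated (?Q j) (fst Y) F" for F g j
    using based_map_loop_of[OF that y0] by (intro loop_class_eq_iff) (simp add: cube_loops_eq)
  have res_inj: "rel_homotopic ?P Y (loop_of Y F) (loop_of Y F') \<longleftrightarrow>
      (\<forall>j\<in>J. rel_homotopic (?Q j) Y (loop_of Y (res j F)) (loop_of Y (res j F')))"
    if F: "affiliated ?P (fst Y) F" and F': "affiliated ?P (fst Y) F'" for F F'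
  proof
    assume "rel_homotopic ?P Y (loop_of Y F) (loop_of Y F')"
    then show "\<forall>j\<in>J. rel_homotopic (?Q j) Y (loop_of Y (res j F)) (loop_of Y (res j F'))"
      unfolding lr using rel_homotopic_compose_pair_map[OF _ \<theta>j Q P] by blast
  next
    assume "\<forall>j\<in>J. rel_homotopic (?Q j) Y (loop_of Y (res j F)) (loop_of Y (res j F'))"
    then have "rel_homotopic ?W Y (loop_of Y F \<circ> \<theta>) (loop_of Y F' \<circ> \<theta>)"
      unfolding lr by (intro rel_homotopic_from_wedge Q) (simp add: o_def)
    \<comment> \<open>Homotopies on all spheres assemble on the wedge; pulling back along
      \<open>\<psi>\<close> and using \<open>\<theta> \<circ> \<psi> \<simeq> id\<close> recovers
      the maps on the original pair.\<close>
    from rel_homotopic_compose_pair_map[OF this \<psi> P W]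
    have "rel_homotopic ?P Y (loop_of Y F \<circ> (\<theta> \<circ> \<psi>)) (loop_of Y F' \<circ> (\<theta> \<circ> \<psi>))" by (simp add: o_assoc)
    moreover have "rel_homotopic ?P Y (loop_of Y G \<circ> (\<theta> \<circ> \<psi>)) (loop_of Y G)" if "affiliated ?P (fst Y) G" for G
      using rel_homotopic_pair_homotopic[OF h1 based_map_loop_of[OF that y0] P P] by simp
    ultimately show "rel_homotopic ?P Y (loop_of Y F) (loop_of Y F')"
      using F F' by (blast intro: rel_homotopic_sym rel_homotopic_trans)
  qed
  \<comment> \<open>Restriction acts on affiliated maps, whereas the group consists of classes of
    loops; a representative is chosen, and its choice is immaterial by
    \<open>res_inj\<close>.\<close>
  define rep where "rep C = (SOME F. affiliated ?P (fst Y) F \<and> C = loop_class n M (adjoint_loop X (loop_of Y F)))" for C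
  have rep: "affiliated ?P (fst Y) (rep C) \<and> C = loop_class n M (adjoint_loop X (loop_of Y (rep C)))"
    if "C \<in> carrier (gottlieb_group n M)" for C
  proof -
    have "\<exists>F. affiliated ?P (fst Y) F \<and> C = loop_class n M (adjoint_loop X (loop_of Y F))"
      using that unfolding carM by blast
    then show ?thesis unfolding rep_def by (rule someI_ex)
  qed
  define \<Theta> where "\<Theta> j C = loop_class (n + e j) Y (loop_of Y (res j (rep C)))" for j C
  have \<Theta>: "\<Theta> j (loop_class n M (adjoint_loop X (loop_of Y F))) = loop_class (n + e j) Y (loop_of Y (res j F))"
    if F: "affiliated ?P (fst Y) F" and j: "j \<in> J" for F j
  proof -
    let ?C = "loop_class n M (adjoint_loop X (loop_of Y F))"
    have "?C \<in> carrier (gottlieb_group n M)" using F unfolding carM by blast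
    note r = rep[OF this]
    have "rel_homotopic ?P Y (loop_of Y (rep ?C)) (loop_of Y F)"
      using classM[THEN iffD1, OF _ F, of "rep ?C"] r by (auto dest: sym)
    then have "rel_homotopic (?Q j) Y (loop_of Y (res j (rep ?C))) (loop_of Y (res j F))"
      using res_inj[of "rep ?C" F] r F j by blast
    then show ?thesis unfolding \<Theta>_def using classY[OF res[OF j, of "rep ?C"]] r by blast
  qed
  show ?thesis
  proof (rule that[of \<Theta>, folded M_def])
    show "\<Theta> j \<in> hom (gottlieb_group n M) (gottlieb_group (n + e j) Y)" if j: "j \<in> J" for j
    proof (rule homI)
      fix C assume C: "C \<in> carrier (gottlieb_group n M)"
      obtain F where F: "C = loop_class n M (adjoint_loop X (loop_of Y F))" "affiliated ?P (fst Y) F"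
        using C unfolding carM by blast
      show "\<Theta> j C \<in> carrier (gottlieb_group (n + e j) Y)"
        unfolding F(1) \<Theta>[OF F(2) j] carY using res[OF j F(2)] by blast
      fix C' assume C': "C' \<in> carrier (gottlieb_group n M)"
      obtain F' where F': "C' = loop_class n M (adjoint_loop X (loop_of Y F'))" "affiliated ?P (fst Y) F'"
        using C' unfolding carM by blast
      have "C \<otimes>\<^bsub>gottlieb_group n M\<^esub> C' = loop_class n M (adjoint_loop X (loop_of Y (\<lambda>(y, k). F (F' (y, k), k))))"
        unfolding F(1) F'(1) mult_gottlieb_group M_def
        by (rule gottlieb_mult_null_component[OF n X(1,2) y0 F(2) F'(2)])
      then have "\<Theta> j (C \<otimes>\<^bsub>gottlieb_group n M\<^esub> C') =
          loop_class (n + e j) Y (loop_of Y (res j (\<lambda>(y, k). F (F' (y, k), k))))"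
        using \<Theta>[OF affiliated_compose[OF F(2) F'(2)] j] by simp
      \<comment> \<open>Composition happens at each point \<open>k\<close> separately, so
        restriction commutes with it on the nose.\<close>
      also have "res j (\<lambda>(y, k). F (F' (y, k), k)) = (\<lambda>(y, k). res j F (res j F' (y, k), k))"
        by (auto simp: res_def)
      also have "loop_class (n + e j) Y (loop_of Y (\<lambda>(y, k). res j F (res j F' (y, k), k))) =
          \<Theta> j C \<otimes>\<^bsub>gottlieb_group (n + e j) Y\<^esub> \<Theta> j C'"
        unfolding F(1) F'(1) \<Theta>[OF F(2) j] \<Theta>[OF F'(2) j] mult_gottlieb_group
        by (rule gottlieb_mult_compose[OF nn y0 res[OF j F(2)] res[OF j F'(2)], symmetric])
      finally show "\<Theta> j (C \<otimes>\<^bsub>gottlieb_group n M\<^esub> C') = \<Theta> j C \<otimes>\<^bsub>gottlieb_group (n + e j) Y\<^esub> \<Theta> j C'" .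
    qed
    show "C = C'" if C: "C \<in> carrier (gottlieb_group n M)" and C': "C' \<in> carrier (gottlieb_group n M)"
      and same: "\<And>j. j \<in> J \<Longrightarrow> \<Theta> j C = \<Theta> j C'" for C C'
    proof -
      obtain F where F: "C = loop_class n M (adjoint_loop X (loop_of Y F))" "affiliated ?P (fst Y) F"
        using C unfolding carM by blast
      obtain F' where F': "C' = loop_class n M (adjoint_loop X (loop_of Y F'))" "affiliated ?P (fst Y) F'"
        using C' unfolding carM by blast
      have "rel_homotopic (?Q j) Y (loop_of Y (res j F)) (loop_of Y (res j F'))" if "j \<in> J" for j
        using same[OF that] unfolding F(1) F'(1) \<Theta>[OF F(2) that] \<Theta>[OF F'(2) that] classY[OF res[OF that F(2)]] .
      then show ?thesis unfolding F(1) F'(1) classM[OF F(2) F'(2)] res_inj[OF F(2) F'(2)] by blast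
    qed
    show "\<exists>C \<in> carrier (gottlieb_group n M). \<forall>j\<in>J. \<Theta> j C = g j"
      if g: "\<And>j. j \<in> J \<Longrightarrow> g j \<in> carrier (gottlieb_group (n + e j) Y)" for g
    proof -
      have "\<forall>j\<in>J. \<exists>G. g j = loop_class (n + e j) Y (loop_of Y G) \<and> affiliated (?Q j) (fst Y) G"
        using g unfolding carY by blast
      from bchoice[OF this] obtain G where
        "\<forall>j\<in>J. g j = loop_class (n + e j) Y (loop_of Y (G j)) \<and> affiliated (?Q j) (fst Y) (G j)" ..
      then have G: "\<And>j. j \<in> J \<Longrightarrow> g j = loop_class (n + e j) Y (loop_of Y (G j))"
        "\<And>j. j \<in> J \<Longrightarrow> affiliated (?Q j) (fst Y) (G j)" by blast+
      \<comment> \<open>The affiliated maps on the separate spheres are defined on disjoint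
        summands, so together they form one affiliated map on the wedge; pulling it back along
        \<open>\<psi>\<close> gives the preimage.\<close>
      define GW where "GW = (\<lambda>(y, j, s). G j (y, s))"
      have GW: "affiliated ?W (fst Y) GW"
        unfolding affiliated_def fst_pair_wedge GW_def
      proof (intro conjI)
        show "continuous_map (prod_topology (fst Y) (sum_topology (\<lambda>i. fst (cube_pair (n + e i))) J)) (fst Y) (\<lambda>(y, j, s). G j (y, s))"
          by (rule continuous_map_from_prod_sum_topology)
            (use G(2) in \<open>auto simp: affiliated_def case_prod_unfold\<close>)
      qed (use G(2) in \<open>auto simp: affiliated_def\<close>)
      define F where "F = (\<lambda>(y, k). GW (y, \<psi> k))"
      have F: "affiliated ?P (fst Y) F"
        unfolding F_def by (rule affiliated_pair_map[OF GW \<psi> W Ylc])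
      have "loop_class (n + e j) Y (loop_of Y (res j F)) = g j" if j: "j \<in> J" for j
      proof -
        \<comment> \<open>The other composite, \<open>\<psi> \<circ> \<theta> \<simeq> id\<close>,
          shows that restricting the pulled-back map returns each given class.\<close>
        have "rel_homotopic ?W Y (loop_of Y GW \<circ> (\<psi> \<circ> \<theta>)) (loop_of Y GW \<circ> id)"
          by (rule rel_homotopic_pair_homotopic[OF h2 based_map_loop_of[OF GW y0] W W])
        from rel_homotopic_compose_pair_map[OF this pair_map_into_wedge[OF j, of ?Q] Q W]
        have "rel_homotopic (?Q j) Y (loop_of Y (res j F)) (loop_of Y (G j))"
          by (simp add: o_def loop_of_def[abs_def] res_def F_def GW_def)
        then show ?thesis unfolding G(1)[OF j] classY[OF res[OF j F]] .
      qed
      then have "\<forall>j\<in>J. \<Theta> j (loop_class n M (adjoint_loop X (loop_of Y F))) = g j" using \<Theta>[OF F] by simp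
      moreover have "loop_class n M (adjoint_loop X (loop_of Y F)) \<in> carrier (gottlieb_group n M)"
        using F unfolding carM by blast
      ultimately show ?thesis by blast
    qed
  qed
qed

theorem theorem3p3:
  fixes N n :: nat
    and X :: "nat \<Rightarrow> 'a based_space"
    and Y :: "'b based_space"
    and k :: "nat \<Rightarrow> nat"
    and d :: "nat \<Rightarrow> nat \<Rightarrow> nat"
  assumes "N \<ge> 1"
    and "\<And>i. i \<in> {1..N} \<Longrightarrow> admissible_space (X i)"
    and "admissible_space Y"
    and "\<And>i m. i \<in> {1..N} \<Longrightarrow> m \<in> {1..k i} \<Longrightarrow> d i m \<ge> 1"
    and "\<And>i. i \<in> {1..N} \<Longrightarrow>
           reduced_suspension (X i) \<simeq>\<^sub>* wedge {1..k i} (\<lambda>m. based_sphere (d i m + 1))"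
    and "n \<ge> 1"
  shows "gottlieb_group n (null_map_component (product_topology (\<lambda>i. fst (X i)) {1..N}) Y) \<cong>
         gottlieb_group n Y \<times>\<times>
           sum_group {1..N} (\<lambda>r.
             sum_group (index_tuples N k r) (\<lambda>ts.
               gottlieb_group (n + (\<Sum>(i, m)\<leftarrow>ts. d i m)) Y))"
proof -
  let ?X = "product_topology (\<lambda>i. fst (X i)) {1..N}"
  let ?J = "all_tuples N k"
  let ?M = "null_map_component ?X Y"
  let ?GM = "gottlieb_group n ?M"
  let ?G = "\<lambda>ts. gottlieb_group (n + tuple_dim d ts) Y"
  let ?S = "\<lambda>r. sum_group (index_tuples N k r) ?G"
  have X: "locally_compact_space ?X" "Hausdorff_space ?X"
    using assms(2) by (auto simp: locally_compact_space_product_topology Hausdorff_space_product_topology admissible_space_def)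
  have "topspace (fst (X i)) \<noteq> {}" if "i \<in> {1..N}" for i
    using assms(2)[OF that] by (auto simp: admissible_space_def)
  then have Xne: "topspace ?X \<noteq> {}" by (auto simp: PiE_eq_empty_iff)
  have eq: "pair_equiv (cube_times n ?X) (pair_wedge ?J (\<lambda>ts. cube_pair (n + tuple_dim d ts)))"
    by (rule pair_equiv_cube_product[OF assms(2,5,6)])
  obtain \<Theta> where hom: "\<And>ts. ts \<in> ?J \<Longrightarrow> \<Theta> ts \<in> hom ?GM (?G ts)"
    and inj: "\<And>C C'. \<lbrakk>C \<in> carrier ?GM; C' \<in> carrier ?GM; \<And>ts. ts \<in> ?J \<Longrightarrow> \<Theta> ts C = \<Theta> ts C'\<rbrakk> \<Longrightarrow> C = C'"
    and surj: "\<And>g. (\<And>ts. ts \<in> ?J \<Longrightarrow> g ts \<in> carrier (?G ts)) \<Longrightarrow> \<exists>C\<in>carrier ?GM. \<forall>ts\<in>?J. \<Theta> ts C = g ts"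
    by (rule gottlieb_decomposition[OF assms(6) X Xne assms(3) eq]) (use Nil_all_tuples in blast)+
  have grp: "group (?G ts)" for ts
    using assms(3,6) by (intro group_gottlieb_group) (auto simp: admissible_space_def)
  \<comment> \<open>There are finitely many tuples, so finite support is automatic and the direct
    sum is the full product of extensional functions.\<close>
  have carS: "carrier (?S r) = (\<Pi>\<^sub>E ts\<in>index_tuples N k r. carrier (?G ts))" for r
    by (rule carrier_sum_group_finite[OF finite_index_tuples grp])
  have grpS: "group (?S r)" for r using grp by simp
  have carT: "carrier (sum_group {1..N} ?S) = (\<Pi>\<^sub>E r\<in>{1..N}. carrier (?S r))"
    by (rule carrier_sum_group_finite[OF _ grpS]) simp
  have d0: "tuple_dim d [] = 0" by (simp add: tuple_dim_def)
  have Jr: "ts \<in> ?J" if "ts \<in> index_tuples N k r" for ts r using that by (simp add: index_tuples_eq)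
  have Jc: "ts = [] \<or> length ts \<in> {1..N} \<and> ts \<in> index_tuples N k (length ts)" if "ts \<in> ?J" for ts
    using that length_all_tuples[OF that] by (cases ts) (auto simp: index_tuples_eq)
  \<comment> \<open>The empty tuple gives the separate summand \<open>G_n(Y)\<close>; the other
    tuples are grouped by their length \<open>r\<close>.\<close>
  define h where "h C = (\<Theta> [] C, \<lambda>r\<in>{1..N}. \<lambda>ts\<in>index_tuples N k r. \<Theta> ts C)" for C
  have in_car: "\<Theta> ts C \<in> carrier (?G ts)" if "ts \<in> ?J" "C \<in> carrier ?GM" for ts C
    using hom[OF that(1)] that(2) by (rule hom_in_carrier)
  have mult: "\<Theta> ts (C \<otimes>\<^bsub>?GM\<^esub> C') = \<Theta> ts C \<otimes>\<^bsub>?G ts\<^esub> \<Theta> ts C'"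
    if "ts \<in> ?J" "C \<in> carrier ?GM" "C' \<in> carrier ?GM" for ts C C'
    using hom[OF that(1)] that(2,3) by (rule hom_mult)
  let ?R = "gottlieb_group n Y \<times>\<times> sum_group {1..N} ?S"
  have "h \<in> iso ?GM ?R"
  proof (rule isoI)
    show "h \<in> hom ?GM ?R"
    proof (rule homI)
      show "h C \<in> carrier ?R" if C: "C \<in> carrier ?GM" for C
        using in_car[OF Nil_all_tuples C] in_car[OF Jr C]
        by (auto simp: h_def DirProd_def carT carS d0 simp del: One_nat_def)
      show "h (C \<otimes>\<^bsub>?GM\<^esub> C') = h C \<otimes>\<^bsub>?R\<^esub> h C'" if C: "C \<in> carrier ?GM" "C' \<in> carrier ?GM" for C C'
        using mult[OF Nil_all_tuples C] mult[OF Jr C]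
        by (auto simp: h_def DirProd_def d0 intro!: restrict_ext)
    qed
    show "bij_betw h (carrier ?GM) (carrier ?R)"
      unfolding bij_betw_def
    proof
      show "inj_on h (carrier ?GM)"
      proof (rule inj_onI)
        fix C C' assume C: "C \<in> carrier ?GM" "C' \<in> carrier ?GM" and hh: "h C = h C'"
        show "C = C'"
        proof (rule inj[OF C])
          fix ts assume "ts \<in> ?J"
          from Jc[OF this] show "\<Theta> ts C = \<Theta> ts C'"
          proof
            assume "length ts \<in> {1..N} \<and> ts \<in> index_tuples N k (length ts)"
            moreover have "snd (h C) (length ts) ts = snd (h C') (length ts) ts" using hh by simp
            ultimately show ?thesis by (simp add: h_def)
          qed (use hh in \<open>simp add: h_def\<close>)
        qed
      qed
      show "h ` carrier ?GM = carrier ?R"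
      proof
        show "h ` carrier ?GM \<subseteq> carrier ?R"
          using hom_in_carrier[OF \<open>h \<in> hom ?GM ?R\<close>] by blast
        show "carrier ?R \<subseteq> h ` carrier ?GM"
        proof
          fix z assume "z \<in> carrier ?R"
          then obtain a b where z: "z = (a, b)" and a: "a \<in> carrier (gottlieb_group n Y)"
            and b: "b \<in> (\<Pi>\<^sub>E r\<in>{1..N}. \<Pi>\<^sub>E ts\<in>index_tuples N k r. carrier (?G ts))"
            by (auto simp: DirProd_def carT carS simp del: One_nat_def)
          \<comment> \<open>The regrouping is undone: a nonempty tuple finds its component in the
            block given by its own length.\<close>
          define g where "g ts = (if ts = [] then a else b (length ts) ts)" for ts
          have "g ts \<in> carrier (?G ts)" if "ts \<in> ?J" for ts
            using Jc[OF that] a b by (auto simp: g_def d0 PiE_iff)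
          from surj[of g, OF this] obtain C where C: "C \<in> carrier ?GM" "\<forall>ts\<in>?J. \<Theta> ts C = g ts" by blast
          have "(\<lambda>r\<in>{1..N}. \<lambda>ts\<in>index_tuples N k r. \<Theta> ts C) = b"
          proof (rule PiE_ext[OF _ b])
            show "(\<lambda>r\<in>{1..N}. \<lambda>ts\<in>index_tuples N k r. \<Theta> ts C) \<in> (\<Pi>\<^sub>E r\<in>{1..N}. \<Pi>\<^sub>E ts\<in>index_tuples N k r. carrier (?G ts))"
              using in_car[OF Jr C(1)] by auto
            fix r assume r: "r \<in> {1..N}"
            have br: "b r \<in> (\<Pi>\<^sub>E ts\<in>index_tuples N k r. carrier (?G ts))" using b r by (rule PiE_mem)
            have "(\<lambda>ts\<in>index_tuples N k r. \<Theta> ts C) = b r"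
            proof (rule PiE_ext[OF _ br])
              show "(\<lambda>ts\<in>index_tuples N k r. \<Theta> ts C) \<in> (\<Pi>\<^sub>E ts\<in>index_tuples N k r. carrier (?G ts))"
                using in_car[OF Jr C(1)] by auto
              show "(\<lambda>ts\<in>index_tuples N k r. \<Theta> ts C) ts = b r ts" if ts: "ts \<in> index_tuples N k r" for ts
                using C(2) Jr[OF ts] ts r by (auto simp: g_def index_tuples_eq)
            qed
            then show "(\<lambda>r\<in>{1..N}. \<lambda>ts\<in>index_tuples N k r. \<Theta> ts C) r = b r" using r by simp
          qed
          moreover have "\<Theta> [] C = a" using C(2) Nil_all_tuples by (auto simp: g_def)
          ultimately have "z = h C" by (simp add: h_def z)
          then show "z \<in> h ` carrier ?GM" using C(1) by blast
        qed
      qed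
    qed
  qed
  then show ?thesis unfolding is_iso_def tuple_dim_def by blast
qed

end
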